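(* Let $E$ be a Polish space and let $M\subset\mathcal{P}(E)$ be a nonempty, convex and weakly compact set. For each $n\ge1$ let $M_n\subset\mathcal{P}(E^n)$ be the associated set of laws (defined in the context). For every bounded continuous $F:\mathcal{P}(E)\to\mathbb{R}$, $$\lim_{n\to\infty}\sup_{\mu\in M_n}\frac1n\log\int_{E^n}e^{nF\circ L_n}\,d\mu=\sup_{\nu\in\mathcal{P}(E),\,\mu\in M}\big(F(\nu)-H(\nu|\mu)\big).$$ For every closed set $A\subset\mathcal{P}(E)$, $$\limsup_{n\to\infty}\sup_{\mu\in M_n}\frac1n\log\mu(L_n\in A)\le-\inf\{H(\nu|\mu):\nu\in A,\ \mu\in M\}.$$
   Context: $\mathcal{P}(E)$ is the set of Borel probability measures on $E$ with the weak topology. $H(\nu|\mu)=\int\log(d\nu/d\mu)\,d\nu$ if $\nu\ll\mu$, and $H(\nu|\mu)=\infty$ otherwise. For $\mu\in\mathcal{P}(E^n)$ define $\mu_{0,1}\in\mathcal{P}(E)$ and measurable $\mu_{k-1,k}:E^{k-1}\to\mathcal{P}(E)$, $k=2,\dots,n$ (unique up to $\mu$-a.s. equality), by the disintegration $\mu(dx_1,\dots,dx_n)=\mu_{0,1}(dx_1)\prod_{k=2}^n\mu_{k-1,k}(x_1,\dots,x_{k-1})(dx_k)$. $M_n$ is the set of $\mu\in\mathcal{P}(E^n)$ with $\mu_{0,1}\in M$ and $\mu_{k-1,k}(x_1,\dots,x_{k-1})\in M$ for all $k=2,\dots,n$ and all $x_1,\dots,x_{n-1}\in E$, for some version of the conditional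 laws (equivalently, $\mu$-almost surely). $L_n(x_1,\dots,x_n)=\frac1n\sum_{i=1}^n\delta_{x_i}$. Conventions: $\log0=-\infty$, $\inf\emptyset=\infty$. *)

theory Defs
  imports "HOL-Probability.Probability"
begin

text \<open>\<open>space (prob_algebra borel)\<close> is the set of Borel probability measures. For a Polish space,
  the sigma-algebra of \<open>prob_algebra borel\<close> is the Borel one of the weak topology, and
  \<open>\<Pi>\<^sub>M i\<in>{..<n}. borel\<close> is the Borel sigma-algebra of the \<open>n\<close>-fold product.\<close>

abbreviation prob_measures :: "'a::topological_space measure set" where
  "prob_measures \<equiv> space (prob_algebra borel)"

abbreviation borel_power :: "nat \<Rightarrow> (nat \<Rightarrow> 'a::topological_space) measure" where
  "borel_power n \<equiv> \<Pi>\<^sub>M i\<in>{..<n}. borel"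

definition weak_topology :: "'a::topological_space measure topology" where
  "weak_topology = topology_generated_by
     {{\<nu> \<in> prob_measures. (\<integral>x. f x \<partial>\<nu>) \<in> U} | (f :: 'a \<Rightarrow> real) U.
        continuous_on UNIV f \<and> bounded (range f) \<and> open U}"

lemma topspace_weak_topology [simp]: "topspace weak_topology = prob_measures"
proof -
  have "prob_measures \<in> {{\<nu> \<in> prob_measures. (\<integral>x. f x \<partial>\<nu>) \<in> U} | (f :: 'a \<Rightarrow> real) U.
      continuous_on UNIV f \<and> bounded (range f) \<and> open U}"
    by (rule CollectI, rule exI[of _ "\<lambda>_. 0"], rule exI[of _ UNIV]) auto
  then show ?thesis
    unfolding weak_topology_def topology_generated_by_topspace by blast
qed

definition convex_measures :: "'a::topological_space measure set \<Rightarrow> bool" where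
  "convex_measures M \<longleftrightarrow> (\<forall>\<mu>\<in>M. \<forall>\<nu>\<in>M. \<forall>t\<in>{0..1}. \<exists>\<rho>\<in>M. \<forall>A\<in>sets borel.
     measure \<rho> A = t * measure \<mu> A + (1 - t) * measure \<nu> A)"

text \<open>The integral of \<open>log (d\<nu>/d\<mu>)\<close> may be \<open>\<infinity>\<close>, so it is taken as the difference of the integrals
  of the positive and negative parts; the latter is finite by \<open>nn_integral_neg_entropy_density\<close>.
  The library's \<open>KL_divergence\<close> is a Bochner integral, which would be \<open>0\<close> in the infinite case.\<close>

definition relative_entropy :: "'a measure \<Rightarrow> 'a measure \<Rightarrow> ereal" where
  "relative_entropy \<nu> \<mu> =
     (if absolutely_continuous \<mu> \<nu>
      then enn2ereal (\<integral>\<^sup>+x. ennreal (entropy_density (exp 1) \<mu> \<nu> x) \<partial>\<nu>)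
         - enn2ereal (\<integral>\<^sup>+x. ennreal (- entropy_density (exp 1) \<mu> \<nu> x) \<partial>\<nu>)
      else \<infinity>)"

lemma nn_integral_neg_entropy_density:
  assumes "prob_space \<mu>" "prob_space \<nu>" "sets \<nu> = sets \<mu>" "absolutely_continuous \<mu> \<nu>"
  shows "(\<integral>\<^sup>+x. ennreal (- entropy_density (exp 1) \<mu> \<nu> x) \<partial>\<nu>) \<le> 1"
proof -
  interpret \<mu>: prob_space \<mu> by fact
  interpret \<nu>: prob_space \<nu> by fact
  let ?f = "RN_deriv \<mu> \<nu>"
  have \<nu>: "\<nu> = density \<mu> ?f"
    using \<mu>.density_RN_deriv[OF assms(4,3)] by simp
  have "(\<integral>\<^sup>+x. ennreal (- entropy_density (exp 1) \<mu> \<nu> x) \<partial>\<nu>)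
      = (\<integral>\<^sup>+x. ?f x * ennreal (- entropy_density (exp 1) \<mu> \<nu> x) \<partial>\<mu>)"
  proof -
    have "(\<integral>\<^sup>+x. ennreal (- entropy_density (exp 1) \<mu> \<nu> x) \<partial>density \<mu> ?f)
        = (\<integral>\<^sup>+x. ?f x * ennreal (- entropy_density (exp 1) \<mu> \<nu> x) \<partial>\<mu>)"
      by (rule nn_integral_density) auto
    then show ?thesis by (simp add: \<nu>[symmetric])
  qed
  also have "\<dots> \<le> (\<integral>\<^sup>+x. 1 \<partial>\<mu>)"
  proof (rule nn_integral_mono_AE)
    have "AE x in \<mu>. ?f x \<noteq> \<infinity>"
      using \<mu>.RN_deriv_finite[OF \<nu>.sigma_finite_measure_axioms assms(4,3)] .
    then show "AE x in \<mu>. ?f x * ennreal (- entropy_density (exp 1) \<mu> \<nu> x) \<le> 1"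
    proof eventually_elim
      case (elim x)
      then obtain r where r: "?f x = ennreal r" "r \<ge> 0"
        by (cases "?f x") auto
      have "r * (- ln r) \<le> 1"
      proof (cases "r = 0")
        case False
        have "- ln r = ln (1 / r)" using r False by (simp add: ln_div)
        also have "\<dots> \<le> 1 / r" using r False ln_le_minus_one[of "1 / r"] by simp
        finally have "r * (- ln r) \<le> r * (1 / r)" using r by (intro mult_left_mono) auto
        with False show ?thesis by simp
      qed simp
      then show ?case using r
        by (simp add: entropy_density_def log_def ennreal_mult'[symmetric] del: mult_minus_right)
    qed
  qed
  finally show ?thesis by (simp add: \<mu>.emeasure_space_1)
qed

lemma relative_entropy_eq_KL_divergence:
  assumes "absolutely_continuous \<mu> \<nu>" "integrable \<nu> (entropy_density (exp 1) \<mu> \<nu>)"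
  shows "relative_entropy \<nu> \<mu> = ereal (KL_divergence (exp 1) \<mu> \<nu>)"
proof -
  let ?h = "entropy_density (exp 1) \<mu> \<nu>"
  obtain a b where "a \<ge> 0" "b \<ge> 0" "(\<integral>\<^sup>+x. ennreal (?h x) \<partial>\<nu>) = ennreal a"
    "(\<integral>\<^sup>+x. ennreal (- ?h x) \<partial>\<nu>) = ennreal b" "integral\<^sup>L \<nu> ?h = a - b"
    using assms(2) by (rule integrableE) auto
  then show ?thesis
    using assms(1) by (simp add: relative_entropy_def KL_divergence_def)
qed

text \<open>The law \<open>\<kappa> 0 (dx\<^sub>0) \<kappa> 1 x\<^sub>0 (dx\<^sub>1) \<dots> \<kappa> (n - 1) (x\<^sub>0,\<dots>,x\<^bsub>n-2\<^esub>) (dx\<^bsub>n-1\<^esub>)\<close>. Coordinates are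
  numbered from \<open>0\<close>, and the first marginal is \<open>\<kappa> 0\<close> at the only point \<open>\<lambda>_. undefined\<close> of the
  empty product.\<close>

primrec joint_law ::
  "(nat \<Rightarrow> (nat \<Rightarrow> 'a) \<Rightarrow> 'a measure) \<Rightarrow> nat \<Rightarrow> (nat \<Rightarrow> 'a::topological_space) measure" where
  "joint_law \<kappa> 0 = return (borel_power 0) (\<lambda>_. undefined)"
| "joint_law \<kappa> (Suc n) =
     joint_law \<kappa> n \<bind> (\<lambda>x. distr (\<kappa> n x) (borel_power (Suc n)) (\<lambda>y. x(n := y)))"

lemma joint_law_eq_Ionescu_Tulcea:
  assumes "Ionescu_Tulcea \<kappa> (\<lambda>_. borel)"
  shows "joint_law \<kappa> n = Ionescu_Tulcea.C \<kappa> (\<lambda>_. borel) 0 n (\<lambda>_. undefined)"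
proof -
  interpret Ionescu_Tulcea \<kappa> "\<lambda>_. borel" by fact
  show ?thesis
    by (induction n) (simp_all add: eP_def[abs_def] lessThan_atLeast0)
qed

definition laws_with_conditionals_in ::
  "'a::topological_space measure set \<Rightarrow> nat \<Rightarrow> (nat \<Rightarrow> 'a) measure set" where
  "laws_with_conditionals_in M n =
     {\<mu> \<in> space (prob_algebra (borel_power n)).
        \<exists>\<kappa>. (\<forall>k<n. \<kappa> k \<in> borel_power k \<rightarrow>\<^sub>M prob_algebra borel) \<and>
            (\<forall>k<n. \<forall>x\<in>space (borel_power k). \<kappa> k x \<in> M) \<and>
            \<mu> = joint_law \<kappa> n}"

definition empirical_measure :: "nat \<Rightarrow> (nat \<Rightarrow> 'a::topological_space) \<Rightarrow> 'a measure" where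
  "empirical_measure n x = distr (uniform_count_measure {..<n}) borel x"

lemma empirical_measure_eq_average:
  assumes "n \<ge> 1" "A \<in> sets borel"
  shows "measure (empirical_measure n x) A = (1 / n) * (\<Sum>i<n. measure (return borel (x i)) A)"
proof -
  have "measure (empirical_measure n x) A
      = measure (uniform_count_measure {..<n}) (x -` A \<inter> space (uniform_count_measure {..<n}))"
    using assms unfolding empirical_measure_def
    by (intro measure_distr) (auto simp: measurable_def)
  also have "x -` A \<inter> space (uniform_count_measure {..<n}) = {i\<in>{..<n}. x i \<in> A}"
    by (auto simp: space_uniform_count_measure)
  also have "measure (uniform_count_measure {..<n}) \<dots> = card {i\<in>{..<n}. x i \<in> A} / n"
    using measure_uniform_count_measure[of "{..<n}" "{i\<in>{..<n}. x i \<in> A}"] by auto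
  also have "real (card {i\<in>{..<n}. x i \<in> A}) = (\<Sum>i<n. indicator A (x i))"
    by (simp add: indicator_def sum.If_cases Int_def)
  finally show ?thesis
    using assms by (simp add: measure_return)
qed

definition log_ereal :: "real \<Rightarrow> ereal" where
  "log_ereal p = (if p = 0 then -\<infinity> else ereal (ln p))"

end

theory Submission
  imports Defs
begin

text \<open>
  Write \<open>log_mgf \<mu> f\<close> for \<open>log \<integral> exp f d\<mu>\<close> and \<open>sup_log_mgf M f\<close> for its supremum over \<open>\<mu> \<in> M\<close>.
  Conditioning step by step shows that \<open>\<integral> exp (f(x\<^sub>0) + \<dots> + f(x\<^bsub>n-1\<^esub>)) d\<mu> \<le> exp (n * sup_log_mgf M f)\<close>
  for every law \<open>\<mu>\<close> with conditionals in \<open>M\<close>. By Chebyshev, the probability that the empirical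
  measure lies in the half-space \<open>\<integral> f d\<nu> > c + sup_log_mgf M f\<close> is therefore at most \<open>exp (- n c)\<close>,
  whichever law is chosen.

  The upper bound for a closed set \<open>A\<close> on which all entropies exceed \<open>c\<close> follows once \<open>A\<close> is covered
  by finitely many such half-spaces with \<open>f\<close> bounded and continuous; this is \<open>half_space_cover\<close>.
  Each measure is viewed as a functional on the bounded continuous functions, so that \<open>A\<close> becomes a
  subset of a product of compact intervals, which is compact by Tychonoff's theorem. If no finite
  cover existed, some functional \<open>\<Lambda>\<close> in the closure of \<open>A\<close> would satisfy
  \<open>\<Lambda> f \<le> c + sup_log_mgf M f\<close> for all \<open>f\<close>. The expression \<open>\<Lambda> f - log_mgf \<mu> f\<close> is concave in \<open>f\<close>,
  and convex and continuous in \<open>\<mu>\<close>; as \<open>M\<close> is convex and compact, a minimax argument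
  (\<open>finite_minimax\<close>, \<open>minimax_over_measures\<close>) provides a single \<open>\<mu> \<in> M\<close> with
  \<open>\<Lambda> f \<le> c + log_mgf \<mu> f\<close> for all \<open>f\<close>. Being a limit of integrals, \<open>\<Lambda>\<close> is linear, and a linear
  functional with this bound is integration against a probability measure \<open>\<nu>\<close>: the bound makes \<open>\<Lambda>\<close> uniformly continuous for the \<open>L\<^sup>1(\<mu>)\<close> norm on bounded sets, so
  \<open>\<Lambda>\<close> extends to the bounded Borel functions (\<open>extend_to_bounded_borel\<close>), and its values on
  indicators are countably additive (\<open>represent_by_measure\<close>). The measure \<open>\<nu>\<close> lies in \<open>A\<close> because \<open>A\<close> is weakly closed, and it
  satisfies \<open>H(\<nu>|\<mu>) \<le> c\<close> by the Donsker--Varadhan formula (\<open>relative_entropy_le\<close>), a contradiction.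

  The upper bound for exponential integrals of \<open>F\<close> follows by cutting the range of \<open>F\<close> into short
  intervals (\<open>laplace_upper_bound\<close>). For the lower bound, take the product law \<open>\<mu>\<^sup>n\<close> with \<open>\<mu> \<in> M\<close>:
  the Gibbs variational inequality (\<open>gibbs_inequality_iid\<close>) bounds the normalised log-integral from
  below by \<open>\<integral> F(L\<^sub>n) d\<nu>\<^sup>n - H(\<nu>|\<mu>)\<close>, which tends to \<open>F \<nu> - H(\<nu>|\<mu>)\<close> by the weak law of large numbers.
\<close>

section \<open>A minimax inequality for finitely many functions\<close>

text \<open>The set \<open>D\<close> of pairs that dominate some \<open>(V f \<mu>, V g \<mu>)\<close> is convex. If it missed the quadrant below
  \<open>(c', c')\<close>, a separating line would have a nonnegative normal, and the combination of \<open>f\<close> and \<open>g\<close>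
  with the normalised weights would have all its values above \<open>c\<close>.
  Convexity and concavity are stated in Ky Fan's form, as existence of \<open>\<rho>\<close> and \<open>h\<close>, because this form
  passes to the sublevel sets in the induction below.\<close>

lemma two_function_minimax:
  fixes V :: "'f \<Rightarrow> 'm \<Rightarrow> real"
  assumes convex: "\<And>\<mu> \<nu> t. \<mu> \<in> M \<Longrightarrow> \<nu> \<in> M \<Longrightarrow> 0 \<le> t \<Longrightarrow> t \<le> 1 \<Longrightarrow>
      \<exists>\<rho>\<in>M. \<forall>f\<in>C. V f \<rho> \<le> t * V f \<mu> + (1 - t) * V f \<nu>"
    and concave: "\<And>f g t. f \<in> C \<Longrightarrow> g \<in> C \<Longrightarrow> 0 \<le> t \<Longrightarrow> t \<le> 1 \<Longrightarrow>
      \<exists>h\<in>C. \<forall>\<mu>\<in>M. t * V f \<mu> + (1 - t) * V g \<mu> \<le> V h \<mu>"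
    and sup_inf: "\<And>f. f \<in> C \<Longrightarrow> \<exists>\<mu>\<in>M. V f \<mu> \<le> c"
    and f: "f \<in> C" and g: "g \<in> C" and c': "c < c'"
  shows "\<exists>\<mu>\<in>M. V f \<mu> \<le> c' \<and> V g \<mu> \<le> c'"
proof (rule ccontr)
  assume neg: "\<not> ?thesis"
  define D where "D = {y :: real \<times> real. \<exists>\<mu>\<in>M. V f \<mu> \<le> fst y \<and> V g \<mu> \<le> snd y}"
  define T where "T = {y :: real \<times> real. fst y \<le> c' \<and> snd y \<le> c'}"
  have "convex D"
    unfolding convex_alt
  proof (intro ballI allI impI)
    fix y z :: "real \<times> real" and u :: real assume y: "y \<in> D" and z: "z \<in> D" and u: "0 \<le> u \<and> u \<le> 1"
    obtain \<mu> where \<mu>: "\<mu> \<in> M" "V f \<mu> \<le> fst y" "V g \<mu> \<le> snd y" using y by (auto simp: D_def)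
    obtain \<nu> where \<nu>: "\<nu> \<in> M" "V f \<nu> \<le> fst z" "V g \<nu> \<le> snd z" using z by (auto simp: D_def)
    obtain \<rho> where \<rho>: "\<rho> \<in> M" "\<And>h. h \<in> C \<Longrightarrow> V h \<rho> \<le> (1 - u) * V h \<mu> + u * V h \<nu>"
      using convex[OF \<mu>(1) \<nu>(1), of "1 - u"] u by auto
    have "V f \<rho> \<le> (1 - u) * fst y + u * fst z"
      using \<rho>(2)[OF f] \<mu> \<nu> u by (smt (verit) mult_left_mono)
    moreover have "V g \<rho> \<le> (1 - u) * snd y + u * snd z"
      using \<rho>(2)[OF g] \<mu> \<nu> u by (smt (verit) mult_left_mono)
    ultimately show "(1 - u) *\<^sub>R y + u *\<^sub>R z \<in> D"
      using \<rho>(1) by (auto simp: D_def)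
  qed
  moreover have "convex T"
  proof -
    have "T = {..c'} \<times> {..c'}" by (auto simp: T_def)
    then show ?thesis by (simp add: convex_Times)
  qed
  moreover have "D \<noteq> {}"
  proof -
    obtain \<mu> where "\<mu> \<in> M" using sup_inf[OF f] by auto
    then have "(V f \<mu>, V g \<mu>) \<in> D" by (auto simp: D_def)
    then show ?thesis by auto
  qed
  moreover have "T \<noteq> {}" by (auto simp: T_def intro!: exI[of _ c'])
  moreover have "T \<inter> D = {}" using neg by (fastforce simp: D_def T_def)
  ultimately obtain a b where a: "a \<noteq> 0" and aT: "\<And>x. x \<in> T \<Longrightarrow> inner a x \<le> b"
    and aD: "\<And>x. x \<in> D \<Longrightarrow> inner a x \<ge> b"
    using separating_hyperplane_sets[of T D] by blast
  obtain p q where pq: "a = (p, q)" by (cases a)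
  have T: "p * x + q * y \<le> b" if "x \<le> c'" "y \<le> c'" for x y
    using aT[of "(x, y)"] that by (simp add: pq T_def)
  \<comment> \<open>The quadrant \<open>T\<close> is unbounded downwards, so a half-plane that contains it has a normal
    with nonnegative entries.\<close>
  have p: "p \<ge> 0"
  proof (rule ccontr)
    assume "\<not> p \<ge> 0"
    define x where "x = min c' ((b + 1 - q * c') / p)"
    have "p * x \<ge> p * ((b + 1 - q * c') / p)"
      using \<open>\<not> p \<ge> 0\<close> by (intro mult_left_mono_neg) (auto simp: x_def)
    then have "p * x \<ge> b + 1 - q * c'" using \<open>\<not> p \<ge> 0\<close> by simp
    moreover have "p * x + q * c' \<le> b" by (rule T) (auto simp: x_def)
    ultimately show False by simp
  qed
  have q: "q \<ge> 0"
  proof (rule ccontr)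
    assume "\<not> q \<ge> 0"
    define x where "x = min c' ((b + 1 - p * c') / q)"
    have "q * x \<ge> q * ((b + 1 - p * c') / q)"
      using \<open>\<not> q \<ge> 0\<close> by (intro mult_left_mono_neg) (auto simp: x_def)
    then have "q * x \<ge> b + 1 - p * c'" using \<open>\<not> q \<ge> 0\<close> by simp
    moreover have "p * c' + q * x \<le> b" by (rule T) (auto simp: x_def)
    ultimately show False by simp
  qed
  have pq0: "p + q > 0" using a p q unfolding pq zero_prod_def by fastforce
  define t where "t = p / (p + q)"
  have t: "0 \<le> t" "t \<le> 1" "1 - t = q / (p + q)"
    using p q pq0 by (auto simp: t_def field_simps)
  obtain h where h: "h \<in> C" "\<And>\<mu>. \<mu> \<in> M \<Longrightarrow> t * V f \<mu> + (1 - t) * V g \<mu> \<le> V h \<mu>"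
    using concave[OF f g t(1,2)] by blast
  obtain \<mu> where \<mu>: "\<mu> \<in> M" "V h \<mu> \<le> c" using sup_inf[OF h(1)] by blast
  have "(p + q) * c' \<le> b" using T[of c' c'] by (simp add: algebra_simps)
  also have "b \<le> p * V f \<mu> + q * V g \<mu>"
    using aD[of "(V f \<mu>, V g \<mu>)"] \<mu>(1) by (auto simp: D_def pq)
  also have "\<dots> = (p + q) * (t * V f \<mu> + (1 - t) * V g \<mu>)"
    unfolding t(3) using pq0 by (simp add: t_def distrib_left)
  also have "\<dots> \<le> (p + q) * c"
    using h(2)[OF \<mu>(1)] \<mu>(2) pq0 by (intro mult_left_mono) auto
  finally show False using c' pq0 by simp
qed

text \<open>Functions are added one at a time: each restricts \<open>M\<close> to one of its sublevel sets, and
  \<open>two_function_minimax\<close> shows that every \<open>f \<in> C\<close> still has a small value on the restricted set.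
  Each addition costs a little of the gap between \<open>c\<close> and \<open>c'\<close>.\<close>

lemma finite_minimax:
  fixes V :: "'f \<Rightarrow> 'm \<Rightarrow> real"
  assumes "finite S" "S \<subseteq> C" "c < c'"
    and convex: "\<And>\<mu> \<nu> t. \<mu> \<in> M \<Longrightarrow> \<nu> \<in> M \<Longrightarrow> 0 \<le> t \<Longrightarrow> t \<le> 1 \<Longrightarrow>
      \<exists>\<rho>\<in>M. \<forall>f\<in>C. V f \<rho> \<le> t * V f \<mu> + (1 - t) * V f \<nu>"
    and concave: "\<And>f g t. f \<in> C \<Longrightarrow> g \<in> C \<Longrightarrow> 0 \<le> t \<Longrightarrow> t \<le> 1 \<Longrightarrow>
      \<exists>h\<in>C. \<forall>\<mu>\<in>M. t * V f \<mu> + (1 - t) * V g \<mu> \<le> V h \<mu>"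
    and sup_inf: "\<And>f. f \<in> C \<Longrightarrow> \<exists>\<mu>\<in>M. V f \<mu> \<le> c"
    and "M \<noteq> {}"
  shows "\<exists>\<mu>\<in>M. \<forall>f\<in>S. V f \<mu> \<le> c'"
  using assms
proof (induction S arbitrary: M c rule: finite_induct)
  case empty
  then show ?case by auto
next
  case (insert f S)
  obtain d where d: "c < d" "d < c'" using dense[OF insert.prems(2)] by blast
  define N where "N = {\<mu>\<in>M. V f \<mu> \<le> d}"
  have f: "f \<in> C" using insert.prems by auto
  have two: "\<exists>\<mu>\<in>N. V g \<mu> \<le> d" if "g \<in> C" for g
    using two_function_minimax[where V=V and C=C and M=M and c=c and c'=d, OF insert.prems(3-5) f that d(1)]
    by (auto simp: N_def)
  have "\<exists>\<mu>\<in>N. \<forall>f\<in>S. V f \<mu> \<le> c'"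
  proof (rule insert.IH[where c=d])
    show "S \<subseteq> C" "d < c'" using insert.prems d by auto
    show "\<exists>\<rho>\<in>N. \<forall>g\<in>C. V g \<rho> \<le> t * V g \<mu> + (1 - t) * V g \<nu>"
      if \<mu>: "\<mu> \<in> N" and \<nu>: "\<nu> \<in> N" and t: "0 \<le> t" "t \<le> 1" for \<mu> \<nu> t
    proof -
      obtain \<rho> where \<rho>: "\<rho> \<in> M" "\<forall>g\<in>C. V g \<rho> \<le> t * V g \<mu> + (1 - t) * V g \<nu>"
        using insert.prems(3)[of \<mu> \<nu> t] \<mu> \<nu> t by (auto simp: N_def)
      have "V f \<rho> \<le> t * V f \<mu> + (1 - t) * V f \<nu>" using \<rho> f by auto
      also have "\<dots> \<le> t * d + (1 - t) * d"
        using \<mu> \<nu> t by (intro add_mono mult_left_mono) (auto simp: N_def)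
      also have "\<dots> = d" by (simp add: algebra_simps)
      finally show ?thesis using \<rho> by (auto simp: N_def)
    qed
    show "\<exists>h\<in>C. \<forall>\<mu>\<in>N. t * V f \<mu> + (1 - t) * V g \<mu> \<le> V h \<mu>"
      if "f \<in> C" "g \<in> C" "0 \<le> t" "t \<le> 1" for f g t
      using insert.prems(4)[OF that] by (auto simp: N_def)
    show "\<exists>\<mu>\<in>N. V g \<mu> \<le> d" if "g \<in> C" for g using two[OF that] .
    show "N \<noteq> {}" using two[OF f] by auto
  qed
  then show ?case using d by (force simp: N_def)
qed

section \<open>Bounded test functions\<close>

definition bounded_continuous :: "('a::topological_space \<Rightarrow> real) set" where
  "bounded_continuous = {f. continuous_on UNIV f \<and> bounded (range f)}"

definition bounded_borel :: "('a::topological_space \<Rightarrow> real) set" where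
  "bounded_borel = {f \<in> borel_measurable borel. bounded (range f)}"

definition log_mgf :: "'a measure \<Rightarrow> ('a \<Rightarrow> real) \<Rightarrow> real" where
  "log_mgf \<mu> f = ln (\<integral>x. exp (f x) \<partial>\<mu>)"

lemma bounded_range_iff: "bounded (range f) \<longleftrightarrow> (\<exists>R. \<forall>x. \<bar>f x\<bar> \<le> R)" for f :: "'a \<Rightarrow> real"
  by (auto simp: bounded_iff)

lemma bounded_range_lincomb:
  assumes "bounded (range f)" "bounded (range g)"
  shows "bounded (range (\<lambda>x. a * f x + b * g x :: real))"
proof -
  obtain R S where R: "\<And>x. \<bar>f x\<bar> \<le> R" and S: "\<And>x. \<bar>g x\<bar> \<le> S"
    using assms by (auto simp: bounded_range_iff)
  have "\<bar>a * f x + b * g x\<bar> \<le> \<bar>a\<bar> * R + \<bar>b\<bar> * S" for x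
    using R[of x] S[of x]
    by (intro order_trans[OF abs_triangle_ineq] add_mono) (auto simp: abs_mult intro!: mult_left_mono)
  then show ?thesis by (auto simp: bounded_range_iff)
qed

lemma bounded_continuous_lincomb:
  "f \<in> bounded_continuous \<Longrightarrow> g \<in> bounded_continuous \<Longrightarrow> (\<lambda>x. a * f x + b * g x) \<in> bounded_continuous"
  unfolding bounded_continuous_def
  by (auto intro!: continuous_intros simp: bounded_range_lincomb)

lemma bounded_borel_lincomb:
  "f \<in> bounded_borel \<Longrightarrow> g \<in> bounded_borel \<Longrightarrow> (\<lambda>x. a * f x + b * g x) \<in> bounded_borel"
  unfolding bounded_borel_def by (auto simp: bounded_range_lincomb)

lemma bounded_continuous_subset_borel: "bounded_continuous \<subseteq> bounded_borel"
  unfolding bounded_continuous_def bounded_borel_def by (auto intro: borel_measurable_continuous_onI)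

lemma bounded_borel_bound:
  assumes "f \<in> bounded_borel"
  obtains R where "R > 0" "\<And>x. \<bar>f x\<bar> \<le> R"
proof -
  obtain R where R: "\<And>x. \<bar>f x\<bar> \<le> R" using assms by (auto simp: bounded_borel_def bounded_range_iff)
  have "\<bar>f x\<bar> \<le> \<bar>R\<bar> + 1" for x using R[of x] by linarith
  then show ?thesis by (intro that[of "\<bar>R\<bar> + 1"]) auto
qed

lemma prob_measuresD:
  assumes "\<mu> \<in> prob_measures"
  shows "prob_space \<mu>" "sets \<mu> = sets borel" "space \<mu> = UNIV"
  using assms sets_eq_imp_space_eq[of \<mu> borel] by (auto simp: space_prob_algebra)

lemma integrable_bounded_borel:
  assumes \<mu>: "\<mu> \<in> prob_measures" and f: "f \<in> bounded_borel"
  shows "integrable \<mu> f"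
proof -
  interpret prob_space \<mu> using prob_measuresD[OF \<mu>] by simp
  obtain R where "\<And>x. \<bar>f x\<bar> \<le> R" using bounded_borel_bound[OF f] by auto
  moreover have "f \<in> borel_measurable \<mu>"
    using f prob_measuresD(2)[OF \<mu>] by (simp add: bounded_borel_def cong: measurable_cong_sets)
  ultimately show ?thesis by (intro integrable_const_bound[where B=R]) auto
qed

lemma bounded_borel_exp: "f \<in> bounded_borel \<Longrightarrow> (\<lambda>x. exp (f x)) \<in> bounded_borel"
proof -
  assume f: "f \<in> bounded_borel"
  then obtain R where R: "\<And>x. \<bar>f x\<bar> \<le> R" using bounded_borel_bound[of f] by metis
  have "\<bar>exp (f x)\<bar> \<le> exp R" for x using R[of x] by simp
  then show ?thesis using f unfolding bounded_borel_def bounded_range_iff by auto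
qed

lemma bounded_borel_abs: "f \<in> bounded_borel \<Longrightarrow> (\<lambda>x. \<bar>f x\<bar>) \<in> bounded_borel"
  unfolding bounded_borel_def bounded_range_iff by auto

lemma bounded_borel_const [simp]: "(\<lambda>_. a) \<in> bounded_borel"
  unfolding bounded_borel_def bounded_range_iff by auto

lemma bounded_borel_diff: "f \<in> bounded_borel \<Longrightarrow> g \<in> bounded_borel \<Longrightarrow> (\<lambda>x. f x - g x) \<in> bounded_borel"
  using bounded_borel_lincomb[of f g 1 "-1"] by simp

lemma bounded_borel_cmult: "f \<in> bounded_borel \<Longrightarrow> (\<lambda>x. a * f x) \<in> bounded_borel"
  using bounded_borel_lincomb[of f f a 0] by simp

lemma bounded_borel_indicator: "A \<in> sets borel \<Longrightarrow> indicator A \<in> bounded_borel"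
  by (auto simp: bounded_borel_def bounded_range_iff indicator_def intro!: exI[of _ 1])

lemma abs_integral_le_bound:
  assumes \<nu>: "\<nu> \<in> prob_measures" and f: "f \<in> bounded_borel" and R: "\<And>x. \<bar>f x\<bar> \<le> R"
  shows "\<bar>\<integral>x. f x \<partial>\<nu>\<bar> \<le> R"
proof -
  interpret prob_space \<nu> using prob_measuresD[OF \<nu>] by simp
  have "\<bar>\<integral>x. f x \<partial>\<nu>\<bar> \<le> (\<integral>x. \<bar>f x\<bar> \<partial>\<nu>)" using integral_norm_bound[of \<nu> f] by simp
  also have "\<dots> \<le> (\<integral>x. R \<partial>\<nu>)"
    using R by (intro integral_mono integrable_bounded_borel[OF \<nu>] bounded_borel_abs f) auto
  finally show ?thesis by (simp add: prob_space)
qed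

lemma integral_exp_ge:
  assumes \<mu>: "\<mu> \<in> prob_measures" and f: "f \<in> bounded_borel" and R: "\<And>x. R \<le> f x"
  shows "exp R \<le> (\<integral>x. exp (f x) \<partial>\<mu>)"
proof -
  interpret prob_space \<mu> using prob_measuresD[OF \<mu>] by simp
  have "(\<integral>x. exp R \<partial>\<mu>) \<le> (\<integral>x. exp (f x) \<partial>\<mu>)"
    by (intro integral_mono integrable_bounded_borel[OF \<mu>] bounded_borel_exp f) (auto simp: R)
  then show ?thesis by (simp add: prob_space)
qed

lemma integral_exp_le:
  assumes \<mu>: "\<mu> \<in> prob_measures" and f: "f \<in> bounded_borel" and R: "\<And>x. f x \<le> R"
  shows "(\<integral>x. exp (f x) \<partial>\<mu>) \<le> exp R"
proof -
  interpret prob_space \<mu> using prob_measuresD[OF \<mu>] by simp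
  have "(\<integral>x. exp R \<partial>\<mu>) \<ge> (\<integral>x. exp (f x) \<partial>\<mu>)"
    by (intro integral_mono integrable_bounded_borel[OF \<mu>] bounded_borel_exp f) (auto simp: R)
  then show ?thesis by (simp add: prob_space)
qed

lemma integral_exp_pos:
  assumes "\<mu> \<in> prob_measures" "f \<in> bounded_borel"
  shows "0 < (\<integral>x. exp (f x) \<partial>\<mu>)"
proof -
  obtain R where "\<And>x. \<bar>f x\<bar> \<le> R" using bounded_borel_bound[OF assms(2)] by auto
  then have "\<And>x. -R \<le> f x" by (auto simp: abs_le_iff) (metis minus_le_iff)
  from integral_exp_ge[OF assms this] show ?thesis using exp_gt_zero less_le_trans by blast
qed

section \<open>Density of the bounded continuous functions in \<open>L\<^sup>1\<close>\<close>

text \<open>By outer regularity \<open>A\<close> may be replaced by an open set \<open>U\<close>, whose indicator is the increasing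
  limit of the functions \<open>min 1 (k * dist(x, - U))\<close>.\<close>

lemma bounded_continuous_approx_indicator:
  fixes \<mu> :: "'a::polish_space measure"
  assumes \<mu>: "\<mu> \<in> prob_measures" and A: "A \<in> sets borel" and e: "e > 0"
  shows "\<exists>f\<in>bounded_continuous. (\<integral>x. \<bar>f x - indicator A x\<bar> \<partial>\<mu>) < e"
proof -
  interpret prob_space \<mu> using prob_measuresD[OF \<mu>] by simp
  have sets [simp, measurable_cong]: "sets \<mu> = sets borel" using prob_measuresD[OF \<mu>] by simp
  have "emeasure \<mu> A = (INF U \<in> {U. A \<subseteq> U \<and> open U}. emeasure \<mu> U)"
    using outer_regular[of \<mu> A] A by (simp add: emeasure_space_1)
  moreover have "emeasure \<mu> A < emeasure \<mu> A + ennreal (e / 2)"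
    using e by (simp add: emeasure_eq_measure ennreal_plus[symmetric] ennreal_less_iff del: ennreal_plus)
  ultimately obtain U where U: "A \<subseteq> U" "open U" "emeasure \<mu> U < emeasure \<mu> A + ennreal (e / 2)"
    by (metis (no_types, lifting) INF_less_iff mem_Collect_eq)
  have "measure \<mu> U < measure \<mu> A + e / 2"
    using U(3) e by (simp add: emeasure_eq_measure ennreal_plus[symmetric] ennreal_less_iff del: ennreal_plus)
  then have UA: "measure \<mu> (U - A) < e / 2"
    using U A by (subst finite_measure_Diff) auto
  define f where "f k x = (if U = UNIV then 1 else min 1 (real k * infdist x (- U)))" for k :: nat and x :: 'a
  have f01: "0 \<le> f k x" "f k x \<le> 1" for k x by (auto simp: f_def infdist_nonneg)
  have cont: "continuous_on UNIV (f k)" for k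
    unfolding f_def by (cases "U = UNIV") (auto intro!: continuous_intros)
  have bc: "f k \<in> bounded_continuous" for k
    using cont f01 unfolding bounded_continuous_def bounded_range_iff by (auto intro!: exI[of _ 1])
  have lim: "(\<lambda>k. f k x) \<longlonglongrightarrow> indicator U x" for x
  proof (cases "x \<in> U")
    case False
    then have "infdist x (- U) = 0" "U \<noteq> UNIV" by auto
    then show ?thesis using False by (simp add: f_def)
  next
    case True
    have "eventually (\<lambda>k. f k x = 1) sequentially"
    proof (cases "U = UNIV")
      case False
      then have "infdist x (- U) > 0"
        using True U(2) in_closed_iff_infdist_zero[of "- U" x] infdist_nonneg[of x "- U"]
        by (auto simp: closed_Compl less_le)
      then obtain N :: nat where "real N * infdist x (- U) > 1"
        using ex_less_of_nat_mult by metis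
      then have "f k x = 1" if "k \<ge> N" for k
        using that False infdist_nonneg[of x "- U"] mult_right_mono[of "real N" "real k" "infdist x (- U)"]
        by (auto simp: f_def)
      then show ?thesis by (auto simp: eventually_sequentially)
    qed (simp add: f_def)
    then show ?thesis using True by (auto intro: tendsto_eventually)
  qed
  have [measurable]: "f k \<in> borel_measurable borel" for k
    by (rule borel_measurable_continuous_onI[OF cont])
  have [measurable]: "U \<in> sets borel" using U by auto
  have "(\<lambda>k. \<integral>x. \<bar>f k x - indicator U x\<bar> \<partial>\<mu>) \<longlonglongrightarrow> (\<integral>x. 0 \<partial>\<mu>)"
  proof (rule integral_dominated_convergence[where w="\<lambda>_. 1"])
    show "AE x in \<mu>. (\<lambda>k. \<bar>f k x - indicator U x\<bar>) \<longlonglongrightarrow> 0"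
      using lim by (auto intro!: tendsto_rabs_zero LIM_zero)
    show "AE x in \<mu>. norm \<bar>f k x - indicator U x\<bar> \<le> 1" for k
    proof (rule AE_I2)
      fix x show "norm \<bar>f k x - indicator U x\<bar> \<le> 1"
        using f01[of k x] by (auto simp: indicator_def)
    qed
  qed auto
  then have "eventually (\<lambda>k. (\<integral>x. \<bar>f k x - indicator U x\<bar> \<partial>\<mu>) < e / 2) sequentially"
    using e by (intro order_tendstoD(2)) auto
  then obtain k where k: "(\<integral>x. \<bar>f k x - indicator U x\<bar> \<partial>\<mu>) < e / 2"
    by (auto simp: eventually_sequentially)
  note ind = bounded_borel_indicator
  note int = integrable_bounded_borel[OF \<mu>]
  have fk: "f k \<in> bounded_borel" using bc bounded_continuous_subset_borel by auto
  have "(\<integral>x. \<bar>f k x - indicator A x\<bar> \<partial>\<mu>) \<le> (\<integral>x. \<bar>f k x - indicator U x\<bar> + indicator (U - A) x \<partial>\<mu>)"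
  proof (rule integral_mono)
    show "integrable \<mu> (\<lambda>x. \<bar>f k x - indicator U x\<bar> + indicator (U - A) x)"
      using A by (intro Bochner_Integration.integrable_add int bounded_borel_abs bounded_borel_diff ind fk) auto
    show "integrable \<mu> (\<lambda>x. \<bar>f k x - indicator A x\<bar>)"
      using A by (intro int bounded_borel_abs bounded_borel_diff ind fk)
  qed (use U in \<open>auto simp: indicator_def\<close>)
  also have "\<dots> = (\<integral>x. \<bar>f k x - indicator U x\<bar> \<partial>\<mu>) + measure \<mu> (U - A)"
    using A by (subst Bochner_Integration.integral_add)
      (auto intro!: int bounded_borel_abs bounded_borel_diff ind fk)
  also have "\<dots> < e" using k UA by simp
  finally show ?thesis using bc by blast
qed

lemma bounded_continuous_dense_L1:
  fixes \<mu> :: "'a::polish_space measure"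
  assumes \<mu>: "\<mu> \<in> prob_measures" and "integrable \<mu> h" and "e > (0::real)"
  shows "\<exists>f\<in>bounded_continuous. (\<integral>x. \<bar>f x - h x\<bar> \<partial>\<mu>) < e"
  using assms(2,3)
proof (induction arbitrary: e rule: integrable_induct)
  case (base A c)
  have A: "A \<in> sets borel" using base prob_measuresD[OF \<mu>] by simp
  have "e / (\<bar>c\<bar> + 1) > 0" using base by simp
  from bounded_continuous_approx_indicator[OF \<mu> A this]
  obtain f where f: "f \<in> bounded_continuous" "(\<integral>x. \<bar>f x - indicator A x\<bar> \<partial>\<mu>) < e / (\<bar>c\<bar> + 1)" by blast
  have "(\<integral>x. \<bar>c * f x + 0 * f x - indicator A x *\<^sub>R c\<bar> \<partial>\<mu>) = (\<integral>x. \<bar>c\<bar> * \<bar>f x - indicator A x\<bar> \<partial>\<mu>)"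
    by (intro Bochner_Integration.integral_cong) (auto simp: abs_mult[symmetric] algebra_simps)
  also have "\<dots> \<le> (\<bar>c\<bar> + 1) * (\<integral>x. \<bar>f x - indicator A x\<bar> \<partial>\<mu>)"
    by (simp add: algebra_simps)
  also have "\<dots> < e" using f(2) by (simp add: pos_less_divide_eq mult.commute)
  finally show ?case using bounded_continuous_lincomb[OF f(1) f(1), of c 0]
    by (intro bexI[of _ "\<lambda>x. c * f x + 0 * f x"])
next
  case (add g h)
  from add.IH(1)[of "e / 2"] add.prems obtain u where
    u: "u \<in> bounded_continuous" "(\<integral>x. \<bar>u x - g x\<bar> \<partial>\<mu>) < e / 2" by auto
  from add.IH(2)[of "e / 2"] add.prems obtain v where
    v: "v \<in> bounded_continuous" "(\<integral>x. \<bar>v x - h x\<bar> \<partial>\<mu>) < e / 2" by auto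
  have iu: "integrable \<mu> u" and iv: "integrable \<mu> v"
    using u v bounded_continuous_subset_borel integrable_bounded_borel[OF \<mu>] by auto
  have "(\<integral>x. \<bar>1 * u x + 1 * v x - (g x + h x)\<bar> \<partial>\<mu>) \<le> (\<integral>x. \<bar>u x - g x\<bar> + \<bar>v x - h x\<bar> \<partial>\<mu>)"
    using iu iv add.hyps by (intro integral_mono) auto
  also have "\<dots> < e"
    using iu iv add.hyps u v by (subst Bochner_Integration.integral_add) auto
  finally show ?case using bounded_continuous_lincomb[OF u(1) v(1), of 1 1]
    by (intro bexI[of _ "\<lambda>x. 1 * u x + 1 * v x"])
next
  case (lim h s)
  have [measurable]: "h \<in> borel_measurable \<mu>" "s i \<in> borel_measurable \<mu>" for i using lim by auto
  have "(\<lambda>i. \<integral>x. \<bar>s i x - h x\<bar> \<partial>\<mu>) \<longlonglongrightarrow> (\<integral>x. 0 \<partial>\<mu>)"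
  proof (rule integral_dominated_convergence[where w="\<lambda>x. 3 * \<bar>h x\<bar>"])
    show "AE x in \<mu>. (\<lambda>i. \<bar>s i x - h x\<bar>) \<longlonglongrightarrow> 0"
      using lim by (auto intro!: tendsto_rabs_zero LIM_zero)
    show "AE x in \<mu>. norm \<bar>s i x - h x\<bar> \<le> 3 * \<bar>h x\<bar>" for i
    proof (rule AE_I2)
      fix x assume "x \<in> space \<mu>"
      from lim.hyps(3)[OF this, of i] show "norm \<bar>s i x - h x\<bar> \<le> 3 * \<bar>h x\<bar>" by auto
    qed
  qed (use lim in auto)
  then have "eventually (\<lambda>i. (\<integral>x. \<bar>s i x - h x\<bar> \<partial>\<mu>) < e / 2) sequentially"
    using lim.prems by (intro order_tendstoD(2)) auto
  then obtain i where i: "(\<integral>x. \<bar>s i x - h x\<bar> \<partial>\<mu>) < e / 2"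
    by (auto simp: eventually_sequentially)
  from lim.IH[of "e / 2" i] lim.prems obtain u where
    u: "u \<in> bounded_continuous" "(\<integral>x. \<bar>u x - s i x\<bar> \<partial>\<mu>) < e / 2" by auto
  have iu: "integrable \<mu> u"
    using u bounded_continuous_subset_borel integrable_bounded_borel[OF \<mu>] by auto
  have "(\<integral>x. \<bar>u x - h x\<bar> \<partial>\<mu>) \<le> (\<integral>x. \<bar>u x - s i x\<bar> + \<bar>s i x - h x\<bar> \<partial>\<mu>)"
    using iu lim by (intro integral_mono) auto
  also have "\<dots> < e"
    using iu lim.hyps u i by (subst Bochner_Integration.integral_add) auto
  finally show ?case using u by blast
qed

text \<open>Clamping an approximation to \<open>[- R, R]\<close> brings it no further from \<open>h\<close>, which takes its values there.\<close>

lemma bounded_continuous_dense_L1_bounded: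
  fixes \<mu> :: "'a::polish_space measure"
  assumes \<mu>: "\<mu> \<in> prob_measures" and h: "h \<in> bounded_borel" and R: "\<And>x. \<bar>h x\<bar> \<le> R" and e: "e > (0::real)"
  shows "\<exists>f\<in>bounded_continuous. (\<forall>x. \<bar>f x\<bar> \<le> R) \<and> (\<integral>x. \<bar>f x - h x\<bar> \<partial>\<mu>) < e"
proof -
  obtain f where f: "f \<in> bounded_continuous" "(\<integral>x. \<bar>f x - h x\<bar> \<partial>\<mu>) < e"
    using bounded_continuous_dense_L1[OF \<mu> integrable_bounded_borel[OF \<mu> h] e] by blast
  define g where "g x = max (-R) (min R (f x))" for x
  have R0: "R \<ge> 0" using R[of undefined] by linarith
  have g: "\<bar>g x\<bar> \<le> R" for x using R0 by (auto simp: g_def)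
  have gc: "g \<in> bounded_continuous"
    using f(1) g unfolding bounded_continuous_def bounded_range_iff g_def
    by (auto intro!: continuous_intros)
  have "(\<integral>x. \<bar>g x - h x\<bar> \<partial>\<mu>) \<le> (\<integral>x. \<bar>f x - h x\<bar> \<partial>\<mu>)"
  proof (rule integral_mono)
    show "\<bar>g x - h x\<bar> \<le> \<bar>f x - h x\<bar>" for x using R[of x] by (auto simp: g_def)
  qed (use f(1) gc h bounded_continuous_subset_borel in
      \<open>auto intro!: integrable_bounded_borel[OF \<mu>] bounded_borel_abs bounded_borel_diff\<close>)
  then show ?thesis using f gc g by (intro bexI[of _ g]) auto
qed

section \<open>Functionals dominated by a logarithmic moment generating function\<close>

lemma exp_chord_bound:
  fixes u t :: real
  assumes "\<bar>u\<bar> \<le> 1" "t \<ge> 0"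
  shows "exp (t * u) \<le> 1 + \<bar>u\<bar> * (exp t - 1)"
proof -
  have "exp (t * u) \<le> exp (t * \<bar>u\<bar>)" using assms by (simp add: mult_left_mono)
  also have "\<dots> \<le> (1 - \<bar>u\<bar>) * exp 0 + \<bar>u\<bar> * exp t"
    using convex_onD[OF exp_convex, of "\<bar>u\<bar>" 0 t] assms by (simp add: mult.commute)
  finally show ?thesis by (simp add: algebra_simps)
qed

text \<open>The class \<open>C\<close> is instantiated twice: by the bounded continuous functions, where the functional is
  given, and by the bounded Borel functions, to which it extends.\<close>

locale entropy_bounded_functional =
  fixes \<mu> :: "'a::polish_space measure" and C :: "('a \<Rightarrow> real) set" and \<Lambda> :: "('a \<Rightarrow> real) \<Rightarrow> real" and c :: real
  assumes \<mu>: "\<mu> \<in> prob_measures"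
    and C: "C \<subseteq> bounded_borel"
    and lincomb: "\<And>f g a b. f \<in> C \<Longrightarrow> g \<in> C \<Longrightarrow> (\<lambda>x. a * f x + b * g x) \<in> C"
    and linear: "\<And>f g a b. f \<in> C \<Longrightarrow> g \<in> C \<Longrightarrow> \<Lambda> (\<lambda>x. a * f x + b * g x) = a * \<Lambda> f + b * \<Lambda> g"
    and bound: "\<And>f. f \<in> C \<Longrightarrow> \<Lambda> f \<le> c + log_mgf \<mu> f"
begin

sublocale prob_space \<mu> using prob_measuresD[OF \<mu>] by simp

lemma sets_\<mu> [simp, measurable_cong]: "sets \<mu> = sets borel"
  using prob_measuresD[OF \<mu>] by simp

lemmas int = integrable_bounded_borel[OF \<mu>]

lemma diff: "f \<in> C \<Longrightarrow> g \<in> C \<Longrightarrow> \<Lambda> (\<lambda>x. f x - g x) = \<Lambda> f - \<Lambda> g"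
  using linear[of f g 1 "-1"] by simp

lemma diff_in: "f \<in> C \<Longrightarrow> g \<in> C \<Longrightarrow> (\<lambda>x. f x - g x) \<in> C"
  using lincomb[of f g 1 "-1"] by simp

lemma scale: "f \<in> C \<Longrightarrow> \<Lambda> (\<lambda>x. a * f x) = a * \<Lambda> f"
  using linear[of f f a 0] by simp

lemma scale_in: "f \<in> C \<Longrightarrow> (\<lambda>x. a * f x) \<in> C"
  using lincomb[of f f a 0] by simp

text \<open>The bound is applied to the multiple \<open>t * g / R\<close>, and the exponential is replaced by its chord on
  \<open>[0, t]\<close>. A large \<open>t\<close> makes the constant \<open>c\<close> harmless, and then a small \<open>L\<^sup>1\<close> norm the second term.\<close>

lemma upper_L1:
  assumes g: "g \<in> C" and R: "\<And>x. \<bar>g x\<bar> \<le> R" "R > 0" and t: "t > 0"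
  shows "\<Lambda> g \<le> R * c / t + (exp t - 1) / t * (\<integral>x. \<bar>g x\<bar> \<partial>\<mu>)"
proof -
  have gb: "g \<in> bounded_borel" using g C by auto
  define I where "I = (\<integral>x. \<bar>g x\<bar> \<partial>\<mu>)"
  have I: "I \<ge> 0" by (simp add: I_def)
  have sc: "(\<lambda>x. t / R * g x) \<in> C" by (rule scale_in[OF g])
  have "t / R * \<Lambda> g \<le> c + log_mgf \<mu> (\<lambda>x. t / R * g x)"
    using bound[OF sc] unfolding scale[OF g] .
  also have "log_mgf \<mu> (\<lambda>x. t / R * g x) \<le> (\<integral>x. exp (t / R * g x) \<partial>\<mu>) - 1"
    unfolding log_mgf_def by (intro ln_le_minus_one integral_exp_pos[OF \<mu>]) (use sc C in auto)
  also have "(\<integral>x. exp (t / R * g x) \<partial>\<mu>) \<le> (\<integral>x. 1 + (exp t - 1) / R * \<bar>g x\<bar> \<partial>\<mu>)"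
  proof (rule integral_mono)
    show "integrable \<mu> (\<lambda>x. exp (t / R * g x))"
      using sc C by (intro int bounded_borel_exp) auto
    show "integrable \<mu> (\<lambda>x. 1 + (exp t - 1) / R * \<bar>g x\<bar>)"
      by (intro Bochner_Integration.integrable_add int bounded_borel_cmult bounded_borel_abs gb) auto
    show "exp (t / R * g x) \<le> 1 + (exp t - 1) / R * \<bar>g x\<bar>" for x
      using exp_chord_bound[of "g x / R" t] R t by (simp add: abs_divide field_simps)
  qed
  also have "\<dots> = 1 + (exp t - 1) / R * I"
    unfolding I_def using int[OF bounded_borel_abs[OF gb]]
    by (subst Bochner_Integration.integral_add) (auto simp: prob_space)
  finally have "t / R * \<Lambda> g \<le> c + (exp t - 1) / R * I" by simp
  then have "(R / t) * (t / R * \<Lambda> g) \<le> (R / t) * (c + (exp t - 1) / R * I)"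
    using R t by (intro mult_left_mono) auto
  then show ?thesis using R t by (simp add: I_def distrib_left)
qed

lemma abs_L1:
  assumes g: "g \<in> C" and R: "\<And>x. \<bar>g x\<bar> \<le> R" "R > 0" and t: "t > 0"
  shows "\<bar>\<Lambda> g\<bar> \<le> R * c / t + (exp t - 1) / t * (\<integral>x. \<bar>g x\<bar> \<partial>\<mu>)"
  using upper_L1[OF assms] upper_L1[of "\<lambda>x. - 1 * g x" R t] R t g scale[OF g, of "-1"] scale_in[OF g, of "-1"]
  by (auto simp: abs_le_iff)

lemma uniformly_continuous_L1:
  assumes e: "e > 0" and R: "R > 0"
  shows "\<exists>d>0. \<forall>g\<in>C. (\<forall>x. \<bar>g x\<bar> \<le> R) \<longrightarrow> (\<integral>x. \<bar>g x\<bar> \<partial>\<mu>) < d \<longrightarrow> \<bar>\<Lambda> g\<bar> < e"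
proof -
  define k where "k = \<bar>c\<bar> + 1"
  have k: "k > 0" "c < k" by (auto simp: k_def)
  \<comment> \<open>This \<open>t\<close> gives the first term of \<open>abs_L1\<close> at most half of \<open>e\<close>.\<close>
  define t where "t = 2 * R * k / e"
  have t: "t > 0" using e R k by (auto simp: t_def)
  have "R * c / t = c / k * (e / 2)" using e R k by (simp add: t_def field_simps)
  also have "\<dots> < 1 * (e / 2)" using e k by (intro mult_strict_right_mono) auto
  finally have Rt: "R * c / t < e / 2" by simp
  have et: "(exp t - 1) / t > 0" using t by auto
  define d where "d = (e / 2) / ((exp t - 1) / t)"
  show ?thesis
  proof (intro exI[of _ d] conjI ballI impI)
    show "d > 0" unfolding d_def by (rule divide_pos_pos[OF _ et]) (use e in simp)
    fix g assume g: "g \<in> C" "\<forall>x. \<bar>g x\<bar> \<le> R" "(\<integral>x. \<bar>g x\<bar> \<partial>\<mu>) < d"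
    have "(exp t - 1) / t * (\<integral>x. \<bar>g x\<bar> \<partial>\<mu>) < e / 2"
      using g(3) et unfolding d_def by (simp only: pos_less_divide_eq[OF et] mult.commute)
    moreover have "\<bar>\<Lambda> g\<bar> \<le> R * c / t + (exp t - 1) / t * (\<integral>x. \<bar>g x\<bar> \<partial>\<mu>)"
      by (rule abs_L1[OF g(1) _ R t]) (use g(2) in auto)
    ultimately show "\<bar>\<Lambda> g\<bar> < e" using Rt by linarith
  qed
qed

lemma tendsto_L1:
  assumes g: "\<And>k. g k \<in> C" and R: "\<And>k x. \<bar>g k x\<bar> \<le> R" and lim: "(\<lambda>k. \<integral>x. \<bar>g k x\<bar> \<partial>\<mu>) \<longlonglongrightarrow> 0"
  shows "(\<lambda>k. \<Lambda> (g k)) \<longlonglongrightarrow> 0"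
proof (rule LIMSEQ_I)
  fix e :: real assume "e > 0"
  have R': "\<bar>g k x\<bar> \<le> \<bar>R\<bar> + 1" for k x using R[of k x] by linarith
  have Rpos: "0 < \<bar>R\<bar> + 1" by simp
  obtain d where d: "d > 0" "\<And>g. g \<in> C \<Longrightarrow> (\<forall>x. \<bar>g x\<bar> \<le> \<bar>R\<bar> + 1) \<Longrightarrow> (\<integral>x. \<bar>g x\<bar> \<partial>\<mu>) < d \<Longrightarrow> \<bar>\<Lambda> g\<bar> < e"
    using uniformly_continuous_L1[OF \<open>e > 0\<close>, of "\<bar>R\<bar> + 1"] by (metis Rpos)
  from order_tendstoD(2)[OF lim d(1)] obtain N where "\<And>k. k \<ge> N \<Longrightarrow> (\<integral>x. \<bar>g k x\<bar> \<partial>\<mu>) < d"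
    by (auto simp: eventually_sequentially)
  then show "\<exists>N. \<forall>k\<ge>N. norm (\<Lambda> (g k) - 0) < e"
    using d(2)[OF g] R' by (intro exI[of _ N]) auto
qed

lemma tendsto_L1':
  assumes g: "\<And>k. g k \<in> C" and h: "h \<in> C" and R: "\<And>k x. \<bar>g k x - h x\<bar> \<le> R"
    and lim: "(\<lambda>k. \<integral>x. \<bar>g k x - h x\<bar> \<partial>\<mu>) \<longlonglongrightarrow> 0"
  shows "(\<lambda>k. \<Lambda> (g k)) \<longlonglongrightarrow> \<Lambda> h"
  using tendsto_L1[of "\<lambda>k x. g k x - h x", OF diff_in[OF g h] R lim]
  by (simp add: diff[OF g h] LIM_zero_iff)

definition approximates :: "(nat \<Rightarrow> 'a \<Rightarrow> real) \<Rightarrow> ('a \<Rightarrow> real) \<Rightarrow> bool" where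
  "approximates a h \<longleftrightarrow> (\<forall>k. a k \<in> C) \<and> (\<exists>R. \<forall>k x. \<bar>a k x\<bar> \<le> R) \<and>
     (\<lambda>k. \<integral>x. \<bar>a k x - h x\<bar> \<partial>\<mu>) \<longlonglongrightarrow> 0"

lemma approximates_const: "h \<in> C \<Longrightarrow> approximates (\<lambda>_. h) h"
  using C bounded_borel_bound[of h] unfolding approximates_def by auto blast

lemma approximates_lincomb:
  assumes a: "approximates a h" and b: "approximates b g" and h: "h \<in> bounded_borel" and g: "g \<in> bounded_borel"
  shows "approximates (\<lambda>k x. s * a k x + t * b k x) (\<lambda>x. s * h x + t * g x)"
proof -
  have aC: "a k \<in> C" and bC: "b k \<in> C" for k using a b by (auto simp: approximates_def)
  then have ab: "a k \<in> bounded_borel" and bb: "b k \<in> bounded_borel" for k using C by auto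
  obtain R S where R: "\<And>k x. \<bar>a k x\<bar> \<le> R" and S: "\<And>k x. \<bar>b k x\<bar> \<le> S"
    using a b unfolding approximates_def by blast
  have bd: "\<bar>s * a k x + t * b k x\<bar> \<le> \<bar>s\<bar> * R + \<bar>t\<bar> * S" for k x
    using R[of k x] S[of k x]
    by (intro order_trans[OF abs_triangle_ineq] add_mono) (auto simp: abs_mult intro!: mult_left_mono)
  have "(\<lambda>k. \<integral>x. \<bar>s * a k x + t * b k x - (s * h x + t * g x)\<bar> \<partial>\<mu>) \<longlonglongrightarrow> 0"
  proof (rule tendsto_sandwich[OF _ _ tendsto_const])
    show "eventually (\<lambda>k. (\<integral>x. \<bar>s * a k x + t * b k x - (s * h x + t * g x)\<bar> \<partial>\<mu>)
        \<le> \<bar>s\<bar> * (\<integral>x. \<bar>a k x - h x\<bar> \<partial>\<mu>) + \<bar>t\<bar> * (\<integral>x. \<bar>b k x - g x\<bar> \<partial>\<mu>)) sequentially"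
    proof (rule always_eventually, rule allI)
      fix k
      have i1: "integrable \<mu> (\<lambda>x. \<bar>s\<bar> * \<bar>a k x - h x\<bar>)" and i2: "integrable \<mu> (\<lambda>x. \<bar>t\<bar> * \<bar>b k x - g x\<bar>)"
        using ab[of k] bb[of k] h g by (auto intro!: int bounded_borel_cmult bounded_borel_abs bounded_borel_diff)
      have "(\<integral>x. \<bar>s * a k x + t * b k x - (s * h x + t * g x)\<bar> \<partial>\<mu>)
          \<le> (\<integral>x. \<bar>s\<bar> * \<bar>a k x - h x\<bar> + \<bar>t\<bar> * \<bar>b k x - g x\<bar> \<partial>\<mu>)"
      proof (rule integral_mono)
        show "integrable \<mu> (\<lambda>x. \<bar>s * a k x + t * b k x - (s * h x + t * g x)\<bar>)"
          using ab[of k] bb[of k] h g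
          by (auto intro!: int bounded_borel_lincomb bounded_borel_abs bounded_borel_diff)
        show "\<bar>s * a k x + t * b k x - (s * h x + t * g x)\<bar>
            \<le> \<bar>s\<bar> * \<bar>a k x - h x\<bar> + \<bar>t\<bar> * \<bar>b k x - g x\<bar>" for x
          using abs_triangle_ineq[of "s * (a k x - h x)" "t * (b k x - g x)"]
          by (simp add: abs_mult[symmetric] algebra_simps)
      qed (use i1 i2 in auto)
      also have "\<dots> = \<bar>s\<bar> * (\<integral>x. \<bar>a k x - h x\<bar> \<partial>\<mu>) + \<bar>t\<bar> * (\<integral>x. \<bar>b k x - g x\<bar> \<partial>\<mu>)"
        by (subst Bochner_Integration.integral_add[OF i1 i2]) simp
      finally show "(\<integral>x. \<bar>s * a k x + t * b k x - (s * h x + t * g x)\<bar> \<partial>\<mu>) \<le> \<dots>" .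
    qed
    show "(\<lambda>k. \<bar>s\<bar> * (\<integral>x. \<bar>a k x - h x\<bar> \<partial>\<mu>) + \<bar>t\<bar> * (\<integral>x. \<bar>b k x - g x\<bar> \<partial>\<mu>)) \<longlonglongrightarrow> 0"
      using a b unfolding approximates_def by (auto intro!: tendsto_eq_intros)
  qed auto
  then show ?thesis using lincomb[OF aC bC] bd unfolding approximates_def by blast
qed

lemma approximates_unique:
  assumes a: "approximates a h" and b: "approximates b h" and h: "h \<in> bounded_borel"
  shows "(\<lambda>k. \<Lambda> (a k) - \<Lambda> (b k)) \<longlonglongrightarrow> 0"
proof -
  have "approximates (\<lambda>k x. 1 * a k x + (-1) * b k x) (\<lambda>x. 1 * h x + (-1) * h x)"
    by (rule approximates_lincomb[OF a b h h])
  then have "approximates (\<lambda>k x. a k x - b k x) (\<lambda>x. 0)" by simp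
  then obtain R where "\<And>k. (\<lambda>x. a k x - b k x) \<in> C" "\<And>k x. \<bar>a k x - b k x\<bar> \<le> R"
    "(\<lambda>k. \<integral>x. \<bar>a k x - b k x\<bar> \<partial>\<mu>) \<longlonglongrightarrow> 0"
    unfolding approximates_def by auto
  from tendsto_L1[OF this] show ?thesis
    using a b diff unfolding approximates_def by simp
qed

lemma approximates_convergent:
  assumes a: "approximates a h" and h: "h \<in> bounded_borel"
  shows "convergent (\<lambda>k. \<Lambda> (a k))"
proof -
  have aC: "a k \<in> C" for k using a by (auto simp: approximates_def)
  then have ab: "a k \<in> bounded_borel" for k using C by auto
  obtain R where R: "\<And>k x. \<bar>a k x\<bar> \<le> R" using a unfolding approximates_def by blast
  have "Cauchy (\<lambda>k. \<Lambda> (a k))"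
  proof (rule CauchyI)
    fix e :: real assume "e > 0"
    have R': "\<bar>a m x - a n x\<bar> \<le> 2 * \<bar>R\<bar> + 1" for m n x using R[of m x] R[of n x] by linarith
    have Rpos: "0 < 2 * \<bar>R\<bar> + 1" by simp
  obtain d where d: "d > 0" "\<And>g. g \<in> C \<Longrightarrow> (\<forall>x. \<bar>g x\<bar> \<le> 2 * \<bar>R\<bar> + 1) \<Longrightarrow> (\<integral>x. \<bar>g x\<bar> \<partial>\<mu>) < d \<Longrightarrow> \<bar>\<Lambda> g\<bar> < e"
      using uniformly_continuous_L1[OF \<open>e > 0\<close>, of "2 * \<bar>R\<bar> + 1"] by (metis Rpos)
    have lim: "(\<lambda>k. \<integral>x. \<bar>a k x - h x\<bar> \<partial>\<mu>) \<longlonglongrightarrow> 0" using a by (auto simp: approximates_def)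
    have "d / 2 > 0" using d by simp
    from order_tendstoD(2)[OF lim this] obtain N
      where N: "\<And>k. k \<ge> N \<Longrightarrow> (\<integral>x. \<bar>a k x - h x\<bar> \<partial>\<mu>) < d / 2"
      by (auto simp: eventually_sequentially)
    have "norm (\<Lambda> (a m) - \<Lambda> (a n)) < e" if mn: "m \<ge> N" "n \<ge> N" for m n
    proof -
      have i: "integrable \<mu> (\<lambda>x. \<bar>a k x - h x\<bar>)" for k
        using ab[of k] h by (auto intro!: int bounded_borel_abs bounded_borel_diff)
      have "(\<integral>x. \<bar>a m x - a n x\<bar> \<partial>\<mu>) \<le> (\<integral>x. \<bar>a m x - h x\<bar> + \<bar>a n x - h x\<bar> \<partial>\<mu>)"
        using i ab by (intro integral_mono) (auto intro!: int bounded_borel_abs bounded_borel_diff)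
      also have "\<dots> < d"
        using N[OF mn(1)] N[OF mn(2)] by (subst Bochner_Integration.integral_add[OF i i]) simp
      finally show ?thesis
        using d(2)[OF diff_in[OF aC aC], of m n] R'[of m _ n] unfolding diff[OF aC aC] real_norm_def
        by blast
    qed
    then show "\<exists>N. \<forall>m\<ge>N. \<forall>n\<ge>N. norm (\<Lambda> (a m) - \<Lambda> (a n)) < e" by blast
  qed
  then show ?thesis by (simp add: Cauchy_convergent_iff)
qed

lemma approximates_log_mgf:
  assumes a: "approximates a h" and h: "h \<in> bounded_borel"
  shows "(\<lambda>k. log_mgf \<mu> (a k)) \<longlonglongrightarrow> log_mgf \<mu> h"
proof -
  have ab: "a k \<in> bounded_borel" for k using C a by (auto simp: approximates_def)
  obtain R1 where R1: "\<And>k x. \<bar>a k x\<bar> \<le> R1" using a unfolding approximates_def by blast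
  obtain R2 where R2: "\<And>x. \<bar>h x\<bar> \<le> R2" using bounded_borel_bound[OF h] by blast
  define R where "R = max R1 R2"
  have R: "a k x \<le> R" "h x \<le> R" for k x
    using R1[of k x] R2[of x] by (auto simp: R_def)
  have exp_lip: "\<bar>exp u - exp v\<bar> \<le> exp R * \<bar>u - v\<bar>" if "u \<le> R" "v \<le> R" for u v :: real
  proof -
    have *: "exp u - exp v \<le> exp R * \<bar>u - v\<bar>" if "u \<le> R" for u v :: real
    proof -
      have "exp u * (1 + (v - u)) \<le> exp u * exp (v - u)" by (intro mult_left_mono) auto
      then have "exp u - exp v \<le> exp u * (u - v)" by (simp add: exp_diff algebra_simps)
      also have "\<dots> \<le> exp u * \<bar>u - v\<bar>" by (intro mult_left_mono) auto
      also have "\<dots> \<le> exp R * \<bar>u - v\<bar>" using that by (intro mult_right_mono) auto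
      finally show ?thesis .
    qed
    show ?thesis using *[OF that(1), of v] *[OF that(2), of u] by (simp add: abs_le_iff abs_minus_commute)
  qed
  have "(\<lambda>k. (\<integral>x. exp (a k x) \<partial>\<mu>) - (\<integral>x. exp (h x) \<partial>\<mu>)) \<longlonglongrightarrow> 0"
  proof (rule Lim_null_comparison)
    show "eventually (\<lambda>k. norm ((\<integral>x. exp (a k x) \<partial>\<mu>) - (\<integral>x. exp (h x) \<partial>\<mu>))
        \<le> exp R * (\<integral>x. \<bar>a k x - h x\<bar> \<partial>\<mu>)) sequentially"
    proof (rule always_eventually, rule allI)
      fix k
      have "(\<integral>x. exp (a k x) \<partial>\<mu>) - (\<integral>x. exp (h x) \<partial>\<mu>) = (\<integral>x. exp (a k x) - exp (h x) \<partial>\<mu>)"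
        by (intro Bochner_Integration.integral_diff[symmetric] int bounded_borel_exp ab h)
      then have "norm ((\<integral>x. exp (a k x) \<partial>\<mu>) - (\<integral>x. exp (h x) \<partial>\<mu>)) \<le> (\<integral>x. \<bar>exp (a k x) - exp (h x)\<bar> \<partial>\<mu>)"
        using integral_norm_bound[of \<mu> "\<lambda>x. exp (a k x) - exp (h x)"] by simp
      also have "\<dots> \<le> (\<integral>x. exp R * \<bar>a k x - h x\<bar> \<partial>\<mu>)"
        using R by (intro integral_mono int bounded_borel_abs bounded_borel_diff bounded_borel_exp
            bounded_borel_cmult ab h) (auto intro!: exp_lip)
      finally show "norm ((\<integral>x. exp (a k x) \<partial>\<mu>) - (\<integral>x. exp (h x) \<partial>\<mu>)) \<le> exp R * (\<integral>x. \<bar>a k x - h x\<bar> \<partial>\<mu>)"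
        by simp
    qed
    show "(\<lambda>k. exp R * (\<integral>x. \<bar>a k x - h x\<bar> \<partial>\<mu>)) \<longlonglongrightarrow> 0"
      using a unfolding approximates_def by (auto intro!: tendsto_eq_intros)
  qed
  then have "(\<lambda>k. \<integral>x. exp (a k x) \<partial>\<mu>) \<longlonglongrightarrow> (\<integral>x. exp (h x) \<partial>\<mu>)"
    by (simp add: LIM_zero_iff)
  then show ?thesis
    unfolding log_mgf_def using integral_exp_pos[OF \<mu> h] by (intro tendsto_ln) auto
qed

end

text \<open>The extension at \<open>h\<close> is the limit of \<open>\<Lambda>\<close> along any uniformly bounded sequence of bounded
  continuous functions that converges to \<open>h\<close> in \<open>L\<^sup>1(\<mu>)\<close>. The uniform bound is essential: \<open>\<Lambda>\<close> is uniformly continuous for the \<open>L\<^sup>1\<close>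
  norm only on sets of uniformly bounded functions.\<close>

lemma extend_to_bounded_borel:
  assumes "entropy_bounded_functional \<mu> bounded_continuous \<Lambda> c"
  shows "\<exists>L. entropy_bounded_functional \<mu> bounded_borel L c \<and> (\<forall>f\<in>bounded_continuous. L f = \<Lambda> f)"
proof -
  interpret entropy_bounded_functional \<mu> bounded_continuous \<Lambda> c by fact
  have ex: "\<exists>a. approximates a h" if h: "h \<in> bounded_borel" for h
  proof -
    obtain R where R: "R > 0" "\<And>x. \<bar>h x\<bar> \<le> R" using bounded_borel_bound[OF h] by blast
    have "\<forall>k. \<exists>f. f \<in> bounded_continuous \<and> (\<forall>x. \<bar>f x\<bar> \<le> R) \<and> (\<integral>x. \<bar>f x - h x\<bar> \<partial>\<mu>) < 1 / real (Suc k)"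
    proof
      fix k show "\<exists>f. f \<in> bounded_continuous \<and> (\<forall>x. \<bar>f x\<bar> \<le> R) \<and> (\<integral>x. \<bar>f x - h x\<bar> \<partial>\<mu>) < 1 / real (Suc k)"
        using bounded_continuous_dense_L1_bounded[OF \<mu> h R(2), of "1 / real (Suc k)"] by auto
    qed
    then obtain a where a: "\<And>k. a k \<in> bounded_continuous" "\<And>k x. \<bar>a k x\<bar> \<le> R"
      "\<And>k. (\<integral>x. \<bar>a k x - h x\<bar> \<partial>\<mu>) < 1 / real (Suc k)" by metis
    have "(\<lambda>k. \<integral>x. \<bar>a k x - h x\<bar> \<partial>\<mu>) \<longlonglongrightarrow> 0"
    proof (rule tendsto_sandwich[OF _ _ tendsto_const LIMSEQ_inverse_real_of_nat])
      show "eventually (\<lambda>k. (\<integral>x. \<bar>a k x - h x\<bar> \<partial>\<mu>) \<le> inverse (real (Suc k))) sequentially"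
        using a(3) by (intro always_eventually allI) (simp add: inverse_eq_divide less_imp_le)
    qed auto
    then show ?thesis using a unfolding approximates_def by blast
  qed
  define L where "L h = lim (\<lambda>k. \<Lambda> ((SOME a. approximates a h) k))" for h
  have L: "(\<lambda>k. \<Lambda> (a k)) \<longlonglongrightarrow> L h" if a: "approximates a h" and h: "h \<in> bounded_borel" for a h
  proof -
    have s: "approximates (SOME a. approximates a h) h" using someI[of "\<lambda>a. approximates a h"] a by blast
    then have "(\<lambda>k. \<Lambda> ((SOME a. approximates a h) k)) \<longlonglongrightarrow> L h"
      unfolding L_def using approximates_convergent[OF s h] by (simp add: convergent_LIMSEQ_iff)
    from tendsto_add[OF approximates_unique[OF a s h] this] show ?thesis by simp
  qed
  have "entropy_bounded_functional \<mu> bounded_borel L c"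
  proof
    show "\<mu> \<in> prob_measures" by (rule \<mu>)
    show "bounded_borel \<subseteq> (bounded_borel :: ('a \<Rightarrow> real) set)" ..
    show "(\<lambda>x. s * f x + t * g x) \<in> bounded_borel" if "f \<in> bounded_borel" "g \<in> bounded_borel"
      for f g :: "'a \<Rightarrow> real" and s t using bounded_borel_lincomb[OF that] .
    show "L (\<lambda>x. s * f x + t * g x) = s * L f + t * L g"
      if f: "f \<in> bounded_borel" and g: "g \<in> bounded_borel" for f g s t
    proof -
      obtain a b where a: "approximates a f" and b: "approximates b g" using ex f g by blast
      have lim: "(\<lambda>k. \<Lambda> (\<lambda>x. s * a k x + t * b k x)) \<longlonglongrightarrow> L (\<lambda>x. s * f x + t * g x)"
        by (rule L[OF approximates_lincomb[OF a b f g] bounded_borel_lincomb[OF f g]])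
      have eq: "(\<lambda>k. \<Lambda> (\<lambda>x. s * a k x + t * b k x)) = (\<lambda>k. s * \<Lambda> (a k) + t * \<Lambda> (b k))"
        using a b linear by (auto simp: approximates_def)
      have "(\<lambda>k. s * \<Lambda> (a k) + t * \<Lambda> (b k)) \<longlonglongrightarrow> s * L f + t * L g"
        by (intro tendsto_intros L a b f g)
      then show ?thesis using LIMSEQ_unique[OF lim[unfolded eq]] by blast
    qed
    show "L h \<le> c + log_mgf \<mu> h" if h: "h \<in> bounded_borel" for h
    proof -
      obtain a where a: "approximates a h" using ex h by blast
      show ?thesis
      proof (rule LIMSEQ_le[OF L[OF a h]])
        show "(\<lambda>k. c + log_mgf \<mu> (a k)) \<longlonglongrightarrow> c + log_mgf \<mu> h"
          by (intro tendsto_intros approximates_log_mgf a h)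
        show "\<exists>N. \<forall>n\<ge>N. \<Lambda> (a n) \<le> c + log_mgf \<mu> (a n)"
          using a bound by (auto simp: approximates_def)
      qed
    qed
  qed
  moreover have "L f = \<Lambda> f" if "f \<in> bounded_continuous" for f
    using LIMSEQ_unique[OF L[OF approximates_const[OF that]] tendsto_const] that
      bounded_continuous_subset_borel by auto
  ultimately show ?thesis by blast
qed

section \<open>Representation by a probability measure\<close>

lemma bounded_borel_nonneg_le:
  assumes "v \<in> bounded_borel" "u \<in> borel_measurable borel" "\<And>x. 0 \<le> u x" "\<And>x. u x \<le> v x"
  shows "u \<in> bounded_borel"
proof -
  obtain R where "\<And>x. \<bar>v x\<bar> \<le> R" using bounded_borel_bound[OF assms(1)] by blast
  then have "\<bar>u x\<bar> \<le> R" for x using assms(3,4)[of x] by (smt (verit))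
  then show ?thesis using assms(2) by (auto simp: bounded_borel_def bounded_range_iff)
qed

context entropy_bounded_functional
begin

text \<open>For \<open>t > 0\<close> the function \<open>- t * h\<close> has a nonpositive logarithmic moment generating function, so
  \<open>- t * \<Lambda> h \<le> c\<close>; a negative value of \<open>\<Lambda> h\<close> would violate this for large \<open>t\<close>. The same scaling proves
  \<open>const_one\<close>.\<close>

lemma nonneg:
  assumes h: "h \<in> C" "\<And>x. 0 \<le> h x"
  shows "0 \<le> \<Lambda> h"
proof (rule ccontr)
  assume neg: "\<not> 0 \<le> \<Lambda> h"
  define t where "t = (\<bar>c\<bar> + 1) / (- \<Lambda> h)"
  have t: "t > 0" using neg by (auto simp: t_def intro!: divide_pos_neg)
  have th: "(\<lambda>x. - t * h x) \<in> C" by (rule scale_in[OF h(1)])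
  then have thb: "(\<lambda>x. - t * h x) \<in> bounded_borel" using C by auto
  have "- t * \<Lambda> h \<le> c + log_mgf \<mu> (\<lambda>x. - t * h x)" using bound[OF th] unfolding scale[OF h(1)] .
  also have "(\<integral>x. exp (- t * h x) \<partial>\<mu>) \<le> exp 0"
    using t h by (intro integral_exp_le[OF \<mu> thb]) auto
  then have "log_mgf \<mu> (\<lambda>x. - t * h x) \<le> 0"
    unfolding log_mgf_def using integral_exp_pos[OF \<mu> thb] by (subst ln_le_zero_iff) auto
  finally have "- t * \<Lambda> h \<le> c" by simp
  moreover have "- t * \<Lambda> h = \<bar>c\<bar> + 1" using neg by (simp add: t_def)
  ultimately show False by linarith
qed

lemma const_one:
  assumes one: "(\<lambda>_. 1) \<in> C"
  shows "\<Lambda> (\<lambda>_. 1) = 1"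
proof (rule ccontr)
  assume ne: "\<Lambda> (\<lambda>_. 1) \<noteq> 1"
  define t where "t = (\<bar>c\<bar> + 1) / (\<Lambda> (\<lambda>_. 1) - 1)"
  have "t * \<Lambda> (\<lambda>_. 1) \<le> c + log_mgf \<mu> (\<lambda>_. t * 1)"
    using bound[OF scale_in[OF one]] unfolding scale[OF one] .
  then have "t * (\<Lambda> (\<lambda>_. 1) - 1) \<le> c" by (simp add: log_mgf_def prob_space algebra_simps)
  moreover have "t * (\<Lambda> (\<lambda>_. 1) - 1) = \<bar>c\<bar> + 1" using ne by (simp add: t_def)
  ultimately show False by linarith
qed

end

text \<open>Continuity at the empty set holds because \<open>\<mu>(A\<^sub>i) \<longlonglongrightarrow> 0\<close> means that the indicators of the \<open>A\<^sub>i\<close> tend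
  to \<open>0\<close> in \<open>L\<^sup>1(\<mu>)\<close>. The same continuity handles the monotone limits that lead from indicators to
  bounded functions.\<close>

lemma represent_by_measure:
  fixes \<mu> :: "'a::polish_space measure"
  assumes "entropy_bounded_functional \<mu> bounded_borel \<Lambda> c"
  shows "\<exists>\<nu>\<in>prob_measures. \<forall>h\<in>bounded_borel. \<Lambda> h = (\<integral>x. h x \<partial>\<nu>)"
proof -
  interpret entropy_bounded_functional \<mu> bounded_borel \<Lambda> c by fact
  define N where "N A = \<Lambda> (indicator A)" for A :: "'a set"
  define \<nu> where "\<nu> = measure_of UNIV (sets borel) (\<lambda>A. ennreal (N A))"
  have N0: "N A \<ge> 0" if "A \<in> sets borel" for A
    unfolding N_def by (rule nonneg) (auto intro: bounded_borel_indicator that)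
  have Nadd: "N (A \<union> B) = N A + N B" if "A \<in> sets borel" "B \<in> sets borel" "A \<inter> B = {}" for A B
  proof -
    have "indicator (A \<union> B) = (\<lambda>x. 1 * indicator A x + 1 * indicator B x :: real)"
      using that(3) by (auto simp: indicator_def fun_eq_iff)
    then show ?thesis unfolding N_def
      using linear[OF bounded_borel_indicator[OF that(1)] bounded_borel_indicator[OF that(2)], of 1 1] by simp
  qed
  have Nempty: "N {} = 0" using Nadd[of "{}" "{}"] by simp
  have pos: "positive (sets borel) (\<lambda>A. ennreal (N A))" by (simp add: positive_def Nempty)
  have "countably_additive (sets (borel :: 'a measure)) (\<lambda>A. ennreal (N A))"
  proof (rule sets.empty_continuous_imp_countably_additive[OF pos])
    show "additive (sets borel) (\<lambda>A. ennreal (N A))"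
      unfolding additive_def using Nadd N0 by (simp add: ennreal_plus)
    show "\<forall>A\<in>sets borel. ennreal (N A) \<noteq> \<infinity>" by simp
    fix A :: "nat \<Rightarrow> 'a set"
    assume A: "range A \<subseteq> sets borel" "decseq A" "(\<Inter>i. A i) = {}"
    have "(\<lambda>i. measure \<mu> (A i)) \<longlonglongrightarrow> measure \<mu> (\<Inter>i. A i)"
      using A by (intro finite_Lim_measure_decseq) auto
    moreover have "(\<integral>x. \<bar>indicator (A i) x :: real\<bar> \<partial>\<mu>) = measure \<mu> (A i)" for i
    proof -
      have "(\<integral>x. \<bar>indicator (A i) x :: real\<bar> \<partial>\<mu>) = (\<integral>x. (indicator (A i) x :: real) \<partial>\<mu>)"
        by (intro Bochner_Integration.integral_cong) (auto simp: indicator_def)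
      also have "\<dots> = measure \<mu> (A i)" using A by (simp add: image_subset_iff)
      finally show ?thesis .
    qed
    ultimately have "(\<lambda>i. \<integral>x. \<bar>indicator (A i) x :: real\<bar> \<partial>\<mu>) \<longlonglongrightarrow> 0" using A by simp
    then have "(\<lambda>i. N (A i)) \<longlonglongrightarrow> 0"
      unfolding N_def using A by (intro tendsto_L1[where R=1] bounded_borel_indicator) (auto simp: indicator_def)
    then show "(\<lambda>i. ennreal (N (A i))) \<longlonglongrightarrow> 0"
      using tendsto_ennrealI by (fastforce simp: ennreal_0[symmetric] simp del: ennreal_0)
  qed
  moreover have sets_\<nu> [simp, measurable_cong]: "sets \<nu> = sets borel"
    unfolding \<nu>_def using sets.sets_measure_of_eq[of "borel :: 'a measure"] by simp
  ultimately have em: "emeasure \<nu> A = ennreal (N A)" if "A \<in> sets borel" for A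
    using that pos by (intro emeasure_measure_of[OF \<nu>_def]) (auto simp: sets_\<nu>)
  have "space \<nu> = UNIV" using sets_eq_imp_space_eq[OF sets_\<nu>] by simp
  moreover have "N UNIV = 1"
    using const_one by (simp add: N_def)
  ultimately have "prob_space \<nu>" by (intro prob_spaceI) (simp add: em)
  then have \<nu>: "\<nu> \<in> prob_measures" by (simp add: space_prob_algebra)
  interpret \<nu>: prob_space \<nu> by fact
  note int\<nu> = integrable_bounded_borel[OF \<nu>]
  have nonneg_case: "u \<in> bounded_borel \<longrightarrow> \<Lambda> u = (\<integral>x. u x \<partial>\<nu>)"
    if u: "u \<in> borel_measurable borel" "\<And>x. 0 \<le> u x" for u
    using u
  proof (induction rule: borel_measurable_induct_real)
    case (set A)
    then show ?case using N0[of A] em[of A] by (simp add: measure_def N_def[symmetric])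
  next
    case (mult u a)
    show ?case
    proof (intro impI)
      assume au: "(\<lambda>x. a * u x) \<in> bounded_borel"
      show "\<Lambda> (\<lambda>x. a * u x) = (\<integral>x. a * u x \<partial>\<nu>)"
      proof (cases "a = 0")
        case True
        then show ?thesis using linear[of "\<lambda>_. 0" "\<lambda>_. 0" 0 0] by simp
      next
        case False
        have "(\<lambda>x. (1 / a) * (a * u x)) \<in> bounded_borel" by (rule bounded_borel_cmult[OF au])
        then have "u \<in> bounded_borel" using False by simp
        then show ?thesis using mult scale[of u a] by simp
      qed
    qed
  next
    case (add u v)
    show ?case
    proof (intro impI)
      assume uv: "(\<lambda>x. v x + u x) \<in> bounded_borel"
      have u: "u \<in> bounded_borel" and v: "v \<in> bounded_borel"
        using add by (auto intro!: bounded_borel_nonneg_le[OF uv])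
      show "\<Lambda> (\<lambda>x. v x + u x) = (\<integral>x. v x + u x \<partial>\<nu>)"
        using add u v linear[OF v u, of 1 1] int\<nu>[OF u] int\<nu>[OF v] by simp
    qed
  next
    case (seq U)
    show ?case
    proof (intro impI)
      assume ub: "u \<in> bounded_borel"
      obtain R where R: "\<And>x. \<bar>u x\<bar> \<le> R" using bounded_borel_bound[OF ub] by blast
      have lim: "(\<lambda>i. U i x) \<longlonglongrightarrow> u x" for x using seq by simp
      have Uu: "U i x \<le> u x" for i x
        using seq.hyps(3) lim by (intro incseq_le) (auto simp: incseq_def le_fun_def)
      have Ub: "U i \<in> bounded_borel" for i
        using bounded_borel_nonneg_le[OF ub] seq.hyps Uu by blast
      have d: "\<bar>U i x - u x\<bar> \<le> R" "\<bar>U i x\<bar> \<le> R" for i x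
        using R[of x] Uu[of i x] seq.hyps(2)[of i x] by auto
      have "(\<lambda>i. \<integral>x. \<bar>U i x - u x\<bar> \<partial>\<mu>) \<longlonglongrightarrow> (\<integral>x. 0 \<partial>\<mu>)"
        using d lim seq.hyps(1) ub
        by (intro integral_dominated_convergence[where w="\<lambda>_. R"])
          (auto intro!: tendsto_rabs_zero LIM_zero int bounded_borel_abs bounded_borel_diff simp: bounded_borel_def)
      then have "(\<lambda>i. \<Lambda> (U i)) \<longlonglongrightarrow> \<Lambda> u"
        using tendsto_L1'[OF Ub ub d(1)] by simp
      moreover have "(\<lambda>i. \<integral>x. U i x \<partial>\<nu>) \<longlonglongrightarrow> (\<integral>x. u x \<partial>\<nu>)"
        using d lim seq.hyps(1) ub
        by (intro integral_dominated_convergence[where w="\<lambda>_. R"]) (auto simp: bounded_borel_def)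
      ultimately show "\<Lambda> u = (\<integral>x. u x \<partial>\<nu>)"
        using seq.IH Ub LIMSEQ_unique by simp
    qed
  qed
  have "\<Lambda> h = (\<integral>x. h x \<partial>\<nu>)" if h: "h \<in> bounded_borel" for h
  proof -
    obtain R where R: "\<And>x. \<bar>h x\<bar> \<le> R" using bounded_borel_bound[OF h] by blast
    have hR: "(\<lambda>x. 1 * h x + R * 1) \<in> bounded_borel" by (rule lincomb[OF h bounded_borel_const])
    have "\<Lambda> h + R = \<Lambda> (\<lambda>x. 1 * h x + R * 1)"
      using linear[OF h bounded_borel_const, of 1 R 1] const_one by simp
    also have "\<dots> = (\<integral>x. 1 * h x + R * 1 \<partial>\<nu>)"
    proof (rule nonneg_case[rule_format, OF _ _ hR])
      show "0 \<le> 1 * h x + R * 1" for x using R[of x] by linarith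
    qed (use hR in \<open>simp add: bounded_borel_def\<close>)
    also have "\<dots> = (\<integral>x. h x \<partial>\<nu>) + R" using int\<nu>[OF h] by (simp add: \<nu>.prob_space)
    finally show ?thesis by simp
  qed
  then show ?thesis using \<nu> by blast
qed

section \<open>Variational inequalities for the relative entropy\<close>

locale abs_cont_pair =
  fixes \<mu> \<nu> :: "'a::polish_space measure"
  assumes \<mu>: "\<mu> \<in> prob_measures" and \<nu>: "\<nu> \<in> prob_measures" and ac: "absolutely_continuous \<mu> \<nu>"
begin

sublocale \<mu>: prob_space \<mu> using prob_measuresD[OF \<mu>] by simp
sublocale \<nu>: prob_space \<nu> using prob_measuresD[OF \<nu>] by simp

lemma sets_eq [simp, measurable_cong]: "sets \<mu> = sets borel" "sets \<nu> = sets borel"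
  using prob_measuresD[OF \<mu>] prob_measuresD[OF \<nu>] by auto

definition \<phi> :: "'a \<Rightarrow> real" where "\<phi> x = enn2real (RN_deriv \<mu> \<nu> x)"
definition w :: "'a \<Rightarrow> real" where "w = entropy_density (exp 1) \<mu> \<nu>"

lemma \<phi>_nonneg [simp]: "\<phi> x \<ge> 0" by (simp add: \<phi>_def)

lemma w_eq: "w x = ln (\<phi> x)"
  by (simp add: w_def \<phi>_def entropy_density_def log_def)

lemma measurable_\<phi>_w [measurable]: "\<phi> \<in> borel_measurable borel" "w \<in> borel_measurable borel"
proof -
  have "RN_deriv \<mu> \<nu> \<in> borel_measurable borel"
    using borel_measurable_RN_deriv[of \<mu> \<nu>] by (simp cong: measurable_cong_sets)
  then show [measurable]: "\<phi> \<in> borel_measurable borel" unfolding \<phi>_def by measurable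
  show "w \<in> borel_measurable borel" unfolding w_eq[abs_def] by measurable
qed

lemma density_eq: "density \<mu> (RN_deriv \<mu> \<nu>) = \<nu>"
  using \<mu>.density_RN_deriv[OF ac] by simp

lemma AE_RN: "AE x in \<mu>. RN_deriv \<mu> \<nu> x = ennreal (\<phi> x)"
proof -
  have "AE x in \<mu>. RN_deriv \<mu> \<nu> x \<noteq> \<infinity>"
    using \<mu>.RN_deriv_finite[OF \<nu>.sigma_finite_measure_axioms ac] by simp
  then show ?thesis by eventually_elim (auto simp: \<phi>_def less_top)
qed

lemma density_\<phi>: "\<nu> = density \<mu> (\<lambda>x. ennreal (\<phi> x))"
  using AE_RN by (subst density_eq[symmetric]) (intro density_cong, auto)

lemma AE_\<phi>_pos: "AE x in \<nu>. 0 < \<phi> x"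
  by (subst density_\<phi>, subst AE_density) (auto simp: ennreal_less_zero_iff)

lemma nn_integral_\<nu>:
  assumes [measurable]: "f \<in> borel_measurable borel"
  shows "(\<integral>\<^sup>+x. f x \<partial>\<nu>) = (\<integral>\<^sup>+x. ennreal (\<phi> x) * f x \<partial>\<mu>)"
  by (subst density_\<phi>, subst nn_integral_density) auto

lemma integral_\<phi>: "integrable \<mu> \<phi>" "(\<integral>x. \<phi> x \<partial>\<mu>) = 1"
proof -
  have n: "(\<integral>\<^sup>+x. ennreal (\<phi> x) \<partial>\<mu>) = ennreal 1"
    using nn_integral_\<nu>[of "\<lambda>_. 1"] \<nu>.emeasure_space_1 by simp
  show "integrable \<mu> \<phi>" by (rule integrableI_nn_integral_finite[OF _ _ n]) auto
  show "(\<integral>x. \<phi> x \<partial>\<mu>) = 1" using n by (subst integral_eq_nn_integral) auto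
qed

lemma negative_part:
  obtains b where "b \<ge> 0" "(\<integral>\<^sup>+x. ennreal (- w x) \<partial>\<nu>) = ennreal b"
proof -
  have "(\<integral>\<^sup>+x. ennreal (- w x) \<partial>\<nu>) \<le> 1"
    unfolding w_def
    by (rule nn_integral_neg_entropy_density) (auto intro: \<mu>.prob_space_axioms \<nu>.prob_space_axioms ac)
  then have "(\<integral>\<^sup>+x. ennreal (- w x) \<partial>\<nu>) < top" by (rule le_less_trans) auto
  then show ?thesis using that by (metis ennreal_cases less_irrefl)
qed

lemma relative_entropy_eq:
  "relative_entropy \<nu> \<mu> = enn2ereal (\<integral>\<^sup>+x. ennreal (w x) \<partial>\<nu>) - enn2ereal (\<integral>\<^sup>+x. ennreal (- w x) \<partial>\<nu>)"
  using ac by (simp add: relative_entropy_def w_def)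

text \<open>Formally the bound is applied to \<open>h = ln \<phi>\<close>, for which \<open>log_mgf \<mu> h = 0\<close>. That function is unbounded,
  so it is truncated at \<open>\<plusminus> k\<close>, after which the integral of its exponential is at most \<open>1 + exp (- k)\<close>;
  monotone convergence applies to the positive part, while the negative part has a finite integral.\<close>

lemma entropy_le:
  assumes bound: "\<And>h. h \<in> bounded_borel \<Longrightarrow> (\<integral>x. h x \<partial>\<nu>) \<le> c + log_mgf \<mu> h"
  shows "relative_entropy \<nu> \<mu> \<le> ereal c"
proof -
  note int = integrable_bounded_borel[OF \<nu>] and int\<mu> = integrable_bounded_borel[OF \<mu>]
  obtain b where b: "b \<ge> 0" "(\<integral>\<^sup>+x. ennreal (- w x) \<partial>\<nu>) = ennreal b" by (rule negative_part)
  define p where "p k x = max 0 (min (real k) (w x))" for k x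
  define q where "q k x = max 0 (min (real k) (- w x))" for k x
  \<comment> \<open>Where the density vanishes, \<open>ln 0 = 0\<close> has to be overruled: there the truncation is \<open>- k\<close>.\<close>
  define h where "h k x = (if \<phi> x = 0 then - real k else p k x - q k x)" for k x
  have pq: "p k \<in> bounded_borel" "q k \<in> bounded_borel" for k
    unfolding p_def[abs_def] q_def[abs_def] bounded_borel_def bounded_range_iff
    by (auto intro!: exI[of _ "real k"])
  have hb: "h k \<in> bounded_borel" for k
  proof -
    have [measurable]: "p k \<in> borel_measurable borel" "q k \<in> borel_measurable borel"
      using pq by (auto simp: bounded_borel_def)
    have "\<bar>h k x\<bar> \<le> real k" for x by (auto simp: h_def p_def q_def)
    moreover have "h k \<in> borel_measurable borel" unfolding h_def[abs_def] by measurable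
    ultimately show ?thesis unfolding bounded_borel_def bounded_range_iff by auto
  qed
  have mgf: "log_mgf \<mu> (h k) \<le> exp (- real k)" for k
  proof -
    have "log_mgf \<mu> (h k) \<le> (\<integral>x. exp (h k x) \<partial>\<mu>) - 1"
      unfolding log_mgf_def by (intro ln_le_minus_one integral_exp_pos[OF \<mu> hb])
    also have "(\<integral>x. exp (h k x) \<partial>\<mu>) \<le> (\<integral>x. \<phi> x + exp (- real k) \<partial>\<mu>)"
    proof (rule integral_mono)
      show "integrable \<mu> (\<lambda>x. exp (h k x))" by (intro int\<mu> bounded_borel_exp hb)
      show "integrable \<mu> (\<lambda>x. \<phi> x + exp (- real k))" using integral_\<phi>(1) by auto
      fix x
      have "exp (h k x) \<le> max (\<phi> x) (exp (- real k))"
      proof (cases "\<phi> x = 0 \<or> w x \<le> - real k")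
        case True
        then have "h k x = - real k" by (auto simp: h_def p_def q_def)
        then show ?thesis by simp
      next
        case False
        then have "h k x \<le> w x" "\<phi> x > 0" by (auto simp: h_def p_def q_def less_le)
        then have "exp (h k x) \<le> exp (w x)" "exp (w x) = \<phi> x" by (simp, simp add: w_eq)
        then show ?thesis by (simp del: exp_le_cancel_iff)
      qed
      also have "\<dots> \<le> \<phi> x + exp (- real k)" by simp
      finally show "exp (h k x) \<le> \<phi> x + exp (- real k)" .
    qed
    also have "\<dots> = 1 + exp (- real k)" using integral_\<phi> by (simp add: \<mu>.prob_space)
    finally show ?thesis by simp
  qed
  have qb: "(\<integral>x. q k x \<partial>\<nu>) \<le> b" for k
  proof -
    have "ennreal (\<integral>x. q k x \<partial>\<nu>) = (\<integral>\<^sup>+x. ennreal (q k x) \<partial>\<nu>)"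
      by (intro nn_integral_eq_integral[symmetric] int pq) (auto simp: q_def)
    also have "\<dots> \<le> (\<integral>\<^sup>+x. ennreal (- w x) \<partial>\<nu>)"
      by (intro nn_integral_mono) (auto simp: q_def max_def min_def ennreal_leI ennreal_neg)
    finally show ?thesis using b by simp
  qed
  have p1: "(\<integral>x. p k x \<partial>\<nu>) \<le> c + exp (- real k) + b" for k
  proof -
    have "(\<integral>x. p k x \<partial>\<nu>) - (\<integral>x. q k x \<partial>\<nu>) = (\<integral>x. p k x - q k x \<partial>\<nu>)"
      by (intro Bochner_Integration.integral_diff[symmetric] int pq)
    also have "\<dots> = (\<integral>x. h k x \<partial>\<nu>)"
      using AE_\<phi>_pos hb[of k] pq[of k]
      by (intro integral_cong_AE) (auto simp: bounded_borel_def h_def elim: eventually_mono)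
    also have "\<dots> \<le> c + exp (- real k)" using bound[OF hb[of k]] mgf[of k] by simp
    finally show ?thesis using qb[of k] by simp
  qed
  have p2: "(\<integral>x. p k x \<partial>\<nu>) \<le> c + b" for k
  proof (rule LIMSEQ_le_const)
    have "(\<lambda>m. exp (- real m)) \<longlonglongrightarrow> 0"
      by (intro filterlim_compose[OF exp_at_bot] filterlim_compose[OF filterlim_uminus_at_bot_at_top]
          filterlim_real_sequentially)
    from tendsto_add[OF tendsto_add[OF tendsto_const this] tendsto_const, of c b]
    show "(\<lambda>m. c + exp (- real m) + b) \<longlonglongrightarrow> c + b" by simp
    have "(\<integral>x. p k x \<partial>\<nu>) \<le> (\<integral>x. p m x \<partial>\<nu>)" if "k \<le> m" for m
      using that by (intro integral_mono int pq) (auto simp: p_def)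
    then show "\<exists>N. \<forall>m\<ge>N. (\<integral>x. p k x \<partial>\<nu>) \<le> c + exp (- real m) + b"
      using p1 order_trans by blast
  qed
  have "(\<integral>\<^sup>+x. ennreal (w x) \<partial>\<nu>) = (\<integral>\<^sup>+x. (SUP k. ennreal (p k x)) \<partial>\<nu>)"
  proof (intro nn_integral_cong antisym SUP_least)
    fix x
    obtain k where "w x \<le> real k" using real_arch_simple by blast
    then have "ennreal (w x) \<le> ennreal (p k x)" by (auto simp: p_def max_def min_def ennreal_neg)
    also have "\<dots> \<le> (SUP k. ennreal (p k x))" by (rule SUP_upper) auto
    finally show "ennreal (w x) \<le> (SUP k. ennreal (p k x))" .
    show "ennreal (p k x) \<le> ennreal (w x)" for k
      by (auto simp: p_def max_def min_def ennreal_leI ennreal_neg)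
  qed
  also have "\<dots> = (SUP k. \<integral>\<^sup>+x. ennreal (p k x) \<partial>\<nu>)"
    using pq by (intro nn_integral_monotone_convergence_SUP)
      (auto simp: incseq_def le_fun_def p_def bounded_borel_def intro!: ennreal_leI)
  also have "\<dots> \<le> ennreal (c + b)"
  proof (rule SUP_least)
    fix k
    have "(\<integral>\<^sup>+x. ennreal (p k x) \<partial>\<nu>) = ennreal (\<integral>x. p k x \<partial>\<nu>)"
      by (intro nn_integral_eq_integral int pq) (auto simp: p_def)
    also have "\<dots> \<le> ennreal (c + b)" by (rule ennreal_leI[OF p2])
    finally show "(\<integral>\<^sup>+x. ennreal (p k x) \<partial>\<nu>) \<le> ennreal (c + b)" .
  qed
  finally have le: "(\<integral>\<^sup>+x. ennreal (w x) \<partial>\<nu>) \<le> ennreal (c + b)" .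
  have cb: "0 \<le> c + b" using p2[of 0] by (simp add: p_def)
  have "enn2ereal (\<integral>\<^sup>+x. ennreal (w x) \<partial>\<nu>) \<le> ereal (c + b)"
    using le cb by (metis enn2ereal_ennreal less_eq_ennreal.rep_eq)
  then have "relative_entropy \<nu> \<mu> \<le> ereal (c + b) - ereal b"
    unfolding relative_entropy_eq b(2) enn2ereal_ennreal[OF b(1)] by (intro ereal_minus_mono) auto
  then show ?thesis by simp
qed

text \<open>After the change of measure \<open>\<integral> exp g d\<mu> \<ge> \<integral> exp (g - w) d\<nu>\<close> this is Jensen's inequality, in the form of
  the tangent \<open>exp m * (1 + u - m) \<le> exp u\<close> at the mean \<open>m\<close>.\<close>

lemma log_mgf_ge:
  assumes r: "relative_entropy \<nu> \<mu> = ereal r" and g: "g \<in> bounded_borel"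
  shows "(\<integral>x. g x \<partial>\<nu>) - r \<le> log_mgf \<mu> g"
proof -
  obtain b where b: "b \<ge> 0" "(\<integral>\<^sup>+x. ennreal (- w x) \<partial>\<nu>) = ennreal b" by (rule negative_part)
  have "(\<integral>\<^sup>+x. ennreal (w x) \<partial>\<nu>) \<noteq> top"
    using r unfolding relative_entropy_eq b(2) enn2ereal_ennreal[OF b(1)] by auto
  then obtain a where a: "a \<ge> 0" "(\<integral>\<^sup>+x. ennreal (w x) \<partial>\<nu>) = ennreal a" by (metis ennreal_cases)
  have rab: "r = a - b"
    using r unfolding relative_entropy_eq a(2) b(2) enn2ereal_ennreal[OF a(1)] enn2ereal_ennreal[OF b(1)] by simp
  have iw: "integrable \<nu> w" using a b by (simp add: real_integrable_def)
  have w: "(\<integral>x. w x \<partial>\<nu>) = r" using real_lebesgue_integral_def[OF iw] a b rab by simp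
  have ig: "integrable \<nu> g" by (rule integrable_bounded_borel[OF \<nu> g])
  have [measurable]: "g \<in> borel_measurable borel" using g by (simp add: bounded_borel_def)
  define m where "m = (\<integral>x. g x - w x \<partial>\<nu>)"
  have m: "m = (\<integral>x. g x \<partial>\<nu>) - r" unfolding m_def using ig iw w by simp
  have "(\<integral>\<^sup>+x. ennreal (exp (g x - w x)) \<partial>\<nu>) = (\<integral>\<^sup>+x. ennreal (\<phi> x) * ennreal (exp (g x - w x)) \<partial>\<mu>)"
    by (rule nn_integral_\<nu>) measurable
  also have "\<dots> \<le> (\<integral>\<^sup>+x. ennreal (exp (g x)) \<partial>\<mu>)"
  proof (rule nn_integral_mono)
    fix x
    show "ennreal (\<phi> x) * ennreal (exp (g x - w x)) \<le> ennreal (exp (g x))"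
    proof (cases "\<phi> x = 0")
      case False
      then have "\<phi> x > 0" by (simp add: less_le)
      then show ?thesis by (simp add: ennreal_mult[symmetric] w_eq exp_diff)
    qed simp
  qed
  also have "\<dots> = ennreal (\<integral>x. exp (g x) \<partial>\<mu>)"
    by (intro nn_integral_eq_integral integrable_bounded_borel[OF \<mu>] bounded_borel_exp g) auto
  finally have le: "(\<integral>\<^sup>+x. ennreal (exp (g x - w x)) \<partial>\<nu>) \<le> ennreal (\<integral>x. exp (g x) \<partial>\<mu>)" .
  have ie: "integrable \<nu> (\<lambda>x. exp (g x - w x))"
    using le by (intro integrableI_nonneg) (auto intro: le_less_trans simp: less_top)
  have "exp m = (\<integral>x. exp m * (1 + (g x - w x - m)) \<partial>\<nu>)"
    using ig iw by (simp add: m_def \<nu>.prob_space)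
  also have "\<dots> \<le> (\<integral>x. exp (g x - w x) \<partial>\<nu>)"
  proof (rule integral_mono[OF _ ie])
    show "integrable \<nu> (\<lambda>x. exp m * (1 + (g x - w x - m)))" using ig iw by simp
    fix x
    have "exp m * (1 + (g x - w x - m)) \<le> exp m * exp (g x - w x - m)"
      by (intro mult_left_mono exp_ge_add_one_self) auto
    then show "exp m * (1 + (g x - w x - m)) \<le> exp (g x - w x)" by (simp add: exp_add[symmetric])
  qed
  also have "\<dots> \<le> (\<integral>x. exp (g x) \<partial>\<mu>)"
  proof -
    have "ennreal (\<integral>x. exp (g x - w x) \<partial>\<nu>) \<le> ennreal (\<integral>x. exp (g x) \<partial>\<mu>)"
      using le nn_integral_eq_integral[OF ie] by simp
    then show ?thesis by (simp add: ennreal_le_iff)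
  qed
  finally have "exp m \<le> (\<integral>x. exp (g x) \<partial>\<mu>)" .
  then have "m \<le> log_mgf \<mu> g"
    unfolding log_mgf_def using integral_exp_pos[OF \<mu> g] by (simp add: ln_ge_iff)
  then show ?thesis by (simp add: m)
qed

end

lemma relative_entropy_not_MInf:
  fixes \<mu> \<nu> :: "'a::polish_space measure"
  assumes "\<mu> \<in> prob_measures" "\<nu> \<in> prob_measures"
  shows "relative_entropy \<nu> \<mu> \<noteq> -\<infinity>"
proof (cases "absolutely_continuous \<mu> \<nu>")
  case True
  interpret abs_cont_pair \<mu> \<nu> using assms True by unfold_locales
  obtain b where b: "b \<ge> 0" "(\<integral>\<^sup>+x. ennreal (- w x) \<partial>\<nu>) = ennreal b" by (rule negative_part)
  have "enn2ereal (\<integral>\<^sup>+x. ennreal (w x) \<partial>\<nu>) \<ge> 0" by simp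
  then show ?thesis unfolding relative_entropy_eq b(2) enn2ereal_ennreal[OF b(1)]
    by (cases "enn2ereal (\<integral>\<^sup>+x. ennreal (w x) \<partial>\<nu>)") auto
qed (simp add: relative_entropy_def)

text \<open>One half of the Donsker--Varadhan formula. Absolute continuity comes from testing with
  large multiples of the indicator of a null set, whose \<open>log_mgf \<mu>\<close> is \<open>0\<close>.\<close>

lemma relative_entropy_le:
  fixes \<mu> :: "'a::polish_space measure"
  assumes \<mu>: "\<mu> \<in> prob_measures" and \<nu>: "\<nu> \<in> prob_measures"
    and bound: "\<And>h. h \<in> bounded_borel \<Longrightarrow> (\<integral>x. h x \<partial>\<nu>) \<le> c + log_mgf \<mu> h"
  shows "relative_entropy \<nu> \<mu> \<le> ereal c"
proof -
  interpret \<mu>: prob_space \<mu> using prob_measuresD[OF \<mu>] by simp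
  interpret \<nu>: prob_space \<nu> using prob_measuresD[OF \<nu>] by simp
  have "absolutely_continuous \<mu> \<nu>"
    unfolding absolutely_continuous_def
  proof
    fix A assume A: "A \<in> null_sets \<mu>"
    then have A': "A \<in> sets borel" using prob_measuresD[OF \<mu>] by auto
    have Ab: "(\<lambda>x. t * indicator A x) \<in> bounded_borel" for t
      using A' by (auto simp: bounded_borel_def bounded_range_iff indicator_def intro!: exI[of _ "\<bar>t\<bar>"])
    have tA: "t * measure \<nu> A \<le> c" for t
    proof -
      have "AE x in \<mu>. exp (t * indicator A x) = 1"
        using AE_not_in[OF A] by eventually_elim auto
      then have "(\<integral>x. exp (t * indicator A x) \<partial>\<mu>) = (\<integral>x. 1 \<partial>\<mu>)"
        using A by (intro integral_cong_AE) auto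
      then have "log_mgf \<mu> (\<lambda>x. t * indicator A x) = 0" by (simp add: log_mgf_def \<mu>.prob_space)
      then show ?thesis using bound[OF Ab[of t]] A' prob_measuresD[OF \<nu>] by simp
    qed
    have "measure \<nu> A = 0"
    proof (rule ccontr)
      assume "measure \<nu> A \<noteq> 0"
      then show False using tA[of "(\<bar>c\<bar> + 1) / measure \<nu> A"] by simp
    qed
    then show "A \<in> null_sets \<nu>"
      using A' prob_measuresD[OF \<nu>] by (intro null_setsI) (auto simp: \<nu>.emeasure_eq_measure)
  qed
  then interpret abs_cont_pair \<mu> \<nu> using \<mu> \<nu> by unfold_locales
  show ?thesis using bound by (rule entropy_le)
qed

lemma gibbs_variational_inequality:
  fixes \<mu> \<nu> :: "'a::polish_space measure"
  assumes \<mu>: "\<mu> \<in> prob_measures" and \<nu>: "\<nu> \<in> prob_measures"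
    and r: "relative_entropy \<nu> \<mu> = ereal r" and g: "g \<in> bounded_borel"
  shows "(\<integral>x. g x \<partial>\<nu>) - r \<le> log_mgf \<mu> g"
proof -
  have "absolutely_continuous \<mu> \<nu>" using r by (auto simp: relative_entropy_def split: if_splits)
  then interpret abs_cont_pair \<mu> \<nu> using \<mu> \<nu> by unfold_locales
  show ?thesis by (rule log_mgf_ge[OF r g])
qed

section \<open>Weak neighbourhoods and minimax over a weakly compact set\<close>

text \<open>Weak closedness is used through the contrapositive: a closed set that contains measures with
  integrals arbitrarily close to those of \<open>\<nu>\<close>, for finitely many test functions at a time,
  contains \<open>\<nu>\<close>.\<close>

lemma weak_nbhd:
  assumes "openin weak_topology V" "\<nu> \<in> V"
  shows "\<exists>S e. finite S \<and> S \<subseteq> bounded_continuous \<and> e > 0 \<and>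
    (\<forall>\<nu>'\<in>prob_measures. (\<forall>f\<in>S. \<bar>(\<integral>x. f x \<partial>\<nu>') - (\<integral>x. f x \<partial>\<nu>)\<bar> < e) \<longrightarrow> \<nu>' \<in> V)"
  using openin_topology_generated_by[OF assms(1)[unfolded weak_topology_def]] assms(2)
proof (induction V)
  case Empty
  then show ?case by simp
next
  case (Int a b)
  then obtain S e T d where S: "finite S" "S \<subseteq> bounded_continuous" "e > 0"
      "\<forall>\<nu>'\<in>prob_measures. (\<forall>f\<in>S. \<bar>(\<integral>x. f x \<partial>\<nu>') - (\<integral>x. f x \<partial>\<nu>)\<bar> < e) \<longrightarrow> \<nu>' \<in> a"
    and T: "finite T" "T \<subseteq> bounded_continuous" "d > 0"
      "\<forall>\<nu>'\<in>prob_measures. (\<forall>f\<in>T. \<bar>(\<integral>x. f x \<partial>\<nu>') - (\<integral>x. f x \<partial>\<nu>)\<bar> < d) \<longrightarrow> \<nu>' \<in> b"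
    by auto
  show ?case
    using S T by (intro exI[of _ "S \<union> T"] exI[of _ "min e d"]) auto
next
  case (UN K)
  then obtain k where "k \<in> K" "\<nu> \<in> k" by auto
  from UN.IH[OF this] obtain S e where S: "finite S" "S \<subseteq> bounded_continuous" "e > 0"
      "\<forall>\<nu>'\<in>prob_measures. (\<forall>f\<in>S. \<bar>(\<integral>x. f x \<partial>\<nu>') - (\<integral>x. f x \<partial>\<nu>)\<bar> < e) \<longrightarrow> \<nu>' \<in> k"
    by blast
  then show ?case using \<open>k \<in> K\<close> by (intro exI[of _ S] exI[of _ e]) auto
next
  case (Basis s)
  from Basis(1) obtain f :: "'a \<Rightarrow> real" and U
    where f: "continuous_on UNIV f" "bounded (range f)" and U: "open U"
      and s: "s = {\<nu> \<in> prob_measures. (\<integral>x. f x \<partial>\<nu>) \<in> U}" by blast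
  obtain e where "e > 0" "\<And>y. dist y (\<integral>x. f x \<partial>\<nu>) < e \<Longrightarrow> y \<in> U"
    using U Basis s unfolding open_dist by auto
  then show ?case
    using f by (intro exI[of _ "{f}"] exI[of _ e]) (auto simp: bounded_continuous_def s dist_real_def)
qed

lemma openin_weak_integral:
  assumes "f \<in> bounded_continuous" "open U"
  shows "openin weak_topology {\<nu> \<in> prob_measures. (\<integral>x. f x \<partial>\<nu>) \<in> U}"
  unfolding weak_topology_def
  by (rule topology_generated_by_Basis) (use assms in \<open>auto simp: bounded_continuous_def\<close>)

lemma closedin_weak_integral:
  assumes "f \<in> bounded_continuous" "closed U"
  shows "closedin weak_topology {\<nu> \<in> prob_measures. (\<integral>x. f x \<partial>\<nu>) \<in> U}"
proof -
  have "prob_measures - {\<nu> \<in> prob_measures. (\<integral>x. f x \<partial>\<nu>) \<in> U} = {\<nu> \<in> prob_measures. (\<integral>x. f x \<partial>\<nu>) \<in> - U}"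
    by auto
  then show ?thesis
    using openin_weak_integral[OF assms(1), of "- U"] assms(2) by (auto simp: closedin_def)
qed

lemma bounded_continuous_exp:
  assumes "f \<in> bounded_continuous" shows "(\<lambda>x. exp (f x)) \<in> bounded_continuous"
proof -
  have "(\<lambda>x. exp (f x)) \<in> bounded_borel"
    using assms bounded_continuous_subset_borel by (intro bounded_borel_exp) auto
  then show ?thesis
    using assms by (auto simp: bounded_continuous_def bounded_borel_def intro!: continuous_intros)
qed

text \<open>The mixture is realised as the two-stage experiment that first tosses a coin with bias \<open>t\<close>.\<close>

lemma integral_mixture:
  fixes \<rho> :: "'a::polish_space measure"
  assumes P: "\<rho> \<in> prob_measures" "\<mu> \<in> prob_measures" "\<nu> \<in> prob_measures" and t: "0 \<le> t" "t \<le> 1"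
    and mix: "\<And>A. A \<in> sets borel \<Longrightarrow> measure \<rho> A = t * measure \<mu> A + (1 - t) * measure \<nu> A"
    and f: "f \<in> bounded_borel" "\<And>x. 0 \<le> f x"
  shows "(\<integral>x. f x \<partial>\<rho>) = t * (\<integral>x. f x \<partial>\<mu>) + (1 - t) * (\<integral>x. f x \<partial>\<nu>)"
proof -
  interpret \<rho>: prob_space \<rho> using prob_measuresD[OF P(1)] by simp
  interpret \<mu>: prob_space \<mu> using prob_measuresD[OF P(2)] by simp
  interpret \<nu>: prob_space \<nu> using prob_measuresD[OF P(3)] by simp
  have [simp, measurable_cong]: "sets \<rho> = sets borel" "sets \<mu> = sets borel" "sets \<nu> = sets borel"
    using P prob_measuresD by auto
  have [measurable]: "f \<in> borel_measurable borel" using f by (simp add: bounded_borel_def)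
  define B where "B = measure_pmf (bernoulli_pmf t)"
  define K where "K b = (if b then \<mu> else \<nu>)" for b
  have K: "K \<in> B \<rightarrow>\<^sub>M subprob_algebra borel"
    unfolding B_def K_def using P
    by (auto simp: space_subprob_algebra space_prob_algebra prob_space_imp_subprob_space)
  have "\<rho> = B \<bind> K"
  proof (rule measure_eqI)
    show "sets \<rho> = sets (B \<bind> K)"
      by (subst sets_bind[where N=borel]) (auto simp: B_def K_def)
    fix A assume "A \<in> sets \<rho>"
    then have A: "A \<in> sets borel" by simp
    have "emeasure (B \<bind> K) A = (\<integral>\<^sup>+b. emeasure (K b) A \<partial>B)"
      using A K by (intro emeasure_bind[where N=borel]) (auto simp: B_def)
    also have "\<dots> = emeasure \<mu> A * t + emeasure \<nu> A * (1 - t)"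
      unfolding B_def using t by (subst nn_integral_bernoulli_pmf) (auto simp: K_def)
    also have "\<dots> = emeasure \<rho> A"
      using mix[OF A] t
      by (simp add: \<rho>.emeasure_eq_measure \<mu>.emeasure_eq_measure \<nu>.emeasure_eq_measure ennreal_mult ennreal_plus mult.commute)
    finally show "emeasure \<rho> A = emeasure (B \<bind> K) A" ..
  qed
  then have "(\<integral>\<^sup>+x. ennreal (f x) \<partial>\<rho>) = (\<integral>\<^sup>+b. \<integral>\<^sup>+x. ennreal (f x) \<partial>K b \<partial>B)"
    by (simp add: nn_integral_bind[OF _ K])
  also have "\<dots> = (\<integral>\<^sup>+x. ennreal (f x) \<partial>\<mu>) * t + (\<integral>\<^sup>+x. ennreal (f x) \<partial>\<nu>) * (1 - t)"
    unfolding B_def using t by (subst nn_integral_bernoulli_pmf) (auto simp: K_def)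
  finally have nn: "(\<integral>\<^sup>+x. ennreal (f x) \<partial>\<rho>) = (\<integral>\<^sup>+x. ennreal (f x) \<partial>\<mu>) * t + (\<integral>\<^sup>+x. ennreal (f x) \<partial>\<nu>) * (1 - t)" .
  have eq: "(\<integral>\<^sup>+x. ennreal (f x) \<partial>\<tau>) = ennreal (\<integral>x. f x \<partial>\<tau>)" if "\<tau> \<in> prob_measures" for \<tau>
    by (intro nn_integral_eq_integral integrable_bounded_borel[OF that f(1)]) (use f in auto)
  have pos: "0 \<le> (\<integral>x. f x \<partial>\<tau>)" for \<tau> using f by simp
  have "ennreal (\<integral>x. f x \<partial>\<rho>) = ennreal (t * (\<integral>x. f x \<partial>\<mu>) + (1 - t) * (\<integral>x. f x \<partial>\<nu>))"
    using nn t pos unfolding eq[OF P(1)] eq[OF P(2)] eq[OF P(3)]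
    by (simp add: ennreal_mult ennreal_plus mult.commute)
  then show ?thesis using pos t by (subst (asm) ennreal_inj) auto
qed

lemma log_mgf_concave_measure:
  fixes \<rho> :: "'a::polish_space measure"
  assumes P: "\<rho> \<in> prob_measures" "\<mu> \<in> prob_measures" "\<nu> \<in> prob_measures" and t: "0 \<le> t" "t \<le> 1"
    and mix: "\<And>A. A \<in> sets borel \<Longrightarrow> measure \<rho> A = t * measure \<mu> A + (1 - t) * measure \<nu> A"
    and f: "f \<in> bounded_borel"
  shows "t * log_mgf \<mu> f + (1 - t) * log_mgf \<nu> f \<le> log_mgf \<rho> f"
proof -
  have "concave_on {0<..} (ln :: real \<Rightarrow> real)" by (rule ln_concave)
  have eq: "(\<integral>x. exp (f x) \<partial>\<rho>) = t * (\<integral>x. exp (f x) \<partial>\<mu>) + (1 - t) * (\<integral>x. exp (f x) \<partial>\<nu>)"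
    by (intro integral_mixture P t mix bounded_borel_exp f) auto
  from concave_onD[OF \<open>concave_on {0<..} ln\<close>, of "1 - t" "\<integral>x. exp (f x) \<partial>\<mu>" "\<integral>x. exp (f x) \<partial>\<nu>"]
  show ?thesis
    unfolding log_mgf_def eq
    using t integral_exp_pos[OF P(2) f] integral_exp_pos[OF P(3) f] by (simp add: algebra_simps)
qed

text \<open>This is Hoelder's inequality. Dividing \<open>exp f\<close> and \<open>exp g\<close> by their integrals reduces it to the pointwise
  convexity of the exponential.\<close>

lemma log_mgf_convex:
  fixes \<mu> :: "'a::polish_space measure"
  assumes \<mu>: "\<mu> \<in> prob_measures" and f: "f \<in> bounded_borel" and g: "g \<in> bounded_borel" and t: "0 \<le> t" "t \<le> 1"
  shows "log_mgf \<mu> (\<lambda>x. t * f x + (1 - t) * g x) \<le> t * log_mgf \<mu> f + (1 - t) * log_mgf \<mu> g"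
proof -
  note int = integrable_bounded_borel[OF \<mu>]
  define A B where "A = log_mgf \<mu> f" and "B = log_mgf \<mu> g"
  define Z where "Z = t * A + (1 - t) * B"
  define h where "h x = t * f x + (1 - t) * g x" for x
  have h: "h \<in> bounded_borel" unfolding h_def[abs_def] by (rule bounded_borel_lincomb[OF f g])
  have A: "exp A = (\<integral>x. exp (f x) \<partial>\<mu>)" and B: "exp B = (\<integral>x. exp (g x) \<partial>\<mu>)"
    unfolding A_def B_def log_mgf_def using integral_exp_pos[OF \<mu> f] integral_exp_pos[OF \<mu> g] by auto
  have "(\<integral>x. exp (h x) \<partial>\<mu>) * exp (- Z)
      = (\<integral>x. exp (h x) * exp (- Z) \<partial>\<mu>)" by simp
  also have "\<dots> \<le> (\<integral>x. t * (exp (f x) / exp A) + (1 - t) * (exp (g x) / exp B) \<partial>\<mu>)"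
  proof (rule integral_mono)
    show "integrable \<mu> (\<lambda>x. exp (h x) * exp (- Z))"
      by (intro integrable_mult_left int bounded_borel_exp h)
    show "integrable \<mu> (\<lambda>x. t * (exp (f x) / exp A) + (1 - t) * (exp (g x) / exp B))"
      by (intro Bochner_Integration.integrable_add integrable_mult_right integrable_divide int bounded_borel_exp f g)
    fix x
    have "exp (h x) * exp (- Z) = exp (t * (f x - A) + (1 - t) * (g x - B))"
      unfolding exp_add[symmetric] by (simp add: h_def Z_def algebra_simps)
    also have "\<dots> \<le> t * exp (f x - A) + (1 - t) * exp (g x - B)"
      using convex_onD[OF exp_convex, of "1 - t" "f x - A" "g x - B"] t by simp
    finally show "exp (h x) * exp (- Z)
        \<le> t * (exp (f x) / exp A) + (1 - t) * (exp (g x) / exp B)" by (simp add: exp_diff)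
  qed
  also have "\<dots> = (\<integral>x. t * (exp (f x) / exp A) \<partial>\<mu>) + (\<integral>x. (1 - t) * (exp (g x) / exp B) \<partial>\<mu>)"
    by (intro Bochner_Integration.integral_add integrable_mult_right integrable_divide int bounded_borel_exp f g)
  also have "\<dots> = 1" using A[symmetric] B[symmetric] by simp
  finally have "(\<integral>x. exp (h x) \<partial>\<mu>) \<le> exp Z"
    by (simp add: exp_minus field_simps)
  then show ?thesis
    unfolding A_def[symmetric] B_def[symmetric] Z_def[symmetric] unfolding log_mgf_def h_def[symmetric]
    using integral_exp_pos[OF \<mu> h] by (metis ln_exp ln_le_cancel_iff exp_gt_zero)
qed

lemma log_mgf_bounds:
  assumes "\<mu> \<in> prob_measures" "f \<in> bounded_borel" "\<And>x. \<bar>f x\<bar> \<le> R"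
  shows "- R \<le> log_mgf \<mu> f" "log_mgf \<mu> f \<le> R"
proof -
  have "- R \<le> f x" "f x \<le> R" for x using assms(3)[of x] by auto
  then show "- R \<le> log_mgf \<mu> f" "log_mgf \<mu> f \<le> R"
    unfolding log_mgf_def
    using integral_exp_ge[OF assms(1,2)] integral_exp_le[OF assms(1,2)] integral_exp_pos[OF assms(1,2)]
    by (simp add: ln_ge_iff, metis ln_exp ln_le_cancel_iff exp_gt_zero)
qed

text \<open>For each \<open>f\<close> and each \<open>e > 0\<close> the admissible \<open>\<mu>\<close> form a weakly closed set, because \<open>exp f\<close> is
  again bounded and continuous; \<open>finite_minimax\<close> is the finite intersection property of these sets,
  and compactness of \<open>M\<close> does the rest.\<close>

lemma minimax_over_measures:
  fixes M :: "'a::polish_space measure set"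
  assumes M: "M \<subseteq> prob_measures" "M \<noteq> {}" "convex_measures M" "compactin weak_topology M"
    and linear: "\<And>f g a b. f \<in> bounded_continuous \<Longrightarrow> g \<in> bounded_continuous \<Longrightarrow>
      \<Lambda> (\<lambda>x. a * f x + b * g x) = a * \<Lambda> f + b * \<Lambda> g"
    and sup_inf: "\<And>f e. f \<in> bounded_continuous \<Longrightarrow> e > 0 \<Longrightarrow> \<exists>\<mu>\<in>M. \<Lambda> f \<le> c + e + log_mgf \<mu> f"
  shows "\<exists>\<mu>\<in>M. \<forall>f\<in>bounded_continuous. \<Lambda> f \<le> c + log_mgf \<mu> f"
proof -
  let ?C = "bounded_continuous :: ('a \<Rightarrow> real) set"
  have CB: "f \<in> bounded_borel" if "f \<in> ?C" for f using that bounded_continuous_subset_borel by auto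
  have MP: "\<mu> \<in> prob_measures" if "\<mu> \<in> M" for \<mu> using that M by auto
  \<comment> \<open>Membership means \<open>\<Lambda> f \<le> c + e + log_mgf \<mu> f\<close>, written as a closed condition on one integral.\<close>
  define K where "K = (\<lambda>(f, e). {\<mu> \<in> prob_measures. (\<integral>x. exp (f x) \<partial>\<mu>) \<in> {exp (\<Lambda> f - c - e)..}})"
  have K_iff: "\<mu> \<in> K (f, e) \<longleftrightarrow> \<mu> \<in> prob_measures \<and> \<Lambda> f \<le> c + e + log_mgf \<mu> f" if "f \<in> ?C" for f e \<mu>
    using integral_exp_pos[of \<mu> f] CB[OF that] by (auto simp: K_def log_mgf_def ln_ge_iff[symmetric] algebra_simps)
  let ?I = "?C \<times> {0<..}"
  have closed: "closedin weak_topology C" if "C \<in> K ` ?I" for C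
    using that unfolding K_def
    by (auto intro!: closedin_weak_integral bounded_continuous_exp simp del: atLeast_iff)
  have fip: "M \<inter> \<Inter>\<F> \<noteq> {}" if fin: "finite \<F>" and sub: "\<F> \<subseteq> K ` ?I" for \<F>
  proof -
    obtain T where T: "T \<subseteq> ?I" "finite T" "\<F> = K ` T"
      using finite_subset_image[OF fin sub] by blast
    \<comment> \<open>The \<open>1\<close> is there for the empty family.\<close>
  define d where "d = Min (insert 1 (snd ` T))"
    have d: "d > 0" "\<And>f e. (f, e) \<in> T \<Longrightarrow> d \<le> e"
    proof -
      have "d \<in> insert 1 (snd ` T)" unfolding d_def using T by (intro Min_in) auto
      then show "d > 0" using T by auto
      show "d \<le> e" if "(f, e) \<in> T" for f e
        unfolding d_def using T that by (intro Min_le) force+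
    qed
    have "\<exists>\<mu>\<in>M. \<forall>f\<in>fst ` T. \<Lambda> f - log_mgf \<mu> f \<le> c + d"
    proof (rule finite_minimax[where C="?C" and c="c + d / 2"])
      show "finite (fst ` T)" "fst ` T \<subseteq> ?C" using T by auto
      show "c + d / 2 < c + d" using d by simp
      show "M \<noteq> {}" by fact
      show "\<exists>\<mu>\<in>M. \<Lambda> f - log_mgf \<mu> f \<le> c + d / 2" if "f \<in> ?C" for f
        using sup_inf[OF that, of "d / 2"] d by (auto simp: algebra_simps)
      show "\<exists>\<rho>\<in>M. \<forall>f\<in>?C. \<Lambda> f - log_mgf \<rho> f \<le> t * (\<Lambda> f - log_mgf \<mu> f) + (1 - t) * (\<Lambda> f - log_mgf \<nu> f)"
        if \<mu>: "\<mu> \<in> M" and \<nu>: "\<nu> \<in> M" and t: "0 \<le> t" "t \<le> 1" for \<mu> \<nu> t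
      proof -
        obtain \<rho> where \<rho>: "\<rho> \<in> M" "\<And>A. A \<in> sets borel \<Longrightarrow> measure \<rho> A = t * measure \<mu> A + (1 - t) * measure \<nu> A"
          using M(3) \<mu> \<nu> t unfolding convex_measures_def by (metis atLeastAtMost_iff)
        have "\<Lambda> f - log_mgf \<rho> f \<le> t * (\<Lambda> f - log_mgf \<mu> f) + (1 - t) * (\<Lambda> f - log_mgf \<nu> f)" if "f \<in> ?C" for f
          using log_mgf_concave_measure[OF MP[OF \<rho>(1)] MP[OF \<mu>] MP[OF \<nu>] t \<rho>(2) CB[OF that]]
          by (simp add: algebra_simps)
        then show ?thesis using \<rho>(1) by blast
      qed
      show "\<exists>h\<in>?C. \<forall>\<mu>\<in>M. t * (\<Lambda> f - log_mgf \<mu> f) + (1 - t) * (\<Lambda> g - log_mgf \<mu> g) \<le> \<Lambda> h - log_mgf \<mu> h"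
        if f: "f \<in> ?C" and g: "g \<in> ?C" and t: "0 \<le> t" "t \<le> 1" for f g t
      proof (intro bexI[of _ "\<lambda>x. t * f x + (1 - t) * g x"] ballI)
        show "(\<lambda>x. t * f x + (1 - t) * g x) \<in> ?C" by (rule bounded_continuous_lincomb[OF f g])
        fix \<mu> assume "\<mu> \<in> M"
        from log_mgf_convex[OF MP[OF this] CB[OF f] CB[OF g] t]
        show "t * (\<Lambda> f - log_mgf \<mu> f) + (1 - t) * (\<Lambda> g - log_mgf \<mu> g)
            \<le> \<Lambda> (\<lambda>x. t * f x + (1 - t) * g x) - log_mgf \<mu> (\<lambda>x. t * f x + (1 - t) * g x)"
          unfolding linear[OF f g] by (simp add: algebra_simps)
      qed
    qed
    then obtain \<mu> where \<mu>: "\<mu> \<in> M" "\<And>f. f \<in> fst ` T \<Longrightarrow> \<Lambda> f - log_mgf \<mu> f \<le> c + d" by blast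
    have "\<mu> \<in> K (f, e)" if fe: "(f, e) \<in> T" for f e
    proof -
      have "f \<in> fst ` T" "f \<in> ?C" using fe T by force+
      then show ?thesis using \<mu>(2)[of f] d(2)[OF fe] MP[OF \<mu>(1)] by (simp add: K_iff)
    qed
    then show ?thesis using \<mu>(1) T(3) by auto
  qed
  have "M \<inter> \<Inter>(K ` ?I) \<noteq> {}"
    by (rule M(4)[unfolded compactin_fip, THEN conjunct2, rule_format, OF conjI]) (use closed fip in auto)
  then obtain \<mu> where "\<mu> \<in> M \<inter> \<Inter>(K ` ?I)" unfolding ex_in_conv[symmetric] ..
  note \<mu> = IntD1[OF this] and K = IntD2[OF this]
  have \<mu>K: "\<mu> \<in> K (f, e)" if "f \<in> ?C" "e > 0" for f e
    by (rule INT_D[OF K]) (use that in simp)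
  have "\<Lambda> f \<le> c + log_mgf \<mu> f" if "f \<in> ?C" for f
  proof (rule field_le_epsilon)
    fix e :: real assume "e > 0"
    from \<mu>K[OF that this] show "\<Lambda> f \<le> c + log_mgf \<mu> f + e" unfolding K_iff[OF that] by simp
  qed
  then show ?thesis using \<mu> by blast
qed

section \<open>Covering a closed set by half-spaces\<close>

definition sup_log_mgf :: "'a measure set \<Rightarrow> ('a \<Rightarrow> real) \<Rightarrow> real" where
  "sup_log_mgf M f = (SUP \<mu>\<in>M. log_mgf \<mu> f)"

lemma log_mgf_le_sup:
  assumes "M \<subseteq> prob_measures" "\<mu> \<in> M" "f \<in> bounded_borel"
  shows "log_mgf \<mu> f \<le> sup_log_mgf M f"
proof -
  obtain R where "\<And>x. \<bar>f x\<bar> \<le> R" using bounded_borel_bound[OF assms(3)] by blast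
  then have "bdd_above ((\<lambda>\<mu>. log_mgf \<mu> f) ` M)"
    using assms log_mgf_bounds(2) by (intro bdd_aboveI2[where M=R]) blast
  then show ?thesis unfolding sup_log_mgf_def using assms(2) by (rule cSUP_upper[rotated])
qed

lemma sup_log_mgf_attained:
  assumes "M \<noteq> {}" "e > 0"
  shows "\<exists>\<mu>\<in>M. sup_log_mgf M f < log_mgf \<mu> f + e"
proof (rule ccontr)
  assume "\<not> ?thesis"
  then have "sup_log_mgf M f \<le> sup_log_mgf M f - e"
    using assms(1) unfolding sup_log_mgf_def by (intro cSUP_least) (auto simp: not_less algebra_simps)
  then show False using assms(2) by simp
qed

text \<open>The compactness argument takes place among functionals on the bounded continuous functions, since
  a weakly closed set is in general not weakly compact. A limit functional that is in no half-space is shown to be a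
  measure in \<open>A\<close> of too small an entropy.\<close>

lemma half_space_cover:
  fixes M A :: "'a::polish_space measure set"
  assumes M: "M \<subseteq> prob_measures" "M \<noteq> {}" "convex_measures M" "compactin weak_topology M"
    and A: "closedin weak_topology A"
    and c: "\<And>\<nu> \<mu>. \<nu> \<in> A \<Longrightarrow> \<mu> \<in> M \<Longrightarrow> ereal c < relative_entropy \<nu> \<mu>"
  shows "\<exists>S. finite S \<and> S \<subseteq> bounded_continuous \<and> (\<forall>\<nu>\<in>A. \<exists>f\<in>S. c + sup_log_mgf M f < (\<integral>x. f x \<partial>\<nu>))"
proof (rule ccontr)
  assume no: "\<not> ?thesis"
  let ?C = "bounded_continuous :: ('a \<Rightarrow> real) set"
  have CB: "f \<in> bounded_borel" if "f \<in> ?C" for f using that bounded_continuous_subset_borel by auto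
  have AP: "A \<subseteq> prob_measures" using closedin_subset[OF A] by simp
  let ?X = "product_topology (\<lambda>_. euclideanreal) ?C"
  define \<Phi> where "\<Phi> \<nu> = restrict (\<lambda>f. \<integral>x. f x \<partial>\<nu>) ?C" for \<nu> :: "'a measure"
  have "\<forall>f\<in>?C. \<exists>R. \<forall>x. \<bar>f x\<bar> \<le> R" by (auto simp: bounded_continuous_def bounded_range_iff)
  then obtain R where R: "\<And>f x. f \<in> ?C \<Longrightarrow> \<bar>f x\<bar> \<le> R f" by metis
  define B where "B = (\<Pi>\<^sub>E f\<in>?C. {- R f..R f})"
  have compact: "compactin ?X B"
    unfolding B_def compactin_PiE by auto
  have \<Phi>B: "\<Phi> \<nu> \<in> B" if "\<nu> \<in> A" for \<nu>
  proof -
    have \<nu>: "\<nu> \<in> prob_measures" using AP that by auto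
    have "\<bar>\<integral>x. f x \<partial>\<nu>\<bar> \<le> R f" if f: "f \<in> ?C" for f
      by (rule abs_integral_le_bound[OF \<nu> CB[OF f] R[OF f]])
    then show ?thesis by (auto simp: B_def \<Phi>_def abs_le_iff minus_le_iff)
  qed
  define K where "K f = {\<Lambda> \<in> topspace ?X. \<Lambda> f \<in> {..c + sup_log_mgf M f}}" for f
  have closed: "closedin ?X T" if "T \<in> insert (?X closure_of (\<Phi> ` A)) (K ` ?C)" for T
  proof -
    have "closedin ?X (K f)" if "f \<in> ?C" for f
      unfolding K_def
      by (rule closedin_continuous_map_preimage[OF continuous_map_product_projection[OF that]]) simp
    then show ?thesis using that by auto
  qed
  have fip: "B \<inter> \<Inter>\<F> \<noteq> {}" if fin: "finite \<F>" and sub: "\<F> \<subseteq> insert (?X closure_of (\<Phi> ` A)) (K ` ?C)" for \<F>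
  proof -
    have "finite (\<F> - {?X closure_of (\<Phi> ` A)})" "\<F> - {?X closure_of (\<Phi> ` A)} \<subseteq> K ` ?C" using fin sub by auto
    then obtain S where S: "S \<subseteq> ?C" "finite S" "\<F> - {?X closure_of (\<Phi> ` A)} = K ` S"
      using finite_subset_image by metis
    then obtain \<nu> where \<nu>: "\<nu> \<in> A" "\<And>f. f \<in> S \<Longrightarrow> (\<integral>x. f x \<partial>\<nu>) \<le> c + sup_log_mgf M f"
      using no by (meson not_le)
    have "\<Phi> ` A \<subseteq> topspace ?X" by (auto simp: \<Phi>_def)
    then have "\<Phi> \<nu> \<in> ?X closure_of (\<Phi> ` A)" using closure_of_subset \<nu>(1) by blast
    moreover have "\<Phi> \<nu> \<in> K f" if "f \<in> S" for f
      using \<nu>(2)[OF that] S(1) that by (auto simp: K_def \<Phi>_def)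
    ultimately have "\<Phi> \<nu> \<in> T" if "T \<in> \<F>" for T using that S(3) by blast
    then show ?thesis using \<Phi>B[OF \<nu>(1)] by blast
  qed
  have "B \<inter> \<Inter>(insert (?X closure_of (\<Phi> ` A)) (K ` ?C)) \<noteq> {}"
    by (rule compact[unfolded compactin_fip, THEN conjunct2, rule_format, OF conjI]) (use closed fip in auto)
  then obtain \<Lambda> where \<Lambda>: "\<Lambda> \<in> B \<inter> \<Inter>(insert (?X closure_of (\<Phi> ` A)) (K ` ?C))"
    unfolding ex_in_conv[symmetric] ..
  have \<Lambda>cl: "\<Lambda> \<in> ?X closure_of (\<Phi> ` A)" using \<Lambda> by blast
  have \<Lambda>K: "\<Lambda> \<in> K f" if "f \<in> ?C" for f using \<Lambda> that by blast
  have approx: "\<exists>\<nu>\<in>A. \<forall>f\<in>S. \<bar>(\<integral>x. f x \<partial>\<nu>) - \<Lambda> f\<bar> < e" if S: "finite S" "S \<subseteq> ?C" and e: "e > 0" for S e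
  proof -
    \<comment> \<open>A single sum controls all coordinates in \<open>S\<close> by one continuous function.\<close>
    let ?U = "{\<Lambda>' \<in> topspace ?X. (\<Sum>f\<in>S. \<bar>\<Lambda>' f - \<Lambda> f\<bar>) \<in> {..<e}}"
    have U: "openin ?X ?U"
    proof (rule openin_continuous_map_preimage[where Y=euclideanreal])
      show "continuous_map ?X euclideanreal (\<lambda>\<Lambda>'. \<Sum>f\<in>S. \<bar>\<Lambda>' f - \<Lambda> f\<bar>)"
        using S by (intro continuous_map_sum continuous_map_real_abs continuous_map_diff
            continuous_map_product_projection) auto
    qed auto
    have \<Lambda>U: "\<Lambda> \<in> ?U" using \<Lambda>cl e by (auto simp: in_closure_of)
    from \<Lambda>cl[unfolded in_closure_of, THEN conjunct2, rule_format, OF conjI[OF \<Lambda>U U]]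
    obtain \<Lambda>' where "\<Lambda>' \<in> \<Phi> ` A" and \<Lambda>': "\<Lambda>' \<in> ?U" by (elim exE conjE)
    then obtain \<nu> where \<nu>: "\<nu> \<in> A" "\<Lambda>' = \<Phi> \<nu>" by (elim imageE)
    note \<nu>U = \<Lambda>'[unfolded \<nu>(2)]
    have "\<bar>(\<integral>x. f x \<partial>\<nu>) - \<Lambda> f\<bar> < e" if f: "f \<in> S" for f
    proof -
      have "\<bar>(\<integral>x. f x \<partial>\<nu>) - \<Lambda> f\<bar> = \<bar>\<Phi> \<nu> f - \<Lambda> f\<bar>" using f S by (auto simp: \<Phi>_def)
      also have "\<dots> \<le> (\<Sum>f\<in>S. \<bar>\<Phi> \<nu> f - \<Lambda> f\<bar>)"
        using f S by (intro member_le_sum) auto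
      also have "\<dots> < e" using \<nu>U by simp
      finally show ?thesis .
    qed
    then show ?thesis using \<nu>(1) by (intro bexI[of _ \<nu>] ballI)
  qed
  \<comment> \<open>Linearity involves three coordinates of \<open>\<Lambda>\<close> at a time, and holds for the integrals near \<open>\<Lambda>\<close>.\<close>
  have linear: "\<Lambda> (\<lambda>x. a * f x + b * g x) = a * \<Lambda> f + b * \<Lambda> g" if f: "f \<in> ?C" and g: "g \<in> ?C" for f g a b
  proof -
    let ?h = "\<lambda>x. a * f x + b * g x"
    have h: "?h \<in> ?C" by (rule bounded_continuous_lincomb[OF f g])
    have "\<bar>\<Lambda> ?h - (a * \<Lambda> f + b * \<Lambda> g)\<bar> \<le> e * (1 + \<bar>a\<bar> + \<bar>b\<bar>)" if e: "e > 0" for e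
    proof -
      obtain \<nu> where \<nu>: "\<nu> \<in> A" "\<And>k. k \<in> {f, g, ?h} \<Longrightarrow> \<bar>(\<integral>x. k x \<partial>\<nu>) - \<Lambda> k\<bar> < e"
        using approx[of "{f, g, ?h}" e] e f g h by auto
      have \<nu>P: "\<nu> \<in> prob_measures" using AP \<nu> by auto
      have eq: "(\<integral>x. ?h x \<partial>\<nu>) = a * (\<integral>x. f x \<partial>\<nu>) + b * (\<integral>x. g x \<partial>\<nu>)"
        using integrable_bounded_borel[OF \<nu>P CB[OF f]] integrable_bounded_borel[OF \<nu>P CB[OF g]] by simp
      have "\<Lambda> ?h - (a * \<Lambda> f + b * \<Lambda> g) = - ((\<integral>x. ?h x \<partial>\<nu>) - \<Lambda> ?h)
          + (a * ((\<integral>x. f x \<partial>\<nu>) - \<Lambda> f) + b * ((\<integral>x. g x \<partial>\<nu>) - \<Lambda> g))"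
        unfolding eq by (simp add: algebra_simps)
      then have "\<bar>\<Lambda> ?h - (a * \<Lambda> f + b * \<Lambda> g)\<bar> \<le> \<bar>(\<integral>x. ?h x \<partial>\<nu>) - \<Lambda> ?h\<bar>
          + (\<bar>a\<bar> * \<bar>(\<integral>x. f x \<partial>\<nu>) - \<Lambda> f\<bar> + \<bar>b\<bar> * \<bar>(\<integral>x. g x \<partial>\<nu>) - \<Lambda> g\<bar>)"
        unfolding abs_mult[symmetric] by linarith
      also have "\<dots> \<le> e + (\<bar>a\<bar> * e + \<bar>b\<bar> * e)"
        using \<nu>(2) by (intro add_mono mult_left_mono) (auto intro: less_imp_le)
      finally show ?thesis by (simp add: algebra_simps)
    qed
    note le = this
    have "\<bar>\<Lambda> ?h - (a * \<Lambda> f + b * \<Lambda> g)\<bar> \<le> 0 + e" if "e > 0" for e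
    proof -
      have "0 < 1 + \<bar>a\<bar> + \<bar>b\<bar>" by (smt (verit) abs_ge_zero)
      then show ?thesis using le[of "e / (1 + \<bar>a\<bar> + \<bar>b\<bar>)"] that by simp
    qed
    then have "\<bar>\<Lambda> ?h - (a * \<Lambda> f + b * \<Lambda> g)\<bar> \<le> 0" by (rule field_le_epsilon)
    then show ?thesis by simp
  qed
  have "\<exists>\<mu>\<in>M. \<Lambda> f \<le> c + e + log_mgf \<mu> f" if f: "f \<in> ?C" and e: "e > 0" for f e
  proof -
    obtain \<mu> where "\<mu> \<in> M" "sup_log_mgf M f < log_mgf \<mu> f + e"
      using sup_log_mgf_attained[OF M(2) e] by blast
    then show ?thesis using \<Lambda>K[OF f] by (intro bexI[of _ \<mu>]) (auto simp: K_def)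
  qed
  from minimax_over_measures[OF M linear this] obtain \<mu>
    where \<mu>: "\<mu> \<in> M" "\<And>f. f \<in> ?C \<Longrightarrow> \<Lambda> f \<le> c + log_mgf \<mu> f" by blast
  have \<mu>P: "\<mu> \<in> prob_measures" using \<mu> M by auto
  have "entropy_bounded_functional \<mu> ?C \<Lambda> c"
    using \<mu>P bounded_continuous_subset_borel bounded_continuous_lincomb linear \<mu>(2) by unfold_locales auto
  from extend_to_bounded_borel[OF this] obtain L where
    L: "entropy_bounded_functional \<mu> bounded_borel L c" "\<And>f. f \<in> ?C \<Longrightarrow> L f = \<Lambda> f" by blast
  from represent_by_measure[OF L(1)] obtain \<nu> where
    \<nu>: "\<nu> \<in> prob_measures" "\<And>h. h \<in> bounded_borel \<Longrightarrow> L h = (\<integral>x. h x \<partial>\<nu>)" by blast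
  have "relative_entropy \<nu> \<mu> \<le> ereal c"
    using \<nu>(2) entropy_bounded_functional.bound[OF L(1)] by (intro relative_entropy_le \<mu>P \<nu>(1)) fastforce
  moreover have "\<nu> \<in> A"
  proof (rule ccontr)
    assume "\<nu> \<notin> A"
    then have "\<nu> \<in> prob_measures - A" using \<nu> by auto
    moreover have "openin weak_topology (prob_measures - A)" using A by (auto simp: closedin_def)
    ultimately obtain S where "\<exists>e. finite S \<and> S \<subseteq> ?C \<and> e > 0 \<and> (\<forall>\<nu>'\<in>prob_measures.
        (\<forall>f\<in>S. \<bar>(\<integral>x. f x \<partial>\<nu>') - (\<integral>x. f x \<partial>\<nu>)\<bar> < e) \<longrightarrow> \<nu>' \<in> prob_measures - A)"
      using weak_nbhd[of "prob_measures - A" \<nu>] by meson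
    then obtain e where Se: "finite S \<and> S \<subseteq> ?C \<and> e > 0 \<and> (\<forall>\<nu>'\<in>prob_measures.
        (\<forall>f\<in>S. \<bar>(\<integral>x. f x \<partial>\<nu>') - (\<integral>x. f x \<partial>\<nu>)\<bar> < e) \<longrightarrow> \<nu>' \<in> prob_measures - A)" ..
    have S: "finite S" "S \<subseteq> ?C" "e > 0" using Se by simp_all
    have S4: "\<nu>' \<in> prob_measures - A"
      if "\<nu>' \<in> prob_measures" "\<forall>f\<in>S. \<bar>(\<integral>x. f x \<partial>\<nu>') - (\<integral>x. f x \<partial>\<nu>)\<bar> < e" for \<nu>'
      using Se[THEN conjunct2, THEN conjunct2, THEN conjunct2, rule_format, OF that(1)] that(2) by simp
    from approx[OF S] obtain \<nu>' where \<nu>': "\<nu>' \<in> A" "\<forall>f\<in>S. \<bar>(\<integral>x. f x \<partial>\<nu>') - \<Lambda> f\<bar> < e" ..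
    have "\<Lambda> f = (\<integral>x. f x \<partial>\<nu>)" if "f \<in> S" for f
      using that S(2) L(2) \<nu>(2) CB by (metis subsetD)
    then have "\<nu>' \<in> prob_measures - A" using \<nu>' AP by (intro S4) auto
    then show False using \<nu>'(1) by simp
  qed
  ultimately show False using c[OF _ \<mu>(1)] by (metis not_le)
qed

section \<open>Empirical measures\<close>

lemma empirical_measure_in_prob_measures:
  assumes "n \<ge> 1"
  shows "empirical_measure n x \<in> prob_measures"
proof -
  have "prob_space (uniform_count_measure {..<n})"
    using assms by (intro prob_space_uniform_count_measure) (auto simp: lessThan_empty_iff)
  then have "prob_space (empirical_measure n x)"
    unfolding empirical_measure_def by (rule prob_space.prob_space_distr) (auto simp: measurable_def)
  then show ?thesis by (simp add: space_prob_algebra empirical_measure_def)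
qed

lemma integral_empirical_measure:
  fixes f :: "'a::topological_space \<Rightarrow> real"
  assumes "f \<in> borel_measurable borel"
  shows "(\<integral>y. f y \<partial>empirical_measure n x) = (\<Sum>i<n. f (x i)) / n"
proof -
  have "(\<integral>y. f y \<partial>empirical_measure n x) = (\<integral>i. f (x i) \<partial>uniform_count_measure {..<n})"
    unfolding empirical_measure_def using assms by (intro integral_distr) (auto simp: measurable_def)
  then show ?thesis by (simp add: integral_uniform_count_measure)
qed

text \<open>The empirical measure is continuous on the space of all sequences, where the Borel and the product
  sigma-algebra agree; the set is pulled back along the inclusion of the \<open>n\<close>-tuples, which are
  themselves functions on all of \<open>nat\<close> (constant outside \<open>{..<n}\<close>).\<close>

lemma empirical_measure_vimage_measurable:
  fixes V :: "'a::polish_space measure set"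
  assumes n: "n \<ge> 1" and V: "openin weak_topology V"
  shows "{x \<in> space (borel_power n). empirical_measure n x \<in> V} \<in> sets (borel_power n)"
proof -
  have "continuous_map euclidean weak_topology (empirical_measure n :: (nat \<Rightarrow> 'a) \<Rightarrow> 'a measure)"
    unfolding weak_topology_def
  proof (rule continuous_on_generated_topo)
    fix U :: "'a measure set"
    assume "U \<in> {{\<nu> \<in> prob_measures. (\<integral>x. f x \<partial>\<nu>) \<in> W} | (f :: 'a \<Rightarrow> real) W.
      continuous_on UNIV f \<and> bounded (range f) \<and> open W}"
    then obtain f :: "'a \<Rightarrow> real" and W where f: "continuous_on UNIV f" and W: "open W"
      and U: "U = {\<nu> \<in> prob_measures. (\<integral>x. f x \<partial>\<nu>) \<in> W}" by blast
    have [measurable]: "f \<in> borel_measurable borel" by (rule borel_measurable_continuous_onI[OF f])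
    have "empirical_measure n -` U = (\<lambda>x. (\<Sum>i<n. f (x i)) / n) -` W"
      using empirical_measure_in_prob_measures[OF n] by (auto simp: U integral_empirical_measure)
    moreover have "continuous_on UNIV (\<lambda>x :: nat \<Rightarrow> 'a. (\<Sum>i<n. f (x i)) / n)"
      using n by (intro continuous_intros continuous_on_compose2[OF f] continuous_on_product_coordinates) auto
    ultimately show "openin euclidean (empirical_measure n -` U \<inter> topspace euclidean)"
      using W by (simp add: open_vimage)
  next
    show "empirical_measure n ` topspace (euclidean :: (nat \<Rightarrow> 'a) topology) \<subseteq> \<Union> {{\<nu> \<in> prob_measures. (\<integral>x. f x \<partial>\<nu>) \<in> W} | (f :: 'a \<Rightarrow> real) W.
      continuous_on UNIV f \<and> bounded (range f) \<and> open W}"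
    proof (intro image_subsetI UnionI)
      show "prob_measures \<in> {{\<nu> \<in> prob_measures. (\<integral>x. f x \<partial>\<nu>) \<in> W} | (f :: 'a \<Rightarrow> real) W.
        continuous_on UNIV f \<and> bounded (range f) \<and> open W}"
        by (rule CollectI, rule exI[of _ "\<lambda>_. 0"], rule exI[of _ UNIV]) auto
      show "empirical_measure n x \<in> prob_measures" for x :: "nat \<Rightarrow> 'a"
        by (rule empirical_measure_in_prob_measures[OF n])
    qed
  qed
  from openin_continuous_map_preimage[OF this V]
  have "open {x. empirical_measure n x \<in> V}" by simp
  then have V': "{x. empirical_measure n x \<in> V} \<in> sets (\<Pi>\<^sub>M i\<in>UNIV. borel)"
    unfolding sets_PiM_equal_borel by simp
  have "(\<lambda>x. x) \<in> borel_power n \<rightarrow>\<^sub>M (\<Pi>\<^sub>M i\<in>UNIV. borel :: 'a measure)"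
  proof (rule measurable_PiM_single')
    fix i :: nat
    show "(\<lambda>x. x i) \<in> borel_power n \<rightarrow>\<^sub>M (borel :: 'a measure)"
    proof (cases "i < n")
      case False
      then have "(\<lambda>x. x i) \<in> borel_power n \<rightarrow>\<^sub>M (borel :: 'a measure) \<longleftrightarrow>
          (\<lambda>x. undefined) \<in> borel_power n \<rightarrow>\<^sub>M (borel :: 'a measure)"
        using False by (subst measurable_cong[where g="\<lambda>_. undefined"]) (auto simp: space_PiM PiE_def extensional_def)
      then show ?thesis by simp
    qed simp
  qed auto
  from measurable_sets[OF this V'] show ?thesis by (simp add: vimage_def Int_def conj_commute)
qed

lemma empirical_measure_vimage_measurable_closed:
  fixes A :: "'a::polish_space measure set"
  assumes n: "n \<ge> 1" and A: "closedin weak_topology A"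
  shows "{x \<in> space (borel_power n). empirical_measure n x \<in> A} \<in> sets (borel_power n)"
proof -
  have "openin weak_topology (prob_measures - A)" using A by (auto simp: closedin_def)
  from sets.compl_sets[OF empirical_measure_vimage_measurable[OF n this]]
  have "space (borel_power n) - {x \<in> space (borel_power n). empirical_measure n x \<in> prob_measures - A} \<in> sets (borel_power n)" .
  also have "space (borel_power n) - {x \<in> space (borel_power n). empirical_measure n x \<in> prob_measures - A}
      = {x \<in> space (borel_power n). empirical_measure n x \<in> A}"
    using empirical_measure_in_prob_measures[OF n] by auto
  finally show ?thesis .
qed

lemma empirical_functional_measurable:
  fixes F :: "'a::polish_space measure \<Rightarrow> real"
  assumes n: "n \<ge> 1" and F: "continuous_map weak_topology euclideanreal F"
  shows "(\<lambda>x. F (empirical_measure n x)) \<in> borel_measurable (borel_power n)"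
proof (rule borel_measurableI)
  fix U :: "real set" assume "open U"
  then have "openin weak_topology {\<nu> \<in> prob_measures. F \<nu> \<in> U}"
    using openin_continuous_map_preimage[OF F] by simp
  from empirical_measure_vimage_measurable[OF n this]
  moreover have "(\<lambda>x. F (empirical_measure n x)) -` U \<inter> space (borel_power n)
      = {x \<in> space (borel_power n). empirical_measure n x \<in> {\<nu> \<in> prob_measures. F \<nu> \<in> U}}"
    using empirical_measure_in_prob_measures[OF n] by auto
  ultimately show "(\<lambda>x. F (empirical_measure n x)) -` U \<inter> space (borel_power n) \<in> sets (borel_power n)" by simp
qed

section \<open>Integration against joint laws\<close>

definition kernels :: "(nat \<Rightarrow> (nat \<Rightarrow> 'a) \<Rightarrow> 'a::topological_space measure) \<Rightarrow> nat \<Rightarrow> bool" where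
  "kernels \<kappa> n \<longleftrightarrow> (\<forall>k<n. \<kappa> k \<in> borel_power k \<rightarrow>\<^sub>M prob_algebra borel)"

abbreviation joint_step :: "(nat \<Rightarrow> (nat \<Rightarrow> 'a) \<Rightarrow> 'a::topological_space measure) \<Rightarrow> nat \<Rightarrow> (nat \<Rightarrow> 'a) \<Rightarrow> (nat \<Rightarrow> 'a) measure" where
  "joint_step \<kappa> n x \<equiv> distr (\<kappa> n x) (borel_power (Suc n)) (\<lambda>y. x(n := y))"

lemma kernels_Suc: "kernels \<kappa> (Suc n) \<longleftrightarrow> kernels \<kappa> n \<and> \<kappa> n \<in> borel_power n \<rightarrow>\<^sub>M prob_algebra borel"
  by (auto simp: kernels_def less_Suc_eq)

lemma measurable_append [measurable]:
  "(\<lambda>(x, y). x(n := y)) \<in> borel_power n \<Otimes>\<^sub>M borel \<rightarrow>\<^sub>M borel_power (Suc n)"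
  using measurable_add_dim[of n "{..<n}" "\<lambda>_. borel"] by (simp add: lessThan_Suc)

lemma measurable_append_point:
  "x \<in> space (borel_power n) \<Longrightarrow> (\<lambda>y. x(n := y)) \<in> borel \<rightarrow>\<^sub>M borel_power (Suc n)"
  using measurable_component_update[of x "{..<n}" "\<lambda>_. borel" n] by (simp add: lessThan_Suc)

lemma joint_step_measurable:
  assumes [measurable]: "\<kappa> n \<in> borel_power n \<rightarrow>\<^sub>M prob_algebra borel"
  shows "joint_step \<kappa> n \<in> borel_power n \<rightarrow>\<^sub>M prob_algebra (borel_power (Suc n))"
  by (rule measurable_distr_prob_space2[OF assms measurable_append])

lemma joint_law_prob:
  assumes "kernels \<kappa> n"
  shows "joint_law \<kappa> n \<in> space (prob_algebra (borel_power n))"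
  using assms
proof (induction n)
  case 0
  have "(\<lambda>_. undefined) \<in> space (borel_power 0)" by (simp add: space_PiM)
  from measurable_space[OF measurable_return_prob_space this] show ?case by simp
next
  case (Suc n)
  then have k: "joint_law \<kappa> n \<in> space (prob_algebra (borel_power n))"
    "joint_step \<kappa> n \<in> borel_power n \<rightarrow>\<^sub>M prob_algebra (borel_power (Suc n))"
    by (auto simp: kernels_Suc intro: joint_step_measurable)
  show ?case
    using prob_space_bind'[OF k] sets_bind'[OF k] by (simp add: space_prob_algebra)
qed

lemma joint_law_space:
  assumes "kernels \<kappa> n"
  shows "prob_space (joint_law \<kappa> n)" "sets (joint_law \<kappa> n) = sets (borel_power n)"
    "space (joint_law \<kappa> n) = space (borel_power n)"
  using joint_law_prob[OF assms] sets_eq_imp_space_eq[of "joint_law \<kappa> n" "borel_power n"]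
  by (auto simp: space_prob_algebra)

lemma kernel_prob:
  assumes "\<kappa> n \<in> borel_power n \<rightarrow>\<^sub>M prob_algebra borel" "x \<in> space (borel_power n)"
  shows "\<kappa> n x \<in> prob_measures"
  by (rule measurable_space[OF assms])

lemma joint_step_integral:
  fixes g :: "(nat \<Rightarrow> 'a::topological_space) \<Rightarrow> real"
  assumes \<kappa>: "\<kappa> n \<in> borel_power n \<rightarrow>\<^sub>M prob_algebra borel" and x: "x \<in> space (borel_power n)"
    and g: "g \<in> borel_measurable (borel_power (Suc n))"
  shows "(\<integral>z. g z \<partial>joint_step \<kappa> n x) = (\<integral>y. g (x(n := y)) \<partial>\<kappa> n x)"
proof (rule integral_distr[OF _ g])
  have "sets (\<kappa> n x) = sets borel" using kernel_prob[of \<kappa> n, OF \<kappa> x] by (simp add: space_prob_algebra)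
  then show "(\<lambda>y. x(n := y)) \<in> \<kappa> n x \<rightarrow>\<^sub>M borel_power (Suc n)"
    using measurable_append_point[OF x] by (simp cong: measurable_cong_sets)
qed

lemma nn_integral_joint_law_Suc:
  assumes \<kappa>: "kernels \<kappa> (Suc n)" and g: "g \<in> borel_measurable (borel_power (Suc n))"
  shows "(\<integral>\<^sup>+z. g z \<partial>joint_law \<kappa> (Suc n)) = (\<integral>\<^sup>+x. \<integral>\<^sup>+y. g (x(n := y)) \<partial>\<kappa> n x \<partial>joint_law \<kappa> n)"
proof -
  have \<kappa>n: "\<kappa> n \<in> borel_power n \<rightarrow>\<^sub>M prob_algebra borel" and kn: "kernels \<kappa> n" using \<kappa> by (auto simp: kernels_Suc)
  have step: "joint_step \<kappa> n \<in> joint_law \<kappa> n \<rightarrow>\<^sub>M subprob_algebra (borel_power (Suc n))"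
    using measurable_prob_algebraD[OF joint_step_measurable[of \<kappa> n, OF \<kappa>n]] joint_law_space(2)[OF kn]
    by (simp cong: measurable_cong_sets)
  have "(\<integral>\<^sup>+z. g z \<partial>joint_law \<kappa> (Suc n)) = (\<integral>\<^sup>+x. \<integral>\<^sup>+z. g z \<partial>joint_step \<kappa> n x \<partial>joint_law \<kappa> n)"
    using nn_integral_bind[OF g step] by simp
  also have "\<dots> = (\<integral>\<^sup>+x. \<integral>\<^sup>+y. g (x(n := y)) \<partial>\<kappa> n x \<partial>joint_law \<kappa> n)"
  proof (rule nn_integral_cong)
    fix x assume "x \<in> space (joint_law \<kappa> n)"
    then have x: "x \<in> space (borel_power n)" using joint_law_space(3)[OF kn] by simp
    have "sets (\<kappa> n x) = sets borel" using kernel_prob[of \<kappa> n, OF \<kappa>n x] by (simp add: space_prob_algebra)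
    then have "(\<lambda>y. x(n := y)) \<in> \<kappa> n x \<rightarrow>\<^sub>M borel_power (Suc n)"
      using measurable_append_point[OF x] by (simp cong: measurable_cong_sets)
    then show "(\<integral>\<^sup>+z. g z \<partial>joint_step \<kappa> n x) = (\<integral>\<^sup>+y. g (x(n := y)) \<partial>\<kappa> n x)"
      using g by (simp add: nn_integral_distr)
  qed
  finally show ?thesis .
qed

lemma integral_joint_law_Suc:
  fixes g :: "(nat \<Rightarrow> 'a::topological_space) \<Rightarrow> real"
  assumes \<kappa>: "kernels \<kappa> (Suc n)" and g: "g \<in> borel_measurable (borel_power (Suc n))"
    and R: "\<And>z. z \<in> space (borel_power (Suc n)) \<Longrightarrow> \<bar>g z\<bar> \<le> R"
  shows "(\<integral>z. g z \<partial>joint_law \<kappa> (Suc n)) = (\<integral>x. \<integral>y. g (x(n := y)) \<partial>\<kappa> n x \<partial>joint_law \<kappa> n)"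
    and "(\<lambda>x. \<integral>y. g (x(n := y)) \<partial>\<kappa> n x) \<in> borel_measurable (borel_power n)"
proof -
  have \<kappa>n: "\<kappa> n \<in> borel_power n \<rightarrow>\<^sub>M prob_algebra borel" and kn: "kernels \<kappa> n" using \<kappa> by (auto simp: kernels_Suc)
  have step: "joint_step \<kappa> n \<in> borel_power n \<rightarrow>\<^sub>M subprob_algebra (borel_power (Suc n))"
    by (rule measurable_prob_algebraD[OF joint_step_measurable[of \<kappa> n, OF \<kappa>n]])
  then have step': "joint_step \<kappa> n \<in> joint_law \<kappa> n \<rightarrow>\<^sub>M subprob_algebra (borel_power (Suc n))"
    using joint_law_space(2)[OF kn] by (simp cong: measurable_cong_sets)
  interpret prob_space "joint_law \<kappa> n" by (rule joint_law_space(1)[OF kn])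
  have sp: "x \<in> space (borel_power n)" if "x \<in> space (joint_law \<kappa> n)" for x
    using that joint_law_space(3)[OF kn] by simp
  have one: "emeasure (joint_step \<kappa> n x) (space (joint_step \<kappa> n x)) \<le> ennreal 1" if "x \<in> space (joint_law \<kappa> n)" for x
    using measurable_space[OF step' that] unfolding ennreal_1
    by (intro subprob_space.emeasure_space_le_1) (simp add: space_subprob_algebra)
  have "(\<integral>z. g z \<partial>joint_law \<kappa> (Suc n)) = (\<integral>x. \<integral>z. g z \<partial>joint_step \<kappa> n x \<partial>joint_law \<kappa> n)"
    unfolding joint_law.simps
    by (rule integral_bind[where K="borel_power (Suc n)" and B=R and B'=1, OF g _ step'])
      (use R one finite_measure_axioms in auto)
  also have "\<dots> = (\<integral>x. \<integral>y. g (x(n := y)) \<partial>\<kappa> n x \<partial>joint_law \<kappa> n)"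
    by (intro Bochner_Integration.integral_cong joint_step_integral[of \<kappa> n, OF \<kappa>n sp g] refl)
  finally show "(\<integral>z. g z \<partial>joint_law \<kappa> (Suc n)) = (\<integral>x. \<integral>y. g (x(n := y)) \<partial>\<kappa> n x \<partial>joint_law \<kappa> n)" .
  have "(\<lambda>x. \<integral>z. g z \<partial>joint_step \<kappa> n x) \<in> borel_measurable (borel_power n)"
    using g by (intro measurable_compose[OF step] integral_measurable_subprob_algebra)
  then show "(\<lambda>x. \<integral>y. g (x(n := y)) \<partial>\<kappa> n x) \<in> borel_measurable (borel_power n)"
    using joint_step_integral[of \<kappa> n, OF \<kappa>n _ g] by (simp cong: measurable_cong)
qed

section \<open>The large deviation upper bound\<close>

text \<open>The last coordinate is integrated first: its conditional law is in \<open>M\<close>, whatever the past, so this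
  contributes a factor of at most \<open>exp (sup_log_mgf M f)\<close>.\<close>

lemma exponential_moment_bound:
  fixes M :: "'a::polish_space measure set"
  assumes M: "M \<subseteq> prob_measures" and f: "f \<in> bounded_continuous" and "kernels \<kappa> n"
    and "\<And>k x. k < n \<Longrightarrow> x \<in> space (borel_power k) \<Longrightarrow> \<kappa> k x \<in> M"
  shows "(\<integral>\<^sup>+x. ennreal (exp (\<Sum>i<n. f (x i))) \<partial>joint_law \<kappa> n) \<le> ennreal (exp (real n * sup_log_mgf M f))"
  using assms(3,4)
proof (induction n)
  case 0
  then interpret prob_space "joint_law \<kappa> 0" by (intro joint_law_space(1)) (simp add: kernels_def)
  show ?case using emeasure_space_1 by simp
next
  case (Suc n)
  have kn: "kernels \<kappa> n" using Suc.prems(1) by (simp add: kernels_Suc)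
  have fb: "f \<in> bounded_borel" using f bounded_continuous_subset_borel by auto
  then have [measurable]: "f \<in> borel_measurable borel" by (simp add: bounded_borel_def)
  let ?\<rho> = "sup_log_mgf M f"
  have "(\<integral>\<^sup>+z. ennreal (exp (\<Sum>i<Suc n. f (z i))) \<partial>joint_law \<kappa> (Suc n))
      = (\<integral>\<^sup>+x. \<integral>\<^sup>+y. ennreal (exp (\<Sum>i<Suc n. f ((x(n := y)) i))) \<partial>\<kappa> n x \<partial>joint_law \<kappa> n)"
    by (rule nn_integral_joint_law_Suc[OF Suc.prems(1)]) measurable
  also have "\<dots> \<le> (\<integral>\<^sup>+x. ennreal (exp (\<Sum>i<n. f (x i))) * ennreal (exp ?\<rho>) \<partial>joint_law \<kappa> n)"
  proof (rule nn_integral_mono)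
    fix x assume "x \<in> space (joint_law \<kappa> n)"
    then have "\<kappa> n x \<in> M" using joint_law_space(3)[OF kn] Suc.prems(2)[of n x] by simp
    then have \<kappa>P: "\<kappa> n x \<in> prob_measures" using M by auto
    have [measurable_cong]: "sets (\<kappa> n x) = sets borel" using prob_measuresD[OF \<kappa>P] by simp
    have "(\<integral>\<^sup>+y. ennreal (exp (\<Sum>i<Suc n. f ((x(n := y)) i))) \<partial>\<kappa> n x)
        = (\<integral>\<^sup>+y. ennreal (exp (\<Sum>i<n. f (x i))) * ennreal (exp (f y)) \<partial>\<kappa> n x)"
      by (simp add: exp_add ennreal_mult)
    also have "\<dots> = ennreal (exp (\<Sum>i<n. f (x i))) * (\<integral>\<^sup>+y. ennreal (exp (f y)) \<partial>\<kappa> n x)"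
      by (rule nn_integral_cmult) measurable
    also have "(\<integral>\<^sup>+y. ennreal (exp (f y)) \<partial>\<kappa> n x) = ennreal (\<integral>y. exp (f y) \<partial>\<kappa> n x)"
      by (intro nn_integral_eq_integral integrable_bounded_borel[OF \<kappa>P] bounded_borel_exp fb) auto
    also have "(\<integral>y. exp (f y) \<partial>\<kappa> n x) = exp (log_mgf (\<kappa> n x) f)"
      unfolding log_mgf_def using integral_exp_pos[OF \<kappa>P fb] by simp
    also have "ennreal (exp (log_mgf (\<kappa> n x) f)) \<le> ennreal (exp ?\<rho>)"
      using log_mgf_le_sup[OF M \<open>\<kappa> n x \<in> M\<close> fb] by (intro ennreal_leI) simp
    finally show "(\<integral>\<^sup>+y. ennreal (exp (\<Sum>i<Suc n. f ((x(n := y)) i))) \<partial>\<kappa> n x)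
        \<le> ennreal (exp (\<Sum>i<n. f (x i))) * ennreal (exp ?\<rho>)" by (simp add: mult_left_mono)
  qed
  also have "\<dots> = (\<integral>\<^sup>+x. ennreal (exp (\<Sum>i<n. f (x i))) \<partial>joint_law \<kappa> n) * ennreal (exp ?\<rho>)"
  proof (rule nn_integral_multc)
    have "(\<lambda>x. ennreal (exp (\<Sum>i<n. f (x i)))) \<in> borel_measurable (borel_power n)" by measurable
    then show "(\<lambda>x. ennreal (exp (\<Sum>i<n. f (x i)))) \<in> borel_measurable (joint_law \<kappa> n)"
      using joint_law_space(2)[OF kn] by (simp cong: measurable_cong_sets)
  qed
  also have "\<dots> \<le> ennreal (exp (real n * ?\<rho>)) * ennreal (exp ?\<rho>)"
    using Suc.prems(2) by (intro mult_right_mono Suc.IH kn) auto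
  also have "\<dots> = ennreal (exp (real (Suc n) * ?\<rho>))"
    by (simp add: ennreal_mult[symmetric] exp_add[symmetric] algebra_simps)
  finally show ?case .
qed

text \<open>Chebyshev's exponential inequality for each half-space of a finite cover. The constant \<open>m\<close> depends
  only on the number of half-spaces; it exceeds that number by one so as to be positive for an
  empty cover.\<close>

lemma empirical_deviation_bound:
  fixes M A :: "'a::polish_space measure set"
  assumes M: "M \<subseteq> prob_measures" "M \<noteq> {}" "convex_measures M" "compactin weak_topology M"
    and A: "closedin weak_topology A"
    and c: "\<And>\<nu> \<mu>. \<nu> \<in> A \<Longrightarrow> \<mu> \<in> M \<Longrightarrow> ereal c < relative_entropy \<nu> \<mu>"
  shows "\<exists>m>0. \<forall>n\<ge>1. \<forall>\<mu>\<in>laws_with_conditionals_in M n.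
    measure \<mu> {x \<in> space \<mu>. empirical_measure n x \<in> A} \<le> m * exp (- real n * c)"
proof -
  obtain S where S: "finite S" "S \<subseteq> bounded_continuous"
    and cover: "\<And>\<nu>. \<nu> \<in> A \<Longrightarrow> \<exists>f\<in>S. c + sup_log_mgf M f < (\<integral>x. f x \<partial>\<nu>)"
    using half_space_cover[OF M A c] by blast
  define m where "m = real (card S) + 1"
  show ?thesis
  proof (intro exI[of _ m] conjI allI impI ballI)
    show "m > 0" by (simp add: m_def)
    fix n :: nat and \<mu> assume n: "n \<ge> 1" and \<mu>M: "\<mu> \<in> laws_with_conditionals_in M n"
    then obtain \<kappa> where "\<forall>k<n. \<kappa> k \<in> borel_power k \<rightarrow>\<^sub>M prob_algebra borel"
      and \<kappa>M: "\<forall>k<n. \<forall>x\<in>space (borel_power k). \<kappa> k x \<in> M" and \<mu>: "\<mu> = joint_law \<kappa> n"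
      unfolding laws_with_conditionals_in_def by blast
    then have \<kappa>: "kernels \<kappa> n" by (simp add: kernels_def)
    interpret prob_space \<mu> unfolding \<mu> by (rule joint_law_space(1)[OF \<kappa>])
    have sets_\<mu> [measurable_cong]: "sets \<mu> = sets (borel_power n)" unfolding \<mu> by (rule joint_law_space(2)[OF \<kappa>])
    have sp: "space \<mu> = space (borel_power n)" unfolding \<mu> by (rule joint_law_space(3)[OF \<kappa>])
    let ?E = "{x \<in> space \<mu>. empirical_measure n x \<in> A}"
    let ?w = "\<lambda>f. exp (- real n * (c + sup_log_mgf M f))"
    have E: "?E \<in> sets \<mu>"
      unfolding sp sets_\<mu> by (rule empirical_measure_vimage_measurable_closed[OF n A])
    have [measurable]: "f \<in> borel_measurable borel" if "f \<in> S" for f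
      using that S bounded_continuous_subset_borel by (auto simp: bounded_borel_def)
    have "emeasure \<mu> ?E = (\<integral>\<^sup>+x. indicator ?E x \<partial>\<mu>)" using E by simp
    also have "\<dots> \<le> (\<integral>\<^sup>+x. (\<Sum>f\<in>S. ennreal (?w f) * ennreal (exp (\<Sum>i<n. f (x i)))) \<partial>\<mu>)"
    proof (rule nn_integral_mono)
      fix x assume "x \<in> space \<mu>"
      show "indicator ?E x \<le> (\<Sum>f\<in>S. ennreal (?w f) * ennreal (exp (\<Sum>i<n. f (x i))))"
      proof (cases "x \<in> ?E")
        case True
        then obtain f where f: "f \<in> S" "c + sup_log_mgf M f < (\<integral>y. f y \<partial>empirical_measure n x)"
          using cover by blast
        then have "real n * (c + sup_log_mgf M f) \<le> (\<Sum>i<n. f (x i))"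
          using n by (simp add: integral_empirical_measure field_simps)
        then have "1 \<le> ?w f * exp (\<Sum>i<n. f (x i))"
          unfolding exp_add[symmetric] by simp
        then have "1 \<le> ennreal (?w f) * ennreal (exp (\<Sum>i<n. f (x i)))"
          by (simp add: ennreal_mult[symmetric])
        also have "\<dots> \<le> (\<Sum>f\<in>S. ennreal (?w f) * ennreal (exp (\<Sum>i<n. f (x i))))"
          using f(1) S(1) by (intro member_le_sum) auto
        finally show ?thesis using True by simp
      next
        case False
        then have "indicator ?E x = (0 :: ennreal)" by (rule indicator_simps(2))
        then show ?thesis by (rule ord_eq_le_trans) (rule zero_le)
      qed
    qed
    also have "\<dots> = (\<Sum>f\<in>S. \<integral>\<^sup>+x. ennreal (?w f) * ennreal (exp (\<Sum>i<n. f (x i))) \<partial>\<mu>)"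
      by (rule nn_integral_sum) measurable
    also have "\<dots> \<le> (\<Sum>f\<in>S. ennreal (exp (- real n * c)))"
    proof (rule sum_mono)
      fix f assume f: "f \<in> S"
      have "(\<integral>\<^sup>+x. ennreal (?w f) * ennreal (exp (\<Sum>i<n. f (x i))) \<partial>\<mu>)
          = ennreal (?w f) * (\<integral>\<^sup>+x. ennreal (exp (\<Sum>i<n. f (x i))) \<partial>\<mu>)"
        using f by (intro nn_integral_cmult) measurable
      also have "\<dots> \<le> ennreal (?w f) * ennreal (exp (real n * sup_log_mgf M f))"
        unfolding \<mu> using f S \<kappa>M by (intro mult_left_mono exponential_moment_bound[OF M(1) _ \<kappa>]) auto
      also have "\<dots> = ennreal (exp (- real n * c))"
        by (simp add: ennreal_mult[symmetric] exp_add[symmetric] algebra_simps)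
      finally show "(\<integral>\<^sup>+x. ennreal (?w f) * ennreal (exp (\<Sum>i<n. f (x i))) \<partial>\<mu>) \<le> ennreal (exp (- real n * c))" .
    qed
    also have "\<dots> = ennreal (real (card S) * exp (- real n * c))"
      by (simp add: ennreal_mult ennreal_of_nat_eq_real_of_nat)
    also have "\<dots> \<le> ennreal (m * exp (- real n * c))"
      by (intro ennreal_leI mult_right_mono) (auto simp: m_def)
    finally show "measure \<mu> ?E \<le> m * exp (- real n * c)"
      by (simp add: emeasure_eq_measure m_def)
  qed
qed

section \<open>Product laws and the law of large numbers\<close>

abbreviation iid_law :: "'a::topological_space measure \<Rightarrow> nat \<Rightarrow> (nat \<Rightarrow> 'a) measure" where
  "iid_law \<nu> \<equiv> joint_law (\<lambda>_ _. \<nu>)"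

lemma kernels_const: "\<nu> \<in> prob_measures \<Longrightarrow> kernels (\<lambda>_ _. \<nu>) n"
  by (simp add: kernels_def)

lemma iid_law_in_laws:
  assumes "\<mu> \<in> M" "M \<subseteq> prob_measures"
  shows "iid_law \<mu> n \<in> laws_with_conditionals_in M n"
proof -
  have k: "kernels (\<lambda>_ _. \<mu>) n" using assms by (intro kernels_const) auto
  show ?thesis
    unfolding laws_with_conditionals_in_def
    using joint_law_prob[OF k] k assms(1) by (auto simp: kernels_def intro!: exI[of _ "\<lambda>_ _. \<mu>"])
qed

lemma append_in_space:
  "x \<in> space (borel_power n) \<Longrightarrow> x(n := y) \<in> space (borel_power (Suc n))"
  by (auto simp: space_PiM PiE_def extensional_def)

lemma integrable_joint_law:
  fixes g :: "(nat \<Rightarrow> 'a::topological_space) \<Rightarrow> real"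
  assumes \<kappa>: "kernels \<kappa> n" and g: "g \<in> borel_measurable (borel_power n)"
    and R: "\<And>z. z \<in> space (borel_power n) \<Longrightarrow> \<bar>g z\<bar> \<le> R"
  shows "integrable (joint_law \<kappa> n) g"
proof -
  interpret prob_space "joint_law \<kappa> n" by (rule joint_law_space(1)[OF \<kappa>])
  show ?thesis
    using R g joint_law_space[OF \<kappa>]
    by (intro integrable_const_bound[where B=R]) (auto cong: measurable_cong_sets)
qed

lemma section_bounded_borel:
  fixes g :: "(nat \<Rightarrow> 'a::topological_space) \<Rightarrow> real"
  assumes "g \<in> borel_measurable (borel_power (Suc n))"
    and "\<And>z. z \<in> space (borel_power (Suc n)) \<Longrightarrow> \<bar>g z\<bar> \<le> R" and "x \<in> space (borel_power n)"
  shows "(\<lambda>y. g (x(n := y))) \<in> bounded_borel"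
  using measurable_compose[OF measurable_append_point[OF assms(3)] assms(1)] append_in_space[OF assms(3)] assms(2)
  unfolding bounded_borel_def bounded_range_iff by blast

text \<open>The relative entropy of product laws is additive, which shows up here as an induction over the
  coordinates: the one-dimensional inequality replaces the innermost integral by \<open>h\<close>, at the cost of one \<open>r\<close>.\<close>

lemma gibbs_inequality_iid:
  fixes \<mu> \<nu> :: "'a::polish_space measure" and g :: "(nat \<Rightarrow> 'a) \<Rightarrow> real"
  assumes \<mu>: "\<mu> \<in> prob_measures" and \<nu>: "\<nu> \<in> prob_measures" and r: "relative_entropy \<nu> \<mu> = ereal r"
    and "g \<in> borel_measurable (borel_power n)"
    and "\<And>z. z \<in> space (borel_power n) \<Longrightarrow> \<bar>g z\<bar> \<le> R"
  shows "(\<integral>x. g x \<partial>iid_law \<nu> n) - real n * r \<le> ln (\<integral>x. exp (g x) \<partial>iid_law \<mu> n)"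
  using assms(4,5)
proof (induction n arbitrary: g)
  case 0
  have u: "(\<lambda>_. undefined) \<in> space (borel_power 0 :: (nat \<Rightarrow> 'a) measure)" by (simp add: space_PiM)
  have "(\<lambda>x. exp (g x)) \<in> borel_measurable (borel_power 0)" using 0 by measurable
  then show ?case using 0 u by (simp add: integral_return)
next
  case (Suc n)
  note k\<mu> = kernels_const[OF \<mu>] and k\<nu> = kernels_const[OF \<nu>]
  note g = Suc.prems
  have eg: "(\<lambda>z. exp (g z)) \<in> borel_measurable (borel_power (Suc n))" using g(1) by measurable
  have egR: "\<bar>exp (g z)\<bar> \<le> exp R" if "z \<in> space (borel_power (Suc n))" for z
    using g(2)[OF that] by simp
  have secb: "(\<lambda>y. g (x(n := y))) \<in> bounded_borel" if "x \<in> space (borel_power n)" for x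
    by (rule section_bounded_borel[OF g that])
  have secR: "\<bar>g (x(n := y))\<bar> \<le> R" if "x \<in> space (borel_power n)" for x y
    by (rule g(2)[OF append_in_space[OF that]])
  define h where "h x = log_mgf \<mu> (\<lambda>y. g (x(n := y)))" for x
  have h_meas: "h \<in> borel_measurable (borel_power n)"
    unfolding h_def[abs_def] log_mgf_def
    using integral_joint_law_Suc(2)[OF k\<mu> eg egR] by measurable
  have hR: "\<bar>h x\<bar> \<le> R" if "x \<in> space (borel_power n)" for x
    using log_mgf_bounds[OF \<mu> secb[OF that] secR[OF that]] by (simp add: h_def abs_le_iff minus_le_iff)
  let ?k = "\<lambda>x. \<integral>y. g (x(n := y)) \<partial>\<nu>"
  have k_meas: "?k \<in> borel_measurable (borel_power n)"
    by (rule integral_joint_law_Suc(2)[OF k\<nu> g])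
  have kR: "\<bar>?k x\<bar> \<le> R" if "x \<in> space (borel_power n)" for x
    by (rule abs_integral_le_bound[OF \<nu> secb[OF that] secR[OF that]])
  interpret \<nu>n: prob_space "iid_law \<nu> n" by (rule joint_law_space(1)[OF k\<nu>])
  have "(\<integral>x. g x \<partial>iid_law \<nu> (Suc n)) - r = (\<integral>x. ?k x \<partial>iid_law \<nu> n) - r"
    by (simp only: integral_joint_law_Suc(1)[OF k\<nu> g])
  also have "\<dots> = (\<integral>x. ?k x - r \<partial>iid_law \<nu> n)"
    using integrable_joint_law[OF k\<nu> k_meas kR] by (simp add: \<nu>n.prob_space)
  also have "\<dots> \<le> (\<integral>x. h x \<partial>iid_law \<nu> n)"
  proof (rule integral_mono)
    show "integrable (iid_law \<nu> n) (\<lambda>x. ?k x - r)"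
      using integrable_joint_law[OF k\<nu> k_meas kR] by simp
    show "integrable (iid_law \<nu> n) h" by (rule integrable_joint_law[OF k\<nu> h_meas hR])
    fix x assume "x \<in> space (iid_law \<nu> n)"
    then have "x \<in> space (borel_power n)" using joint_law_space(3)[OF k\<nu>] by simp
    then show "?k x - r \<le> h x" unfolding h_def by (intro gibbs_variational_inequality[OF \<mu> \<nu> r] secb)
  qed
  finally have "(\<integral>x. g x \<partial>iid_law \<nu> (Suc n)) - real (Suc n) * r \<le> (\<integral>x. h x \<partial>iid_law \<nu> n) - real n * r"
    by (simp add: algebra_simps)
  also have "\<dots> \<le> ln (\<integral>x. exp (h x) \<partial>iid_law \<mu> n)" by (rule Suc.IH[OF h_meas hR])
  also have "(\<integral>x. exp (h x) \<partial>iid_law \<mu> n) = (\<integral>x. \<integral>y. exp (g (x(n := y))) \<partial>\<mu> \<partial>iid_law \<mu> n)"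
  proof (rule Bochner_Integration.integral_cong[OF refl])
    fix x assume "x \<in> space (iid_law \<mu> n)"
    then have "x \<in> space (borel_power n)" using joint_law_space(3)[OF k\<mu>] by simp
    from integral_exp_pos[OF \<mu> secb[OF this]]
    show "exp (h x) = (\<integral>y. exp (g (x(n := y))) \<partial>\<mu>)" by (simp add: h_def log_mgf_def)
  qed
  also have "\<dots> = (\<integral>x. exp (g x) \<partial>iid_law \<mu> (Suc n))"
    by (rule integral_joint_law_Suc(1)[OF k\<mu> eg egR, symmetric])
  finally show ?case .
qed

text \<open>Independence enters through the vanishing inner integral of the cross term in each step.\<close>

lemma iid_second_moment:
  fixes \<nu> :: "'a::polish_space measure"
  assumes \<nu>: "\<nu> \<in> prob_measures" and d: "d \<in> bounded_borel" and mean: "(\<integral>y. d y \<partial>\<nu>) = 0"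
  shows "(\<integral>x. (\<Sum>i<n. d (x i))\<^sup>2 \<partial>iid_law \<nu> n) = real n * (\<integral>y. (d y)\<^sup>2 \<partial>\<nu>)"
proof (induction n)
  case 0
  then show ?case by simp
next
  case (Suc n)
  note k = kernels_const[OF \<nu>]
  interpret \<nu>: prob_space \<nu> using prob_measuresD[OF \<nu>] by simp
  interpret \<nu>n: prob_space "iid_law \<nu> n" by (rule joint_law_space(1)[OF k])
  have [measurable]: "d \<in> borel_measurable borel" using d by (simp add: bounded_borel_def)
  obtain R where R: "R > 0" "\<And>x. \<bar>d x\<bar> \<le> R" using bounded_borel_bound[OF d] by blast
  have S: "\<bar>\<Sum>i<m. d (z i)\<bar> \<le> real m * R" for m and z :: "nat \<Rightarrow> 'a"
  proof -
    have "\<bar>\<Sum>i<m. d (z i)\<bar> \<le> (\<Sum>i<m. \<bar>d (z i)\<bar>)" by (rule sum_abs)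
    also have "\<dots> \<le> (\<Sum>i<m. R)" by (intro sum_mono R)
    finally show ?thesis by simp
  qed
  have S2: "\<bar>(\<Sum>i<m. d (z i))\<^sup>2\<bar> \<le> (real m * R)\<^sup>2" for m and z :: "nat \<Rightarrow> 'a"
    using S[of z m] R by (simp add: abs_le_square_iff[symmetric] abs_mult)
  have d2: "(\<lambda>y. (d y)\<^sup>2) \<in> bounded_borel"
  proof -
    have "\<bar>(d y)\<^sup>2\<bar> \<le> R\<^sup>2" for y using R by (simp add: abs_le_square_iff[symmetric])
    then show ?thesis unfolding bounded_borel_def bounded_range_iff by auto
  qed
  have m: "(\<lambda>z. (\<Sum>i<m. d (z i))\<^sup>2) \<in> borel_measurable (borel_power m)" for m by measurable
  have "(\<integral>x. (\<Sum>i<Suc n. d (x i))\<^sup>2 \<partial>iid_law \<nu> (Suc n))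
      = (\<integral>x. \<integral>y. (\<Sum>i<Suc n. d ((x(n := y)) i))\<^sup>2 \<partial>\<nu> \<partial>iid_law \<nu> n)"
    by (rule integral_joint_law_Suc(1)[OF k m S2])
  also have "\<dots> = (\<integral>x. (\<Sum>i<n. d (x i))\<^sup>2 + (\<integral>y. (d y)\<^sup>2 \<partial>\<nu>) \<partial>iid_law \<nu> n)"
  proof (rule Bochner_Integration.integral_cong[OF refl])
    fix x
    let ?s = "\<Sum>i<n. d (x i)"
    have "(\<integral>y. (\<Sum>i<Suc n. d ((x(n := y)) i))\<^sup>2 \<partial>\<nu>) = (\<integral>y. ?s\<^sup>2 + 2 * ?s * d y + (d y)\<^sup>2 \<partial>\<nu>)"
      by (simp add: power2_sum ac_simps)
    also have "\<dots> = ?s\<^sup>2 + (\<integral>y. (d y)\<^sup>2 \<partial>\<nu>)"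
      using integrable_bounded_borel[OF \<nu> d] integrable_bounded_borel[OF \<nu> d2] mean
      by (simp add: \<nu>.prob_space)
    finally show "(\<integral>y. (\<Sum>i<Suc n. d ((x(n := y)) i))\<^sup>2 \<partial>\<nu>) = ?s\<^sup>2 + (\<integral>y. (d y)\<^sup>2 \<partial>\<nu>)" .
  qed
  also have "\<dots> = real (Suc n) * (\<integral>y. (d y)\<^sup>2 \<partial>\<nu>)"
    using integrable_joint_law[OF k m S2] Suc.IH by (simp add: \<nu>n.prob_space algebra_simps)
  finally show ?case .
qed

text \<open>Choose a basic neighbourhood of \<open>\<nu>\<close> on which \<open>F\<close> varies by less than \<open>r / 2\<close>. Outside it some test
  integral is off by at least \<open>e\<close>, so the sum over \<open>S\<close> of the squared relative errors is at least \<open>1\<close>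
  and, multiplied by \<open>2 * B\<close>, serves as a pointwise majorant there; its expectation is of order \<open>1 / n\<close>.\<close>

lemma law_of_large_numbers:
  fixes \<nu> :: "'a::polish_space measure" and F :: "'a measure \<Rightarrow> real"
  assumes \<nu>: "\<nu> \<in> prob_measures" and F: "continuous_map weak_topology euclideanreal F"
    and B: "\<And>\<tau>. \<tau> \<in> prob_measures \<Longrightarrow> \<bar>F \<tau>\<bar> \<le> B"
  shows "(\<lambda>n. \<integral>x. F (empirical_measure n x) \<partial>iid_law \<nu> n) \<longlonglongrightarrow> F \<nu>"
proof (rule LIMSEQ_I)
  fix r :: real assume r: "r > 0"
  have "openin weak_topology {\<tau> \<in> topspace weak_topology. F \<tau> \<in> ball (F \<nu>) (r / 2)}"
    by (rule openin_continuous_map_preimage[OF F]) simp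
  then have V: "openin weak_topology {\<tau> \<in> prob_measures. F \<tau> \<in> ball (F \<nu>) (r / 2)}" by simp
  have "\<nu> \<in> {\<tau> \<in> prob_measures. F \<tau> \<in> ball (F \<nu>) (r / 2)}" using \<nu> r by simp
  from weak_nbhd[OF V this] obtain S e where S: "finite S" "S \<subseteq> bounded_continuous" and e: "e > 0"
    and near: "\<forall>\<tau>\<in>prob_measures. (\<forall>f\<in>S. \<bar>(\<integral>x. f x \<partial>\<tau>) - (\<integral>x. f x \<partial>\<nu>)\<bar> < e) \<longrightarrow>
      \<tau> \<in> {\<tau> \<in> prob_measures. F \<tau> \<in> ball (F \<nu>) (r / 2)}"
    by (elim exE conjE) (rule that)
  have B0: "B \<ge> 0" using B[OF \<nu>] by linarith
  define d where "d f y = f y - (\<integral>x. f x \<partial>\<nu>)" for f :: "'a \<Rightarrow> real" and y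
  define v where "v f = (\<integral>y. (d f y)\<^sup>2 \<partial>\<nu>)" for f
  interpret \<nu>: prob_space \<nu> using prob_measuresD[OF \<nu>] by simp
  have Sb: "f \<in> bounded_borel" if "f \<in> S" for f using that S bounded_continuous_subset_borel by auto
  have db: "d f \<in> bounded_borel" if "f \<in> S" for f
    unfolding d_def[abs_def] by (intro bounded_borel_diff Sb[OF that]) simp
  have d0: "(\<integral>y. d f y \<partial>\<nu>) = 0" if "f \<in> S" for f
    unfolding d_def using integrable_bounded_borel[OF \<nu> Sb[OF that]] by (simp add: \<nu>.prob_space)
  define C where "C = 2 * B * (\<Sum>f\<in>S. v f / e\<^sup>2)"
  have main: "\<bar>(\<integral>x. F (empirical_measure n x) \<partial>iid_law \<nu> n) - F \<nu>\<bar> \<le> r / 2 + C / real n" if n: "n \<ge> 1" for n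
  proof -
    note k = kernels_const[OF \<nu>, of n]
    interpret \<nu>n: prob_space "iid_law \<nu> n" by (rule joint_law_space(1)[OF k])
    note em = empirical_measure_in_prob_measures[OF n]
    have Fm: "(\<lambda>x. F (empirical_measure n x)) \<in> borel_measurable (borel_power n)"
      by (rule empirical_functional_measurable[OF n F])
    have Fi: "integrable (iid_law \<nu> n) (\<lambda>x. F (empirical_measure n x))"
      by (rule integrable_joint_law[OF k Fm, of B]) (intro B em)
    let ?q = "\<lambda>f x. (\<Sum>i<n. d f (x i))\<^sup>2"
    have qi: "integrable (iid_law \<nu> n) (?q f)" if f: "f \<in> S" for f
    proof -
      obtain R where R: "\<And>x. \<bar>d f x\<bar> \<le> R" using bounded_borel_bound[OF db[OF f]] by blast
      have [measurable]: "d f \<in> borel_measurable borel" using db[OF f] by (simp add: bounded_borel_def)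
      show ?thesis
      proof (rule integrable_joint_law[OF k])
        show "?q f \<in> borel_measurable (borel_power n)" by measurable
        fix z :: "nat \<Rightarrow> 'a"
        have "\<bar>\<Sum>i<n. d f (z i)\<bar> \<le> (\<Sum>i<n. \<bar>d f (z i)\<bar>)" by (rule sum_abs)
        also have "\<dots> \<le> (\<Sum>i<n. R)" by (intro sum_mono R)
        finally have "\<bar>\<Sum>i<n. d f (z i)\<bar> \<le> \<bar>real n * R\<bar>" by simp
        then show "\<bar>?q f z\<bar> \<le> (real n * R)\<^sup>2" by (simp only: abs_le_square_iff abs_power2)
      qed
    qed
    have "\<bar>(\<integral>x. F (empirical_measure n x) \<partial>iid_law \<nu> n) - F \<nu>\<bar>
        = \<bar>\<integral>x. F (empirical_measure n x) - F \<nu> \<partial>iid_law \<nu> n\<bar>"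
      using Fi by (simp add: \<nu>n.prob_space)
    also have "\<dots> \<le> (\<integral>x. \<bar>F (empirical_measure n x) - F \<nu>\<bar> \<partial>iid_law \<nu> n)"
      using integral_norm_bound[of "iid_law \<nu> n" "\<lambda>x. F (empirical_measure n x) - F \<nu>"] by simp
    also have "\<dots> \<le> (\<integral>x. r / 2 + 2 * B * (\<Sum>f\<in>S. ?q f x / (real n * e)\<^sup>2) \<partial>iid_law \<nu> n)"
    proof (rule integral_mono)
      show "integrable (iid_law \<nu> n) (\<lambda>x. \<bar>F (empirical_measure n x) - F \<nu>\<bar>)" using Fi by simp
      show "integrable (iid_law \<nu> n) (\<lambda>x. r / 2 + 2 * B * (\<Sum>f\<in>S. ?q f x / (real n * e)\<^sup>2))"
        using qi by simp
      fix x
      have sum0: "0 \<le> 2 * B * (\<Sum>f\<in>S. ?q f x / (real n * e)\<^sup>2)"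
        using B0 by (intro mult_nonneg_nonneg sum_nonneg) auto
      have q: "?q f x / (real n * e)\<^sup>2 = (((\<integral>y. f y \<partial>empirical_measure n x) - (\<integral>y. f y \<partial>\<nu>)) / e)\<^sup>2" if "f \<in> S" for f
      proof -
        have [measurable]: "f \<in> borel_measurable borel" using Sb[OF that] by (simp add: bounded_borel_def)
        have "(\<Sum>i<n. d f (x i)) = real n * ((\<integral>y. f y \<partial>empirical_measure n x) - (\<integral>y. f y \<partial>\<nu>))"
          using n by (simp add: d_def sum_subtractf integral_empirical_measure right_diff_distrib)
        then show ?thesis using n e by (simp add: power_divide power_mult_distrib)
      qed
      show "\<bar>F (empirical_measure n x) - F \<nu>\<bar> \<le> r / 2 + 2 * B * (\<Sum>f\<in>S. ?q f x / (real n * e)\<^sup>2)"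
      proof (cases "\<forall>f\<in>S. \<bar>(\<integral>y. f y \<partial>empirical_measure n x) - (\<integral>y. f y \<partial>\<nu>)\<bar> < e")
        case True
        then have "F (empirical_measure n x) \<in> ball (F \<nu>) (r / 2)" using near em by blast
        then have "\<bar>F (empirical_measure n x) - F \<nu>\<bar> < r / 2"
          by (simp add: dist_real_def abs_minus_commute)
        then show ?thesis using sum0 by linarith
      next
        case False
        then obtain f where f: "f \<in> S" "\<bar>(\<integral>y. f y \<partial>empirical_measure n x) - (\<integral>y. f y \<partial>\<nu>)\<bar> \<ge> e"
          by (auto simp: not_less)
        have "1 \<le> \<bar>((\<integral>y. f y \<partial>empirical_measure n x) - (\<integral>y. f y \<partial>\<nu>)) / e\<bar>"
          using f(2) e by (simp add: abs_divide)
        then have "1 \<le> ?q f x / (real n * e)\<^sup>2"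
          unfolding q[OF f(1)]
          using abs_le_square_iff[of 1 "((\<integral>y. f y \<partial>empirical_measure n x) - (\<integral>y. f y \<partial>\<nu>)) / e"] by simp
        also have "\<dots> \<le> (\<Sum>f\<in>S. ?q f x / (real n * e)\<^sup>2)"
          using f(1) S(1) by (intro member_le_sum[where f="\<lambda>f. ?q f x / (real n * e)\<^sup>2"]) auto
        finally have "2 * B * 1 \<le> 2 * B * (\<Sum>f\<in>S. ?q f x / (real n * e)\<^sup>2)"
          using B0 by (intro mult_left_mono) auto
        moreover have "\<bar>F (empirical_measure n x) - F \<nu>\<bar> \<le> 2 * B" using B[OF em, of x] B[OF \<nu>] by linarith
        ultimately show ?thesis using r by linarith
      qed
    qed
    also have "\<dots> = r / 2 + 2 * B * (\<Sum>f\<in>S. (\<integral>x. ?q f x \<partial>iid_law \<nu> n) / (real n * e)\<^sup>2)"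
      using qi by (simp add: \<nu>n.prob_space)
    also have "(\<Sum>f\<in>S. (\<integral>x. ?q f x \<partial>iid_law \<nu> n) / (real n * e)\<^sup>2) = (\<Sum>f\<in>S. v f / e\<^sup>2 / real n)"
    proof (rule sum.cong[OF refl])
      fix f assume f: "f \<in> S"
      show "(\<integral>x. ?q f x \<partial>iid_law \<nu> n) / (real n * e)\<^sup>2 = v f / e\<^sup>2 / real n"
        unfolding iid_second_moment[OF \<nu> db[OF f] d0[OF f]] v_def
        using n by (simp add: power_mult_distrib power2_eq_square)
    qed
    also have "2 * B * (\<Sum>f\<in>S. v f / e\<^sup>2 / real n) = C / real n"
      unfolding C_def times_divide_eq_right[symmetric] by (simp only: sum_divide_distrib)
    finally show ?thesis .
  qed
  have "(\<lambda>n. C / real n) \<longlonglongrightarrow> 0" by (rule lim_const_over_n)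
  then have "eventually (\<lambda>n. C / real n < r / 2) sequentially" using r by (intro order_tendstoD(2)) auto
  then obtain N where N: "\<And>n. n \<ge> N \<Longrightarrow> C / real n < r / 2" by (auto simp: eventually_sequentially)
  show "\<exists>no. \<forall>n\<ge>no. norm ((\<integral>x. F (empirical_measure n x) \<partial>iid_law \<nu> n) - F \<nu>) < r"
  proof (intro exI[of _ "max N 1"] allI impI)
    fix n assume "n \<ge> max N 1"
    then have "n \<ge> 1" "n \<ge> N" by auto
    from main[OF this(1)] N[OF this(2)]
    show "norm ((\<integral>x. F (empirical_measure n x) \<partial>iid_law \<nu> n) - F \<nu>) < r"
      unfolding real_norm_def by linarith
  qed
qed

section \<open>The limit theorem\<close>

lemma limsup_le_affine:
  fixes a :: "nat \<Rightarrow> ereal"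
  assumes "\<And>n. n \<ge> 1 \<Longrightarrow> a n \<le> ereal (C / real n + t)"
  shows "limsup a \<le> ereal t"
proof -
  have "(\<lambda>n. C / real n + t) \<longlonglongrightarrow> 0 + t" by (intro tendsto_add lim_const_over_n tendsto_const)
  then have "limsup (\<lambda>n. ereal (C / real n + t)) = ereal t"
    by (intro lim_imp_Limsup) (auto simp: trivial_limit_sequentially)
  moreover have "limsup a \<le> limsup (\<lambda>n. ereal (C / real n + t))"
    using assms by (intro Limsup_mono) (auto simp: eventually_sequentially)
  ultimately show ?thesis by simp
qed

lemma laws_with_conditionals_inD:
  assumes "\<mu> \<in> laws_with_conditionals_in M n"
  shows "prob_space \<mu>" "sets \<mu> = sets (borel_power n)" "space \<mu> = space (borel_power n)"
  using assms sets_eq_imp_space_eq[of \<mu> "borel_power n"]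
  by (auto simp: laws_with_conditionals_in_def space_prob_algebra)

text \<open>On the level set \<open>A j\<close> the function \<open>F\<close> is \<open>a j\<close> up to \<open>e\<close>, and every relative entropy exceeds
  \<open>a j - s\<close>; the deviation bound for this set cancels the growth of the integrand up to
  \<open>exp (n * (s + e))\<close>. Finitely many level sets suffice because \<open>F\<close> is bounded.\<close>

lemma laplace_upper_bound:
  fixes M :: "'a::polish_space measure set" and F :: "'a measure \<Rightarrow> real"
  assumes M: "M \<subseteq> prob_measures" "M \<noteq> {}" "convex_measures M" "compactin weak_topology M"
    and F: "continuous_map weak_topology euclideanreal F"
    and B: "\<And>\<tau>. \<tau> \<in> prob_measures \<Longrightarrow> \<bar>F \<tau>\<bar> \<le> B"
    and s: "\<And>\<nu> \<mu>. \<nu> \<in> prob_measures \<Longrightarrow> \<mu> \<in> M \<Longrightarrow> ereal (F \<nu>) - relative_entropy \<nu> \<mu> < ereal s"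
    and e: "e > 0"
  shows "\<exists>C. \<forall>n\<ge>1. \<forall>\<mu>\<in>laws_with_conditionals_in M n.
    (1 / real n) * ln (\<integral>x. exp (real n * F (empirical_measure n x)) \<partial>\<mu>) \<le> C / real n + (s + e)"
proof -
  obtain \<mu>\<^sub>0 where "\<mu>\<^sub>0 \<in> M" using M(2) by blast
  then have B0: "B \<ge> 0" using B[of \<mu>\<^sub>0] M(1) by force
  \<comment> \<open>Intervals of length \<open>e\<close> starting at \<open>- B\<close>; the first \<open>N\<close> of them cover the range of \<open>F\<close>.\<close>
  define a where "a j = - B + real j * e" for j
  define A where "A j = {\<tau> \<in> prob_measures. F \<tau> \<in> {a j..a j + e}}" for j
  obtain N where N: "2 * B / e < real N" using reals_Archimedean2 by blast
  then have N': "2 * B < real N * e" using e by (simp add: pos_divide_less_eq)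
  have N0: "N > 0" using N B0 e by (cases N) (auto simp: divide_less_0_iff)
  have closed: "closedin weak_topology (A j)" for j
    using closedin_continuous_map_preimage[OF F, of "{a j..a j + e}"] by (simp add: A_def)
  have large: "ereal (a j - s) < relative_entropy \<nu> \<mu>" if \<nu>: "\<nu> \<in> A j" and \<mu>: "\<mu> \<in> M" for j \<nu> \<mu>
  proof -
    have \<nu>P: "\<nu> \<in> prob_measures" and Fa: "a j \<le> F \<nu>" using \<nu> by (auto simp: A_def)
    show ?thesis
      using s[OF \<nu>P \<mu>] Fa relative_entropy_not_MInf[of \<mu> \<nu>] M(1) \<mu> \<nu>P
      by (cases "relative_entropy \<nu> \<mu>") auto
  qed
  have ex: "\<exists>m>0. \<forall>n\<ge>1. \<forall>\<mu>\<in>laws_with_conditionals_in M n.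
    measure \<mu> {x \<in> space \<mu>. empirical_measure n x \<in> A j} \<le> m * exp (- real n * (a j - s))" for j
    by (rule empirical_deviation_bound[OF M closed large])
  define m where "m j = (SOME m. m > 0 \<and> (\<forall>n\<ge>1. \<forall>\<mu>\<in>laws_with_conditionals_in M n.
    measure \<mu> {x \<in> space \<mu>. empirical_measure n x \<in> A j} \<le> m * exp (- real n * (a j - s))))" for j
  note m_dev = someI_ex[OF ex, folded m_def]
  have m: "m j > 0" for j using m_dev[of j] by (rule conjunct1)
  have dev: "measure \<mu> {x \<in> space \<mu>. empirical_measure n x \<in> A j} \<le> m j * exp (- real n * (a j - s))"
    if "n \<ge> 1" "\<mu> \<in> laws_with_conditionals_in M n" for j n \<mu>
    using m_dev[of j, THEN conjunct2, rule_format, OF that] .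
  define m' where "m' = (\<Sum>j<N. m j)"
  have m': "m' > 0" unfolding m'_def using m N0 by (intro sum_pos) auto
  have level: "\<exists>j<N. \<tau> \<in> A j" if \<tau>: "\<tau> \<in> prob_measures" for \<tau>
  proof -
    define j where "j = nat \<lfloor>(F \<tau> + B) / e\<rfloor>"
    have FB: "0 \<le> F \<tau> + B" "F \<tau> + B \<le> 2 * B" using B[OF \<tau>] by auto
    have "0 \<le> (F \<tau> + B) / e" using FB e by simp
    then have j: "real j \<le> (F \<tau> + B) / e" "(F \<tau> + B) / e < real j + 1"
      unfolding j_def by linarith+
    have "real j * e \<le> F \<tau> + B" "F \<tau> + B < (real j + 1) * e"
      using j e by (auto simp: pos_le_divide_eq pos_divide_less_eq)
    moreover from this have "real j * e < real N * e" using FB N' by linarith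
    then have "j < N" using e by simp
    ultimately show ?thesis using \<tau> by (intro exI[of _ j]) (auto simp: A_def a_def algebra_simps)
  qed
  show ?thesis
  proof (intro exI[of _ "ln m'"] allI impI ballI)
    fix n :: nat and \<mu> assume n: "n \<ge> 1" and \<mu>: "\<mu> \<in> laws_with_conditionals_in M n"
    interpret prob_space \<mu> by (rule laws_with_conditionals_inD(1)[OF \<mu>])
    have sets_\<mu> [measurable_cong]: "sets \<mu> = sets (borel_power n)" and sp: "space \<mu> = space (borel_power n)"
      by (rule laws_with_conditionals_inD[OF \<mu>])+
    note em = empirical_measure_in_prob_measures[OF n]
    let ?f = "\<lambda>x. exp (real n * F (empirical_measure n x))"
    let ?E = "\<lambda>j. {x \<in> space \<mu>. empirical_measure n x \<in> A j}"
    have E: "?E j \<in> sets \<mu>" for j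
      unfolding sp sets_\<mu> by (rule empirical_measure_vimage_measurable_closed[OF n closed])
    have [measurable]: "(\<lambda>x. F (empirical_measure n x)) \<in> borel_measurable (borel_power n)"
      by (rule empirical_functional_measurable[OF n F])
    have FB: "- B \<le> F (empirical_measure n x)" "F (empirical_measure n x) \<le> B" for x
      using B[OF em, of x] by auto
    have int: "integrable \<mu> ?f"
      using FB by (intro integrable_const_bound[where B="exp (real n * B)"]) (auto intro!: AE_I2 mult_left_mono)
    have pos: "0 < (\<integral>x. ?f x \<partial>\<mu>)"
    proof -
      have "(\<integral>x. exp (real n * (- B)) \<partial>\<mu>) \<le> (\<integral>x. ?f x \<partial>\<mu>)"
        by (intro integral_mono int) (use mult_left_mono[OF FB(1), of "real n"] in auto)
      then show ?thesis by (simp add: prob_space) (meson exp_gt_zero less_le_trans)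
    qed
    have "(\<integral>x. ?f x \<partial>\<mu>) \<le> (\<integral>x. (\<Sum>j<N. exp (real n * (a j + e)) * indicator (?E j) x) \<partial>\<mu>)"
    proof (rule integral_mono[OF int])
      show "integrable \<mu> (\<lambda>x. \<Sum>j<N. exp (real n * (a j + e)) * indicator (?E j) x)"
        using E by (intro Bochner_Integration.integrable_sum integrable_mult_right integrable_real_indicator)
          (auto simp: less_top[symmetric])
      fix x assume x: "x \<in> space \<mu>"
      obtain j where j: "j < N" "empirical_measure n x \<in> A j" using level[OF em] by blast
      have "?f x \<le> exp (real n * (a j + e)) * indicator (?E j) x"
        using j x by (auto simp: A_def intro!: mult_left_mono)
      also have "\<dots> \<le> (\<Sum>j<N. exp (real n * (a j + e)) * indicator (?E j) x)"
        using j by (intro member_le_sum[where f="\<lambda>j. exp (real n * (a j + e)) * indicator (?E j) x"]) auto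
      finally show "?f x \<le> (\<Sum>j<N. exp (real n * (a j + e)) * indicator (?E j) x)" .
    qed
    also have "\<dots> = (\<Sum>j<N. exp (real n * (a j + e)) * measure \<mu> (?E j))"
      using E by (subst Bochner_Integration.integral_sum)
        (auto intro!: integrable_mult_right integrable_real_indicator simp: less_top[symmetric])
    also have "\<dots> \<le> (\<Sum>j<N. exp (real n * (a j + e)) * (m j * exp (- real n * (a j - s))))"
      by (intro sum_mono mult_left_mono dev n \<mu>) auto
    also have "\<dots> = (\<Sum>j<N. m j * exp (real n * (s + e)))"
    proof (rule sum.cong[OF refl])
      fix j
      have "exp (real n * (a j + e)) * exp (- real n * (a j - s)) = exp (real n * (s + e))"
        unfolding exp_add[symmetric] by (simp add: algebra_simps)
      then show "exp (real n * (a j + e)) * (m j * exp (- real n * (a j - s))) = m j * exp (real n * (s + e))"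
        by (simp add: mult.left_commute)
    qed
    also have "\<dots> = m' * exp (real n * (s + e))" by (simp add: m'_def sum_distrib_right)
    finally have "ln (\<integral>x. ?f x \<partial>\<mu>) \<le> ln (m' * exp (real n * (s + e)))"
      using pos m' by (subst ln_le_cancel_iff) auto
    also have "\<dots> = ln m' + real n * (s + e)" using m' by (simp add: ln_mult)
    finally show "(1 / real n) * ln (\<integral>x. ?f x \<partial>\<mu>) \<le> ln m' / real n + (s + e)"
      using n by (simp add: field_simps)
  qed
qed

theorem corollary5p4:
  fixes M :: "'a::polish_space measure set"
  assumes "M \<subseteq> prob_measures" and "M \<noteq> {}" and "convex_measures M" and "compactin weak_topology M"
  shows
    "(\<forall>F :: 'a measure \<Rightarrow> real.
        continuous_map weak_topology euclideanreal F \<and> bounded (F ` prob_measures) \<longrightarrow>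
        (\<lambda>n. SUP \<mu> \<in> laws_with_conditionals_in M n.
            ereal ((1 / real n) * ln (\<integral>x. exp (real n * F (empirical_measure n x)) \<partial>\<mu>)))
          \<longlonglongrightarrow> (SUP (\<nu>, \<mu>) \<in> prob_measures \<times> M. ereal (F \<nu>) - relative_entropy \<nu> \<mu>)) \<and>
     (\<forall>A. closedin weak_topology A \<longrightarrow>
        limsup (\<lambda>n. SUP \<mu> \<in> laws_with_conditionals_in M n.
            ereal (1 / real n) * log_ereal (measure \<mu> {x \<in> space \<mu>. empirical_measure n x \<in> A}))
          \<le> - (INF (\<nu>, \<mu>) \<in> A \<times> M. relative_entropy \<nu> \<mu>))"
proof (intro conjI allI impI)
  fix F :: "'a measure \<Rightarrow> real"
  assume "continuous_map weak_topology euclideanreal F \<and> bounded (F ` prob_measures)"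
  then have F: "continuous_map weak_topology euclideanreal F" and "bounded (F ` prob_measures)" by auto
  then obtain B where B: "\<And>\<tau>. \<tau> \<in> prob_measures \<Longrightarrow> \<bar>F \<tau>\<bar> \<le> B" by (auto simp: bounded_iff)
  let ?a = "\<lambda>n. SUP \<mu> \<in> laws_with_conditionals_in M n.
      ereal ((1 / real n) * ln (\<integral>x. exp (real n * F (empirical_measure n x)) \<partial>\<mu>))"
  let ?S = "SUP (\<nu>, \<mu>) \<in> prob_measures \<times> M. ereal (F \<nu>) - relative_entropy \<nu> \<mu>"
  have upper: "limsup ?a \<le> ?S"
  proof (rule dense_ge)
    fix t assume t: "?S < t"
    show "limsup ?a \<le> t"
    proof (cases t)
      case (real t')
      \<comment> \<open>The room between \<open>s\<close> and \<open>t\<close> is spent on the width of the level sets of \<open>F\<close>.\<close>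
      obtain s where s: "?S < ereal s" "ereal s < t" using ereal_dense2[OF t] by blast
      have "ereal (F \<nu>) - relative_entropy \<nu> \<mu> < ereal s" if "\<nu> \<in> prob_measures" "\<mu> \<in> M" for \<nu> \<mu>
        using that by (intro le_less_trans[OF _ s(1)] SUP_upper2[of "(\<nu>, \<mu>)"]) auto
      moreover have "t' - s > 0" using s(2) real by simp
      ultimately obtain C where C: "\<And>n \<mu>. n \<ge> 1 \<Longrightarrow> \<mu> \<in> laws_with_conditionals_in M n \<Longrightarrow>
          (1 / real n) * ln (\<integral>x. exp (real n * F (empirical_measure n x)) \<partial>\<mu>) \<le> C / real n + (s + (t' - s))"
        using laplace_upper_bound[OF assms F B, of s "t' - s"] by blast
      have "limsup ?a \<le> ereal t'"
      proof (rule limsup_le_affine[where C=C])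
        fix n :: nat assume "n \<ge> 1"
        from C[OF this] show "?a n \<le> ereal (C / real n + t')" by (intro SUP_least) simp
      qed
      then show ?thesis by (simp add: real)
    qed (use t in auto)
  qed
  have lower: "?S \<le> liminf ?a"
  proof (rule SUP_least, clarify)
    fix \<nu> \<mu> :: "'a measure" assume \<nu>: "\<nu> \<in> prob_measures" and \<mu>M: "\<mu> \<in> M"
    then have \<mu>: "\<mu> \<in> prob_measures" using assms(1) by auto
    show "ereal (F \<nu>) - relative_entropy \<nu> \<mu> \<le> liminf ?a"
    proof (cases "relative_entropy \<nu> \<mu>")
      case (real r)
      let ?b = "\<lambda>n. (\<integral>x. F (empirical_measure n x) \<partial>iid_law \<nu> n) - r"
      have "?b \<longlonglongrightarrow> F \<nu> - r" by (intro tendsto_diff law_of_large_numbers[OF \<nu> F B] tendsto_const)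
      then have "ereal (F \<nu> - r) = liminf (\<lambda>n. ereal (?b n))"
        by (intro lim_imp_Liminf[symmetric]) (auto simp: trivial_limit_sequentially)
      also have "\<dots> \<le> liminf ?a"
      proof (rule Liminf_mono, unfold eventually_sequentially, intro exI[of _ 1] allI impI)
        fix n :: nat assume n: "n \<ge> 1"
        have m: "(\<lambda>x. real n * F (empirical_measure n x)) \<in> borel_measurable (borel_power n)"
          using empirical_functional_measurable[OF n F] by measurable
        have bd: "\<bar>real n * F (empirical_measure n x)\<bar> \<le> real n * B" for x
          using B[OF empirical_measure_in_prob_measures[OF n]] by (simp add: abs_mult mult_left_mono)
        have "real n * ?b n \<le> ln (\<integral>x. exp (real n * F (empirical_measure n x)) \<partial>iid_law \<mu> n)"
          using gibbs_inequality_iid[OF \<mu> \<nu> real m bd] by (simp add: right_diff_distrib)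
        then have "?b n \<le> (1 / real n) * ln (\<integral>x. exp (real n * F (empirical_measure n x)) \<partial>iid_law \<mu> n)"
          using n by (simp add: field_simps)
        then show "ereal (?b n) \<le> ?a n"
          by (intro SUP_upper2[OF iid_law_in_laws[OF \<mu>M assms(1)]]) simp
      qed
      finally show ?thesis by (simp add: real)
    qed (use relative_entropy_not_MInf[OF \<mu> \<nu>] in auto)
  qed
  have "liminf ?a \<le> limsup ?a" by (rule Liminf_le_Limsup) simp
  then show "?a \<longlonglongrightarrow> ?S"
    using upper lower by (subst tendsto_iff_Liminf_eq_Limsup) auto
next
  fix A :: "'a measure set" assume A: "closedin weak_topology A"
  let ?J = "INF (\<nu>, \<mu>) \<in> A \<times> M. relative_entropy \<nu> \<mu>"
  let ?a = "\<lambda>n. SUP \<mu> \<in> laws_with_conditionals_in M n.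
      ereal (1 / real n) * log_ereal (measure \<mu> {x \<in> space \<mu>. empirical_measure n x \<in> A})"
  show "limsup ?a \<le> - ?J"
  proof (rule dense_ge)
    fix t assume t: "- ?J < t"
    show "limsup ?a \<le> t"
    proof (cases t)
      case (real t')
      then have "ereal (- t') < ?J" using t by (simp add: ereal_uminus_less_reorder)
      then have "ereal (- t') < relative_entropy \<nu> \<mu>" if "\<nu> \<in> A" "\<mu> \<in> M" for \<nu> \<mu>
        using that by (elim less_le_trans) (intro INF_lower2[of "(\<nu>, \<mu>)"], auto)
      from empirical_deviation_bound[OF assms A this] obtain m where m: "m > 0"
        and dev: "\<And>n \<mu>. n \<ge> 1 \<Longrightarrow> \<mu> \<in> laws_with_conditionals_in M n \<Longrightarrow>
          measure \<mu> {x \<in> space \<mu>. empirical_measure n x \<in> A} \<le> m * exp (- real n * (- t'))"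
        by blast
      have "limsup ?a \<le> ereal t'"
      proof (rule limsup_le_affine[where C="ln m"], rule SUP_least)
        fix n :: nat and \<mu> assume n: "n \<ge> 1" and \<mu>: "\<mu> \<in> laws_with_conditionals_in M n"
        let ?p = "measure \<mu> {x \<in> space \<mu>. empirical_measure n x \<in> A}"
        show "ereal (1 / real n) * log_ereal ?p \<le> ereal (ln m / real n + t')"
        proof (cases "?p = 0")
          case True
          then show ?thesis using n by (simp add: log_ereal_def)
        next
          case False
          then have "?p > 0" by (simp add: zero_less_measure_iff)
          then have "ln ?p \<le> ln (m * exp (real n * t'))"
            using dev[OF n \<mu>] m by (subst ln_le_cancel_iff) auto
          also have "\<dots> = ln m + real n * t'" using m by (simp add: ln_mult)
          finally have "(1 / real n) * ln ?p \<le> ln m / real n + t'" using n by (simp add: field_simps)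
          then show ?thesis using False by (simp add: log_ereal_def)
        qed
      qed
      then show ?thesis by (simp add: real)
    qed (use t in auto)
  qed
qed

end
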